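(* Let $X$ be a transient Borel right process with $\alpha$-potential densities $u^\alpha(x,y)$ with respect to $m$, and let $\nu$ be the associated measure $\nu(F)=\int_S Q^{z,z}(F)\,dm(z)$, as described in the context. Then for any integer $k\ge 1$, any $\alpha>0$, and any bounded measurable functions $f_1,\ldots,f_k$ on $S$ with compact support, $$\nu\left(\prod_{j=1}^{k}\int_{0}^{\infty} f_{j}(X_{t_{j}})\,dt_{j}\;e^{-\alpha\zeta}\right)=\sum_{\pi\in\mathcal{P}_{k}}\int u^{\alpha}(z,x_{1})\,u^{\alpha}(x_{1},x_{2})\cdots u^{\alpha}(x_{k-1},x_k)\,u^{\alpha}(x_{k},z)\prod_{j=1}^{k}f_{\pi_{j}}(x_{j})\,dm(x_{j})\,dm(z),$$ where $\mathcal{P}_k$ is the set of permutations of $\{1,\ldots,k\}$, and both sides are finite.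
   Context: Setting. $S$ is a locally compact space with countable base, and $X=(\Omega,\mathcal{F}_t,X_t,\theta_t,P^x)$ is a transient Borel right process with state space $S$ and transition semigroup $(P_t)_{t\ge 0}$. It is in canonical form: $\Omega$ is the set of right continuous paths $\omega:[0,\infty)\to S_\Delta=S\cup\{\Delta\}$, $\Delta\notin S$, such that $\omega(t)=\Delta$ for all $t\ge\zeta(\omega)=\inf\{t>0:\omega(t)=\Delta\}$, and $X_t(\omega)=\omega(t)$. Functions on $S$ are extended by $0$ at $\Delta$. $m$ is a Borel measure on $S$, finite on compact sets. No transition densities are assumed, but $X$ has strictly positive potential densities $u^\alpha(x,y)$, $\alpha\ge 0$, with respect to $m$: $\int_0^\infty e^{-\alpha t}P_t(x,dy)\,dt=u^\alpha(x,y)\,m(dy)$, and these satisfy the resolvent equations $u^\alpha(x,y)=u^\beta(x,y)+(\beta-\alpha)\int u^\alpha(x,z)u^\beta(z,y)\,dm(z)=u^\beta(x,y)+(\beta-\alpha)\int u^\beta(x,z)u^\alpha(z,y)\,dm(z)$ for $0\le\alpha\le\beta$. Write $u=u^0$. It is assumed that $u(x,y)$ is excessive in $x$ for each fixed $y$, that $u(x,x)=\infty$ for all $x$ and $u(x,y)<\infty$ for $x\ne y$, and that all points of $S$ are polar. It is also assumed that for every compact $K\subseteq S$, $$\sup_{x}\int_{K}\big(u(x,y)+u(y,x)\big)^{2}\,dm(y)<\infty,$$ and that for any $\alpha>0$, any compact $K\subseteq S$, and any compact neighborhood $\widetilde K$ of $K$, $$\sup_{z\in\widetilde K^{c},\,x\in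 K}u^{\alpha}(z,x)<\infty.$$ The measures $Q^{z,z}$. Fix $z\in S$, put $h_z(x)=u(x,z)$, and on $S_z=S\setminus\{z\}$ let $P^z_t(x,dy)=P_t(x,dy)\,h_z(y)/h_z(x)$. The $\sigma$-finite measures $\eta^z_t(dx)=P_t(z,dx)h_z(x)$, $t>0$, form an entrance law for $(P^z_t)$. $Q^{z,z}$ is the measure on $\Omega$ (carried by paths with $X_0=z$ and $\zeta>0$) under which $(X_t)_{t>0}$ is the right process with one-dimensional distributions $\eta^z_t$ on $S$ and transition semigroup $(P^z_t)$. Thus for $0<t_1<\cdots<t_k$, with $t_0=0$, $x_0=z$, and nonnegative measurable $f_j$ on $S$, $$Q^{z,z}\Big(\prod_{j=1}^k f_j(X_{t_j})\Big)=\int\prod_{j=1}^kP_{t_j-t_{j-1}}(x_{j-1},dx_j)\prod_{j=1}^kf_j(x_j)\;u(x_k,z).$$ The measure $\nu$ is $\nu(F)=\int_S Q^{z,z}(F)\,dm(z)$ for measurable $F$ on $\Omega$. *)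

theory Defs
  imports "HOL-Probability.Probability"
begin

section \<open>The state space with a cemetery\<close>

text \<open>
  \<open>'s option\<close> is \<open>S\<close> with the cemetery \<open>\<Delta> = None\<close> adjoined as an isolated point.
  With the point at infinity instead, path right continuity would only change for paths
  started at \<open>\<Delta>\<close>, and these do not matter below.
\<close>

instantiation option :: (topological_space) topological_space
begin

definition open_option :: "'a option set \<Rightarrow> bool"
  where "open_option U \<longleftrightarrow> open (Some -` U)"

instance
  by standard (auto simp: open_option_def vimage_Union)

end

definition ext0 :: "('s \<Rightarrow> 'b::zero) \<Rightarrow> 's option \<Rightarrow> 'b"
  where "ext0 f = case_option 0 f"


section \<open>Canonical path space\<close>

text \<open>Paths are functions on \<open>[0,\<infinity>)\<close>, extensional (\<open>undefined\<close>) at negative times.\<close>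

type_synonym 's path = "real \<Rightarrow> 's option"

definition lifetime :: "'s path \<Rightarrow> ereal"
  where "lifetime \<omega> = Inf {ereal t | t. t > 0 \<and> \<omega> t = None}"

definition paths :: "'s::topological_space path set"
  where "paths = {\<omega> \<in> extensional {0..}.
     (\<forall>t\<ge>0. (\<omega> \<longlongrightarrow> \<omega> t) (at_right t)) \<and>
     (\<forall>t\<ge>0. lifetime \<omega> \<le> ereal t \<longrightarrow> \<omega> t = None)}"

text \<open>\<open>path_algebra I\<close> is \<open>\<sigma>(X\<^sub>r : r \<in> I)\<close>; in particular \<open>path_algebra {0..s}\<close> is the
  natural filtration.\<close>

definition path_algebra :: "real set \<Rightarrow> 's::topological_space path measure"
  where "path_algebra I =
    vimage_algebra paths (\<lambda>\<omega>. restrict \<omega> I) (\<Pi>\<^sub>M t\<in>I. (borel :: 's option measure))"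

abbreviation path_space :: "'s::topological_space path measure"
  where "path_space \<equiv> path_algebra {0..}"

text \<open>\<open>exp (- \<alpha> \<zeta>)\<close> with the convention \<open>exp (- \<infinity>) = 0\<close>.\<close>

definition exp_lifetime :: "real \<Rightarrow> 's path \<Rightarrow> real"
  where "exp_lifetime \<alpha> \<omega> =
    (if lifetime \<omega> = \<infinity> then 0 else exp (- \<alpha> * real_of_ereal (lifetime \<omega>)))"


section \<open>Borel right processes\<close>

text \<open>
  Simple Markov property of the coordinate process under a (possibly infinite) measure \<open>M\<close>,
  at the times \<open>s \<in> T\<close>, relative to the natural filtration, with transition kernels \<open>K\<close> on \<open>S\<close>
  and \<open>\<Delta>\<close> as a trap.
\<close>

definition markov_property ::
  "real set \<Rightarrow> 's::topological_space path measure \<Rightarrow> (real \<Rightarrow> 's \<Rightarrow> 's measure) \<Rightarrow> bool"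
  where "markov_property T M K \<longleftrightarrow>
    (\<forall>s\<in>T. \<forall>t\<ge>0. \<forall>G \<in> borel_measurable (path_algebra {0..s}).
      \<forall>f \<in> borel_measurable borel.
        (\<integral>\<^sup>+\<omega>. (G \<omega> :: ennreal) * ext0 f (\<omega> (s + t)) \<partial>M) =
        (\<integral>\<^sup>+\<omega>. G \<omega> * ext0 (\<lambda>x. \<integral>\<^sup>+y. f y \<partial>K t x) (\<omega> s) \<partial>M))"

definition universally_measurable :: "('s::topological_space \<Rightarrow> ennreal) \<Rightarrow> bool"
  where "universally_measurable f \<longleftrightarrow>
    (\<forall>\<mu>. finite_measure \<mu> \<and> sets \<mu> = sets borel \<longrightarrow> f \<in> borel_measurable (completion \<mu>))"

definition excessive ::
  "(real \<Rightarrow> 's::topological_space \<Rightarrow> 's measure) \<Rightarrow> real \<Rightarrow> ('s \<Rightarrow> ennreal) \<Rightarrow> bool"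
  where "excessive P \<alpha> f \<longleftrightarrow> universally_measurable f \<and>
    (\<forall>x. \<forall>t\<ge>0. ennreal (exp (- \<alpha> * t)) * (\<integral>\<^sup>+y. f y \<partial>completion (P t x)) \<le> f x) \<and>
    (\<forall>x. ((\<lambda>t. ennreal (exp (- \<alpha> * t)) * (\<integral>\<^sup>+y. f y \<partial>completion (P t x))) \<longlongrightarrow> f x) (at_right 0))"

text \<open>
  \<open>P\<close> is the (sub-Markov, Borel) transition semigroup, \<open>Px x\<close> the law \<open>P\<^sup>x\<close> on the canonical
  path space. The last clause is the second of the \<^emph>\<open>hypotheses droites\<close>: \<open>\<alpha>\<close>-excessive functions
  are almost surely right continuous along the paths, under every initial law \<open>\<mu>\<close>.
\<close>

definition borel_right_process ::
  "(real \<Rightarrow> 's::topological_space \<Rightarrow> 's measure) \<Rightarrow> ('s \<Rightarrow> 's path measure) \<Rightarrow> bool"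
  where "borel_right_process P Px \<longleftrightarrow>
    (\<forall>t\<ge>0. P t \<in> borel \<rightarrow>\<^sub>M subprob_algebra borel) \<and>
    (\<forall>x. P 0 x = return borel x) \<and>
    (\<forall>s\<ge>0. \<forall>t\<ge>0. \<forall>x. P (s + t) x = P s x \<bind> P t) \<and>
    Px \<in> borel \<rightarrow>\<^sub>M prob_algebra path_space \<and>
    (\<forall>x. AE \<omega> in Px x. \<omega> 0 = Some x) \<and>
    (\<forall>x. markov_property {0..} (Px x) P) \<and>
    (\<forall>\<alpha>\<ge>0. \<forall>f. excessive P \<alpha> f \<longrightarrow>
      (\<forall>\<mu>. prob_space \<mu> \<and> sets \<mu> = sets borel \<longrightarrow>
        (AE \<omega> in \<mu> \<bind> Px. \<forall>t\<ge>0.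
          ((\<lambda>s. ext0 f (\<omega> s)) \<longlongrightarrow> ext0 f (\<omega> t)) (at_right t))))"

text \<open>Transience: the potential kernel is proper.\<close>

definition transient :: "(real \<Rightarrow> 's::topological_space \<Rightarrow> 's measure) \<Rightarrow> bool"
  where "transient P \<longleftrightarrow>
    (\<exists>q :: 's \<Rightarrow> real. q \<in> borel_measurable borel \<and> (\<forall>x. q x > 0) \<and>
      (\<forall>x. (\<integral>\<^sup>+t\<in>{0..}. (\<integral>\<^sup>+y. ennreal (q y) \<partial>P t x) \<partial>lborel) < \<infinity>))"

text \<open>The hitting time \<open>inf {t > 0. X\<^sub>t = y}\<close> is almost surely infinite. The hitting event is in
  general only analytic, hence the formulation by \<open>AE\<close>.\<close>

definition polar_point :: "('s::topological_space \<Rightarrow> 's path measure) \<Rightarrow> 's \<Rightarrow> bool"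
  where "polar_point Px y \<longleftrightarrow> (\<forall>x. AE \<omega> in Px x. \<forall>t>0. \<omega> t \<noteq> Some y)"

definition potential_densities ::
  "(real \<Rightarrow> 's::topological_space \<Rightarrow> 's measure) \<Rightarrow> 's measure \<Rightarrow>
   (real \<Rightarrow> 's \<Rightarrow> 's \<Rightarrow> ennreal) \<Rightarrow> bool"
  where "potential_densities P m u \<longleftrightarrow>
    (\<forall>\<alpha>\<ge>0. (\<lambda>(x, y). u \<alpha> x y) \<in> borel_measurable (borel \<Otimes>\<^sub>M borel)) \<and>
    (\<forall>\<alpha>\<ge>0. \<forall>x y. u \<alpha> x y > 0) \<and>
    (\<forall>\<alpha>\<ge>0. \<forall>x. \<forall>A\<in>sets borel.
      (\<integral>\<^sup>+t\<in>{0..}. ennreal (exp (- \<alpha> * t)) * emeasure (P t x) A \<partial>lborel) =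
      (\<integral>\<^sup>+y\<in>A. u \<alpha> x y \<partial>m))"

definition resolvent_equations ::
  "'s measure \<Rightarrow> (real \<Rightarrow> 's \<Rightarrow> 's \<Rightarrow> ennreal) \<Rightarrow> bool"
  where "resolvent_equations m u \<longleftrightarrow>
    (\<forall>\<alpha> \<beta> x y. 0 \<le> \<alpha> \<and> \<alpha> \<le> \<beta> \<longrightarrow>
      u \<alpha> x y = u \<beta> x y + ennreal (\<beta> - \<alpha>) * (\<integral>\<^sup>+z. u \<alpha> x z * u \<beta> z y \<partial>m) \<and>
      u \<alpha> x y = u \<beta> x y + ennreal (\<beta> - \<alpha>) * (\<integral>\<^sup>+z. u \<beta> x z * u \<alpha> z y \<partial>m))"


section \<open>The measures \<open>Q\<^sup>z\<^sup>,\<^sup>z\<close> and \<open>\<nu>\<close>\<close>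

text \<open>
  The kernels \<open>P\<^sup>z\<^sub>t\<close> of the transform by \<open>h = u(\<cdot>,z)\<close>. They live on \<open>S - {z}\<close>; at \<open>x = z\<close>,
  where \<open>h z = \<infinity>\<close>, the formula below yields the null measure, and the points \<open>z\<close> are not charged.
\<close>

definition h_semigroup ::
  "(real \<Rightarrow> 's \<Rightarrow> 's measure) \<Rightarrow> ('s \<Rightarrow> ennreal) \<Rightarrow> real \<Rightarrow> 's \<Rightarrow> 's measure"
  where "h_semigroup P h t x = density (P t x) (\<lambda>y. h y / h x)"

definition entrance_law ::
  "(real \<Rightarrow> 's \<Rightarrow> 's measure) \<Rightarrow> ('s \<Rightarrow> ennreal) \<Rightarrow> 's \<Rightarrow> real \<Rightarrow> 's measure"
  where "entrance_law P h z t = density (P t z) h"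

text \<open>\<open>M\<close> is the measure \<open>Q\<^sup>z\<^sup>,\<^sup>z\<close>; these conditions determine it uniquely.\<close>

definition is_Qzz ::
  "(real \<Rightarrow> 's::topological_space \<Rightarrow> 's measure) \<Rightarrow> ('s \<Rightarrow> 's \<Rightarrow> ennreal) \<Rightarrow> 's \<Rightarrow>
   's path measure \<Rightarrow> bool"
  where "is_Qzz P u z M \<longleftrightarrow>
    space M = space path_space \<and> sets M = sets path_space \<and>
    (AE \<omega> in M. \<omega> 0 = Some z \<and> lifetime \<omega> > 0) \<and>
    (\<forall>t>0. \<forall>A\<in>sets borel.
      emeasure M {\<omega> \<in> space M. \<omega> t \<in> Some ` A} =
      emeasure (entrance_law P (\<lambda>x. u x z) z t) A) \<and>
    markov_property {0<..} M (h_semigroup P (\<lambda>x. u x z))"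

definition nu :: "'s::topological_space measure \<Rightarrow> ('s \<Rightarrow> 's path measure) \<Rightarrow> 's path measure"
  where "nu m Q = measure_of (space path_space) (sets path_space)
    (\<lambda>A. \<integral>\<^sup>+z. emeasure (Q z) A \<partial>m)"

text \<open>\<open>u(z,x\<^sub>1) u(x\<^sub>1,x\<^sub>2) \<dots> u(x\<^sub>k\<^sub>-\<^sub>1,x\<^sub>k) u(x\<^sub>k,z)\<close>\<close>

definition cyclic_product ::
  "('s \<Rightarrow> 's \<Rightarrow> ennreal) \<Rightarrow> nat \<Rightarrow> 's \<Rightarrow> (nat \<Rightarrow> 's) \<Rightarrow> ennreal"
  where "cyclic_product v k z x =
    v z (x 1) * (\<Prod>j\<in>{1..<k}. v (x j) (x (Suc j))) * v (x k) z"

end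

theory Submission
  imports Defs "HOL-Combinatorics.Multiset_Permutations"
begin

text \<open>
  Fix \<open>z\<close> and write \<open>h = u(\<cdot>,z)\<close>. Under \<open>Q\<^sup>z\<^sup>,\<^sup>z\<close> the process has entrance law \<open>P\<^sub>t(z,dx) h(x)\<close> and transition
  kernels \<open>P\<^sub>t(x,dy) h(y) / h(x)\<close>. For times \<open>0 < t\<^sub>1 < \<dots> < t\<^sub>k\<close> the factors \<open>h\<close> telescope: only \<open>h(x\<^sub>k)\<close>
  survives in the law of \<open>(X(t\<^sub>1), \<dots>, X(t\<^sub>k))\<close>. Given \<open>X(t\<^sub>k) = x\<^sub>k\<close>, for \<open>t = t\<^sub>k\<close> the identity
  \<open>exp(-\<alpha>\<zeta>) = exp(-\<alpha>t) (1 - \<alpha> \<integral>\<^sub>0\<^sup>\<infinity> exp(-\<alpha>r) 1{\<zeta> > t + r} dr)\<close> on \<open>{\<zeta> > t}\<close> and the resolvent equation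
  \<open>h = u\<^sup>\<alpha>(\<cdot>,z) + \<alpha> U\<^sup>\<alpha>h\<close> show that \<open>exp(-\<alpha>\<zeta>)\<close> has conditional mean \<open>exp(-\<alpha>t\<^sub>k) u\<^sup>\<alpha>(x\<^sub>k,z) / h(x\<^sub>k)\<close>
  (\<open>Q_exp_lifetime\<close>), so that the last \<open>h\<close> disappears as well. The discount \<open>exp(-\<alpha>t\<^sub>k)\<close> is distributed over the
  time increments, and integrating these out turns every transition kernel into a density \<open>u\<^sup>\<alpha>\<close>.
  Hence the integral over \<open>t\<^sub>1 < \<dots> < t\<^sub>k\<close> is the chain \<open>u\<^sup>\<alpha>(z,x\<^sub>1) \<cdots> u\<^sup>\<alpha>(x\<^sub>k,z)\<close> integrated against \<open>m\<close>
  (\<open>Q_ordered_functional_total\<close>).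

  The product of the time integrals is the sum of such ordered integrals over all orderings of the indices
  (\<open>prod_time_integrals_eq_sum_orderings\<close>); this is where the permutations come from. Integrating over \<open>z\<close> gives
  the formula for nonnegative functions (\<open>loop_moment_formula_nonneg\<close>). That \<open>\<nu>\<close> may be computed by integrating over \<open>z\<close>
  rests on the measurability of \<open>z \<mapsto> Q\<^sup>z\<^sup>,\<^sup>z\<close>, which follows from that of the finite dimensional
  distributions once the infinite measures \<open>Q\<^sup>z\<^sup>,\<^sup>z\<close> are made finite by a weight depending measurably on \<open>z\<close>.

  For finiteness (\<open>cyclic_integral_finite\<close>) the variable \<open>z\<close> is integrated first: for \<open>x\<^sub>1\<close>, \<open>x\<^sub>k\<close> in a compact set \<open>K\<close>
  the integral of \<open>u\<^sup>\<alpha>(x\<^sub>k,z) u\<^sup>\<alpha>(z,x\<^sub>1)\<close> is bounded: near \<open>K\<close> by the square integrability hypothesis, and away from \<open>K\<close>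
  because there \<open>u\<^sup>\<alpha>(\<cdot>,x\<^sub>1)\<close> is bounded while \<open>u\<^sup>\<alpha>(x\<^sub>k,\<cdot>)\<close> has integral at most \<open>1/\<alpha>\<close>. The remaining variables
  run over \<open>K\<close> and are integrated one after the other. Signed functions are reduced to nonnegative ones by expanding
  the product of the differences of positive and negative parts.
\<close>

section \<open>Measurability on the path space\<close>

lemma open_Some_image: "open U \<Longrightarrow> open (Some ` U)"
  by (simp add: open_option_def inj_vimage_image_eq)

lemma open_None: "open {None}"
  unfolding open_option_def by (simp add: vimage_def)

lemma None_in_sets [measurable]: "{None} \<in> sets borel"
  by (rule borel_open) (rule open_None)

lemma measurable_the [measurable]: "the \<in> borel_measurable borel"
proof (rule borel_measurableI)
  fix U :: "'a set" assume U: "open U"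
  have "the -` U = Some ` U \<union> (if the None \<in> U then {None} else {})"
    by (auto simp: image_iff) (metis option.exhaust_sel)+
  moreover have "open \<dots>"
    using open_Some_image[OF U] open_None open_Un[of "Some ` U" "{None}"] by auto
  ultimately show "the -` U \<inter> space borel \<in> sets borel"
    by simp
qed

lemma ext0_simps [simp]: "ext0 f None = 0" "ext0 f (Some x) = f x"
  by (simp_all add: ext0_def)

lemma ext0_eq_if: "ext0 f x = (if x \<in> {None} then 0 else f (the x))"
  by (cases x) auto

text \<open>
  The function may depend on a parameter, because the transforms by \<open>u(\<cdot>,z)\<close> vary with \<open>z\<close>.
\<close>

lemma measurable_ext0 [measurable (raw)]:
  fixes \<phi> :: "'a \<Rightarrow> 's::topological_space \<Rightarrow> 'b::{zero,topological_space}"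
  assumes [measurable]: "(\<lambda>(y, x). \<phi> y x) \<in> borel_measurable (N \<Otimes>\<^sub>M borel)" "g \<in> N \<rightarrow>\<^sub>M borel"
  shows "(\<lambda>y. ext0 (\<phi> y) (g y)) \<in> borel_measurable N"
proof -
  have "(\<lambda>y. case_prod \<phi> (y, the (g y))) \<in> borel_measurable N"
    by measurable
  then have [measurable]: "(\<lambda>y. \<phi> y (the (g y))) \<in> borel_measurable N"
    by simp
  show ?thesis
    unfolding ext0_eq_if by measurable
qed

lemma space_path_algebra [simp]: "space (path_algebra I) = paths"
  by (simp add: path_algebra_def)

lemma measurable_coord:
  assumes "r \<in> I"
  shows "(\<lambda>\<omega>. \<omega> r) \<in> path_algebra I \<rightarrow>\<^sub>M (borel :: 's::topological_space option measure)"
proof -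
  have "(\<lambda>\<omega>. restrict \<omega> I) \<in> path_algebra I \<rightarrow>\<^sub>M (\<Pi>\<^sub>M t\<in>I. (borel :: 's option measure))"
    unfolding path_algebra_def by (rule measurable_vimage_algebra1) (auto simp: space_PiM)
  from measurable_compose[OF this measurable_component_singleton[OF assms]]
  show ?thesis using assms by simp
qed

lemma path_algebra_mono:
  assumes "I \<subseteq> J"
  shows "sets (path_algebra I) \<subseteq> sets (path_algebra J :: 's::topological_space path measure)"
  unfolding path_algebra_def[of I]
proof (rule sets_image_in_sets)
  show "(\<lambda>\<omega>. restrict \<omega> I) \<in> path_algebra J \<rightarrow>\<^sub>M (\<Pi>\<^sub>M t\<in>I. (borel :: 's option measure))"
    using assms by (intro measurable_restrict measurable_coord) auto
qed simp

lemma measurable_path_algebra_mono: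
  "G \<in> path_algebra I \<rightarrow>\<^sub>M N \<Longrightarrow> I \<subseteq> J \<Longrightarrow> G \<in> path_algebra J \<rightarrow>\<^sub>M N"
  using measurable_mono[of N N "path_algebra I" "path_algebra J"] path_algebra_mono[of I J] by auto

text \<open>
  Being locally compact and Hausdorff, \<open>S\<close> is regular, so a point of an open set \<open>U\<close> has a basic neighbourhood whose closure
  stays in \<open>U\<close>; this makes \<open>X\<^sub>t \<in> U\<close> a countable condition on approximations of \<open>X\<^sub>t\<close>.
\<close>

lemma countable_regular_basis:
  assumes lc: "locally_compact_space (euclidean :: 's::{t2_space, second_countable_topology} topology)"
  obtains B :: "'s::{t2_space, second_countable_topology} set set" where "countable B" "\<And>V. V \<in> B \<Longrightarrow> open V"
    "\<And>U x. open U \<Longrightarrow> x \<in> U \<Longrightarrow> \<exists>V\<in>B. x \<in> V \<and> closure V \<subseteq> U"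
proof -
  obtain B :: "'s set set" where B: "countable B" "topological_basis B"
    using ex_countable_basis by blast
  have "Hausdorff_space (euclidean :: 's topology)"
    unfolding Hausdorff_space_def disjnt_def using hausdorff by (auto simp: open_openin[symmetric])
  then have reg: "regular_space (euclidean :: 's topology)"
    using lc by (rule locally_compact_Hausdorff_imp_regular_space[rotated])
  have "\<exists>V\<in>B. x \<in> V \<and> closure V \<subseteq> U" if U: "open U" "x \<in> U" for U :: "'s set" and x
  proof -
    have "closedin euclidean (- U)" "x \<in> topspace euclidean - (- U)"
      using U by auto
    with reg obtain V W where VW: "open V" "open W" "x \<in> V" "- U \<subseteq> W" "disjnt V W"
      unfolding regular_space_def by (metis open_openin)
    then obtain V' where V': "V' \<in> B" "x \<in> V'" "V' \<subseteq> V"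
      using topological_basisE[OF B(2) VW(1,3)] by blast
    have "closure V' \<subseteq> - W"
      using VW V' by (intro closure_minimal) (auto simp: disjnt_def)
    with V' VW show ?thesis by blast
  qed
  then show ?thesis
    using B topological_basis_open by (intro that[of B]) blast+
qed

text \<open>
  Right continuity makes the process jointly measurable: \<open>X\<^sub>t\<close> is the limit of \<open>X\<close> at the
  next grid point to the right of \<open>t\<close>.
\<close>

lemma measurable_process:
  assumes lc: "locally_compact_space (euclidean :: 's::{t2_space, second_countable_topology} topology)"
  shows "(\<lambda>(t, \<omega>). \<omega> t) \<in> borel \<Otimes>\<^sub>M path_space \<rightarrow>\<^sub>M (borel :: 's option measure)"
proof -
  obtain B :: "'s set set" where B: "countable B" "\<And>V. V \<in> B \<Longrightarrow> open V"
    "\<And>U x. open U \<Longrightarrow> x \<in> U \<Longrightarrow> \<exists>V\<in>B. x \<in> V \<and> closure V \<subseteq> U"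
    using countable_regular_basis[OF lc] by blast
  let ?M = "(borel :: real measure) \<Otimes>\<^sub>M (path_space :: 's path measure)"
  \<comment> \<open>the first multiple of \<open>1/(n+1)\<close> strictly to the right of \<open>t\<close>\<close>
  define d where "d n t = (real_of_int \<lfloor>real (Suc n) * t\<rfloor> + 1) / real (Suc n)" for n t
  define X where "X n t \<omega> = (\<omega> (max 0 (d n (max t 0))) :: 's option)" for n t \<omega>
  have d_gt: "t < d n t" for n t
  proof -
    have "real (Suc n) * t < real_of_int \<lfloor>real (Suc n) * t\<rfloor> + 1" by linarith
    then show ?thesis by (simp add: d_def field_simps del: of_nat_Suc)
  qed
  have d_le: "d n t \<le> t + inverse (real (Suc n))" for n t
  proof -
    have "real_of_int \<lfloor>real (Suc n) * t\<rfloor> + 1 \<le> real (Suc n) * t + 1" by linarith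
    then show ?thesis by (simp add: d_def field_simps del: of_nat_Suc)
  qed
  have d_lim: "filterlim (\<lambda>n. d n t) (at_right t) sequentially" for t
  proof -
    have "(\<lambda>n. t + inverse (real (Suc n))) \<longlonglongrightarrow> t + 0"
      by (intro tendsto_intros LIMSEQ_inverse_real_of_nat)
    then have "(\<lambda>n. d n t) \<longlonglongrightarrow> t"
      by (intro tendsto_sandwich[of "\<lambda>_. t" "\<lambda>n. d n t" _ "\<lambda>n. t + inverse (real (Suc n))"]
          always_eventually allI less_imp_le[OF d_gt] d_le tendsto_const) simp
    then show ?thesis
      unfolding filterlim_at using d_gt by (simp add: less_imp_neq[symmetric])
  qed
  have lim: "\<forall>\<^sub>F n in sequentially. X n t \<omega> \<in> U"
    if "\<omega> \<in> paths" "0 \<le> t" "open U" "\<omega> t \<in> U" for \<omega> t U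
  proof -
    have "(\<omega> \<longlongrightarrow> \<omega> t) (at_right t)" using that by (auto simp: paths_def)
    then have "((\<lambda>n. \<omega> (d n t)) \<longlongrightarrow> \<omega> t) sequentially"
      using d_lim[of t] by (rule filterlim_compose)
    from topological_tendstoD[OF this that(3,4)]
    have ev: "\<forall>\<^sub>F n in sequentially. \<omega> (d n t) \<in> U" .
    have "max 0 (d n (max t 0)) = d n t" for n
      using d_gt[of t n] that by auto
    with ev show ?thesis
      unfolding X_def by simp
  qed
  have X_meas [measurable]: "(\<lambda>(t, \<omega>). X n t \<omega>) \<in> ?M \<rightarrow>\<^sub>M borel" for n
  proof -
    have "(\<lambda>p. (\<lambda>i p. snd p (max 0 ((real_of_int i + 1) / real (Suc n))))
        \<lfloor>real (Suc n) * max (fst p) 0\<rfloor> p) \<in> ?M \<rightarrow>\<^sub>M (borel :: 's option measure)"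
      by (rule measurable_compose_countable)
        (auto intro!: measurable_compose[OF measurable_snd measurable_coord])
    then show ?thesis by (simp add: X_def d_def case_prod_beta)
  qed
  have Some_meas: "Measurable.pred ?M (\<lambda>(t, \<omega>). \<omega> (max t 0) \<in> Some ` U)" if U: "open U" for U
  proof -
    have "(\<omega> (max t 0) \<in> Some ` U) \<longleftrightarrow>
        (\<exists>V\<in>{V\<in>B. closure V \<subseteq> U}. \<exists>N. \<forall>n\<in>{N..}. X n t \<omega> \<in> Some ` V)"
      (is "?L \<longleftrightarrow> ?R") if w: "\<omega> \<in> paths" for t \<omega>
    proof
      assume ?L
      then obtain x where x: "x \<in> U" "\<omega> (max t 0) = Some x" by auto
      obtain V where V: "V \<in> B" "x \<in> V" "closure V \<subseteq> U" using B(3)[OF U x(1)] by auto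
      have "\<forall>\<^sub>F n in sequentially. X n (max t 0) \<omega> \<in> Some ` V"
        using x V B(2) by (intro lim w open_Some_image) auto
      then have "\<exists>N. \<forall>n\<in>{N..}. X n t \<omega> \<in> Some ` V"
        by (auto simp: eventually_sequentially X_def)
      with V show ?R by auto
    next
      assume ?R
      then obtain V where V: "V \<in> B" "closure V \<subseteq> U"
        and ev: "\<forall>\<^sub>F n in sequentially. X n (max t 0) \<omega> \<in> Some ` V"
        unfolding eventually_sequentially X_def Ball_def by auto
      show ?L
      proof (rule ccontr)
        assume nL: "\<not> ?L"
        have "open (- (Some ` closure V))"
          by (simp add: open_option_def vimage_Compl inj_vimage_image_eq open_Compl)
        moreover have "\<omega> (max t 0) \<in> - (Some ` closure V)" using nL V by auto
        ultimately have "\<forall>\<^sub>F n in sequentially. X n (max t 0) \<omega> \<in> - (Some ` closure V)"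
          by (intro lim w) auto
        with ev have "\<forall>\<^sub>F n in sequentially. False"
          by eventually_elim (use closure_subset in auto)
        then show False by simp
      qed
    qed
    note eq = this
    have [measurable]: "Some ` V \<in> sets borel" if "V \<in> B" for V
      by (intro borel_open open_Some_image B(2) that)
    let ?E = "\<lambda>V. {p \<in> space ?M. \<exists>N. \<forall>n\<in>{N..}. X n (fst p) (snd p) \<in> Some ` V}"
    let ?B = "{V\<in>B. closure V \<subseteq> U}"
    have "?E V \<in> sets ?M"
      if "V \<in> ?B" for V
    proof -
      have [measurable]: "Some ` V \<in> sets borel" using that by auto
      have [measurable]: "(\<lambda>p. X n (fst p) (snd p)) \<in> ?M \<rightarrow>\<^sub>M borel" for n
        using X_meas[of n] by (simp add: case_prod_beta)
      show ?thesis by measurable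
    qed
    then have "(\<Union>V\<in>?B. ?E V)
        \<in> sets ?M"
      using B(1) by (intro sets.countable_UN'') auto
    also have "(\<Union>V\<in>?B. ?E V)
        = {p \<in> space ?M. \<exists>V\<in>?B. \<exists>N. \<forall>n\<in>{N..}. X n (fst p) (snd p) \<in> Some ` V}"
      by blast
    finally have "Measurable.pred ?M
        (\<lambda>p. \<exists>V\<in>?B. \<exists>N. \<forall>n\<in>{N..}. X n (fst p) (snd p) \<in> Some ` V)"
      by (simp add: pred_def)
    then show ?thesis
      by (rule measurable_cong[THEN iffD2, rotated])
        (clarsimp simp only: space_pair_measure space_path_algebra eq mem_Times_iff case_prod_beta)
  qed
  have Y: "(\<lambda>(t, \<omega>). \<omega> (max t 0)) \<in> ?M \<rightarrow>\<^sub>M (borel :: 's option measure)"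
  proof (rule borel_measurableI)
    fix O' :: "'s option set" assume "open O'"
    then have O: "open (Some -` O')" by (simp add: open_option_def)
    have N: "Measurable.pred ?M (\<lambda>(t, \<omega>). \<omega> (max t 0) \<in> Some ` UNIV)"
      by (rule Some_meas) simp
    have eq: "(\<lambda>(t, \<omega>). \<omega> (max t 0) \<in> O') =
      (\<lambda>p. (\<lambda>(t, \<omega>). \<omega> (max t 0) \<in> Some ` (Some -` O')) p
        \<or> (None \<in> O' \<and> \<not> (\<lambda>(t, \<omega>). \<omega> (max t 0) \<in> Some ` UNIV) p))"
      by (auto simp: fun_eq_iff image_iff) (metis option.exhaust)+
    have "Measurable.pred ?M (\<lambda>(t, \<omega>). \<omega> (max t 0) \<in> O')"
      unfolding eq by (intro pred_intros_logic Some_meas[OF O] N) simp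
    then show "(\<lambda>(t, \<omega>). \<omega> (max t 0)) -` O' \<inter> space ?M \<in> sets ?M"
      by (auto simp: pred_def vimage_def Int_def conj_commute case_prod_beta)
  qed
  have "(\<lambda>p. if fst p < 0 then undefined else (\<lambda>(t, \<omega>). \<omega> (max t 0)) p) \<in> ?M \<rightarrow>\<^sub>M (borel :: 's option measure)"
    by (intro measurable_If Y) auto
  then show ?thesis
    by (rule measurable_cong[THEN iffD2, rotated])
      (auto simp: space_pair_measure paths_def extensional_def max_def)
qed

lemma dead_iff_lifetime_le:
  assumes "\<omega> \<in> paths" "0 < t"
  shows "\<omega> t = None \<longleftrightarrow> lifetime \<omega> \<le> ereal t"
  using assms by (auto simp: paths_def lifetime_def intro: Inf_lower)

text \<open>
  A path stays at the cemetery, so \<open>\<zeta> < a\<close> is witnessed by a rational time.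
\<close>

lemma borel_measurable_lifetime [measurable]:
  "lifetime \<in> borel_measurable (path_space :: 's::topological_space path measure)"
proof (rule borel_measurableI_less)
  fix a :: ereal
  have "{\<omega> \<in> paths. lifetime \<omega> < a} =
      (\<Union>q\<in>{q\<in>\<rat>. 0 < q \<and> ereal q < a}. {\<omega> \<in> paths. \<omega> q \<in> {None :: 's option}})" (is "?L = ?R")
  proof
    show "?R \<subseteq> ?L"
      using dead_iff_lifetime_le by (auto intro: le_less_trans)
    show "?L \<subseteq> ?R"
    proof
      fix \<omega> assume w: "\<omega> \<in> ?L"
      then obtain t where t: "0 < t" "\<omega> t = None" "ereal t < a"
        by (auto simp: lifetime_def Inf_less_iff)
      obtain q where q: "q \<in> \<rat>" "t < q" "ereal q < a"
      proof -
        obtain r where r: "ereal t < ereal r" "ereal r < a"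
          using ereal_dense2[OF t(3)] by auto
        then obtain q where "q \<in> \<rat>" "t < q" "q < r"
          using Rats_dense_in_real[of t r] by auto
        moreover from \<open>q < r\<close> r(2) have "ereal q < a"
          by (intro less_trans[of "ereal q" "ereal r" a]) auto
        ultimately show ?thesis by (intro that)
      qed
      have "lifetime \<omega> \<le> ereal t"
        using w t dead_iff_lifetime_le[of \<omega> t] by auto
      then have "lifetime \<omega> \<le> ereal q"
        using q by (meson ereal_less_eq(3) less_imp_le order_trans)
      then have "\<omega> q = None" using w t q dead_iff_lifetime_le[of \<omega> q] by auto
      with w q t show "\<omega> \<in> ?R" by auto
    qed
  qed
  also have "\<dots> \<in> sets path_space"
  proof (intro sets.countable_UN'' ballI)
    show "countable {q\<in>\<rat>. 0 < q \<and> ereal q < a}"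
      by (rule countable_subset[OF _ countable_rat]) auto
    show "{\<omega> \<in> paths. \<omega> q \<in> {None :: 's option}} \<in> sets path_space"
      if "q \<in> {q\<in>\<rat>. 0 < q \<and> ereal q < a}" for q :: real
    proof -
      have [measurable]: "(\<lambda>\<omega>. \<omega> q) \<in> path_space \<rightarrow>\<^sub>M (borel :: 's option measure)"
        using that by (intro measurable_coord) auto
      have "{\<omega> \<in> space path_space. \<omega> q \<in> {None :: 's option}} \<in> sets path_space"
        by measurable
      then show ?thesis by simp
    qed
  qed
  finally show "{\<omega> \<in> space path_space. lifetime \<omega> < a} \<in> sets (path_space :: 's path measure)"
    by simp
qed

lemma borel_measurable_exp_lifetime [measurable]:
  "exp_lifetime \<alpha> \<in> borel_measurable (path_space :: 's::topological_space path measure)"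
  unfolding exp_lifetime_def[abs_def] by measurable

lemma exp_lifetime_nonneg: "0 \<le> exp_lifetime \<alpha> \<omega>"
  by (simp add: exp_lifetime_def)

section \<open>Products of time integrals as sums over orderings\<close>

text \<open>
  \<open>time_ordered c [\<phi>\<^sub>1, \<dots>, \<phi>\<^sub>k] s\<close> is the integral of \<open>c \<phi>\<^sub>1(t\<^sub>1) \<cdots> \<phi>\<^sub>k(t\<^sub>k)\<close> over the simplex
  \<open>s \<le> t\<^sub>1 \<le> \<cdots> \<le> t\<^sub>k\<close>.
\<close>

primrec time_ordered :: "ennreal \<Rightarrow> (real \<Rightarrow> ennreal) list \<Rightarrow> real \<Rightarrow> ennreal" where
  "time_ordered c [] s = c"
| "time_ordered c (\<phi> # \<phi>s) s = (\<integral>\<^sup>+t\<in>{s..}. \<phi> t * time_ordered c \<phi>s t \<partial>lborel)"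

text \<open>
  The moving lower end of the integration makes joint measurability of the integrand necessary.
\<close>

lemma borel_measurable_tail_integral [measurable (raw)]:
  fixes f :: "'a \<Rightarrow> real \<Rightarrow> ennreal"
  assumes [measurable]: "(\<lambda>(x, t). f x t) \<in> borel_measurable (M \<Otimes>\<^sub>M borel)" "g \<in> borel_measurable M"
  shows "(\<lambda>x. \<integral>\<^sup>+t\<in>{g x..}. f x t \<partial>lborel) \<in> borel_measurable M"
proof -
  have "(\<lambda>x. \<integral>\<^sup>+t. f x t * (if g x \<le> t then 1 else 0) \<partial>lborel) \<in> borel_measurable M"
    by measurable
  then show ?thesis by (simp add: indicator_def of_bool_def)
qed

lemma borel_measurable_time_ordered [measurable (raw)]:
  assumes [measurable]: "c \<in> borel_measurable M" "s \<in> borel_measurable M"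
    and "\<And>g. g \<in> set gs \<Longrightarrow> (\<lambda>(x, t). F g x t) \<in> borel_measurable (M \<Otimes>\<^sub>M borel)"
  shows "(\<lambda>x. time_ordered (c x) (map (\<lambda>g. F g x) gs) (s x)) \<in> borel_measurable M"
proof -
  have "(\<lambda>(x, s). time_ordered (c x) (map (\<lambda>g. F g x) gs) s) \<in> borel_measurable (M \<Otimes>\<^sub>M borel)"
    using assms(3)
  proof (induction gs)
    case Nil
    show ?case by simp
  next
    case (Cons g gs)
    have [measurable]: "(\<lambda>(x, s). time_ordered (c x) (map (\<lambda>g. F g x) gs) s) \<in> borel_measurable (M \<Otimes>\<^sub>M borel)"
      by (rule Cons.IH) (use Cons.prems in auto)
    have [measurable]: "(\<lambda>(x, t). F g x t) \<in> borel_measurable (M \<Otimes>\<^sub>M borel)"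
      using Cons.prems by auto
    show ?case by simp
  qed
  from measurable_compose[OF measurable_Pair[OF measurable_ident assms(2)] this]
  show ?thesis by (simp add: id_def)
qed

text \<open>
  Two times are ordered one way or the other, and the diagonal is a Lebesgue null set.
\<close>

lemma tail_integral_mult:
  fixes \<phi> \<psi> :: "real \<Rightarrow> ennreal"
  assumes [measurable]: "\<phi> \<in> borel_measurable borel" "\<psi> \<in> borel_measurable borel"
  shows "(\<integral>\<^sup>+t\<in>{s..}. \<phi> t \<partial>lborel) * (\<integral>\<^sup>+t\<in>{s..}. \<psi> t \<partial>lborel) =
    (\<integral>\<^sup>+t\<in>{s..}. \<phi> t * (\<integral>\<^sup>+r\<in>{t..}. \<psi> r \<partial>lborel) \<partial>lborel) +
    (\<integral>\<^sup>+t\<in>{s..}. \<psi> t * (\<integral>\<^sup>+r\<in>{t..}. \<phi> r \<partial>lborel) \<partial>lborel)"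
proof -
  let ?le = "\<lambda>t r. if t \<le> r then 1 else 0 :: ennreal"
  let ?\<phi> = "\<lambda>t. \<phi> t * indicator {s..} t" and ?\<psi> = "\<lambda>t. \<psi> t * indicator {s..} t"
  have null: "AE r in lborel. r \<noteq> t" for t :: real
    by (rule AE_lborel_singleton)
  have "(\<integral>\<^sup>+t. ?\<phi> t \<partial>lborel) * (\<integral>\<^sup>+r. ?\<psi> r \<partial>lborel) = (\<integral>\<^sup>+t. \<integral>\<^sup>+r. ?\<phi> t * ?\<psi> r \<partial>lborel \<partial>lborel)"
    by (simp add: nn_integral_cmult nn_integral_multc)
  also have "\<dots> = (\<integral>\<^sup>+t. \<integral>\<^sup>+r. ?\<phi> t * ?\<psi> r * ?le t r
      + ?\<phi> t * ?\<psi> r * ?le r t \<partial>lborel \<partial>lborel)"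
  proof (rule nn_integral_cong, rule nn_integral_cong_AE)
    fix t
    show "AE r in lborel. ?\<phi> t * ?\<psi> r = ?\<phi> t * ?\<psi> r * ?le t r
        + ?\<phi> t * ?\<psi> r * ?le r t"
      using null[of t] by eventually_elim auto
  qed
  also have "\<dots> = (\<integral>\<^sup>+t. \<integral>\<^sup>+r. ?\<phi> t * ?\<psi> r * ?le t r \<partial>lborel \<partial>lborel)
     + (\<integral>\<^sup>+t. \<integral>\<^sup>+r. ?\<phi> t * ?\<psi> r * ?le r t \<partial>lborel \<partial>lborel)"
    by (simp add: nn_integral_add)
  also have "(\<integral>\<^sup>+t. \<integral>\<^sup>+r. ?\<phi> t * ?\<psi> r * ?le r t \<partial>lborel \<partial>lborel)
     = (\<integral>\<^sup>+r. \<integral>\<^sup>+t. ?\<phi> t * ?\<psi> r * ?le r t \<partial>lborel \<partial>lborel)"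
    by (rule lborel_pair.Fubini') measurable
  also have "\<dots> = (\<integral>\<^sup>+t\<in>{s..}. \<psi> t * (\<integral>\<^sup>+r\<in>{t..}. \<phi> r \<partial>lborel) \<partial>lborel)"
  proof (intro nn_integral_cong)
    fix r
    have "(\<integral>\<^sup>+t. ?\<phi> t * ?\<psi> r * ?le r t \<partial>lborel)
        = (\<integral>\<^sup>+t. ?\<psi> r * (\<phi> t * indicator {r..} t) \<partial>lborel)"
      by (intro nn_integral_cong) (auto simp: indicator_def ac_simps)
    also have "\<dots> = ?\<psi> r * (\<integral>\<^sup>+t\<in>{r..}. \<phi> t \<partial>lborel)"
      by (rule nn_integral_cmult) measurable
    finally show "(\<integral>\<^sup>+t. ?\<phi> t * ?\<psi> r * ?le r t \<partial>lborel)
        = \<psi> r * (\<integral>\<^sup>+t\<in>{r..}. \<phi> t \<partial>lborel) * indicator {s..} r"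
      by (simp add: ac_simps)
  qed
  also have "(\<integral>\<^sup>+t. \<integral>\<^sup>+r. ?\<phi> t * ?\<psi> r * ?le t r \<partial>lborel \<partial>lborel)
      = (\<integral>\<^sup>+t\<in>{s..}. \<phi> t * (\<integral>\<^sup>+r\<in>{t..}. \<psi> r \<partial>lborel) \<partial>lborel)"
  proof (intro nn_integral_cong)
    fix t
    have "(\<integral>\<^sup>+r. ?\<phi> t * ?\<psi> r * ?le t r \<partial>lborel)
        = (\<integral>\<^sup>+r. ?\<phi> t * (\<psi> r * indicator {t..} r) \<partial>lborel)"
      by (intro nn_integral_cong) (auto simp: indicator_def ac_simps)
    also have "\<dots> = ?\<phi> t * (\<integral>\<^sup>+r\<in>{t..}. \<psi> r \<partial>lborel)"
      by (rule nn_integral_cmult) measurable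
    finally show "(\<integral>\<^sup>+r. ?\<phi> t * ?\<psi> r * ?le t r \<partial>lborel)
        = \<phi> t * (\<integral>\<^sup>+r\<in>{t..}. \<psi> r \<partial>lborel) * indicator {s..} t"
      by (simp add: ac_simps)
  qed
  finally show ?thesis .
qed

text \<open>
  In the induction step the new time comes either before the first of the other times or after it.
\<close>

lemma prod_tail_integral_first:
  fixes \<phi> :: "'i \<Rightarrow> real \<Rightarrow> ennreal"
  assumes "finite A" "A \<noteq> {}" and meas: "\<And>i. i \<in> A \<Longrightarrow> \<phi> i \<in> borel_measurable borel"
  shows "(\<Prod>i\<in>A. \<integral>\<^sup>+t\<in>{s..}. \<phi> i t \<partial>lborel) =
    (\<Sum>i\<in>A. \<integral>\<^sup>+t\<in>{s..}. \<phi> i t * (\<Prod>j\<in>A - {i}. \<integral>\<^sup>+r\<in>{t..}. \<phi> j r \<partial>lborel) \<partial>lborel)"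
  using assms
proof (induction A arbitrary: s rule: finite_ne_induct)
  case (singleton a)
  then show ?case by simp
next
  case (insert a A)
  let ?T = "\<lambda>i s. \<integral>\<^sup>+t\<in>{s..}. \<phi> i t \<partial>lborel"
  let ?R = "\<lambda>i t. \<Prod>j\<in>A - {i}. ?T j t"
  let ?H = "\<lambda>i t. \<integral>\<^sup>+r\<in>{t..}. \<phi> i r * ?R i r \<partial>lborel"
  have [measurable]: "\<phi> a \<in> borel_measurable borel" using insert.prems by auto
  have [measurable]: "\<phi> i \<in> borel_measurable borel" if "i \<in> A" for i using insert.prems that by auto
  note m = this
  have rest [measurable]: "(\<lambda>t. \<Prod>j\<in>B. ?T j t) \<in> borel_measurable borel" if "B \<subseteq> A" for B
    using that by (intro borel_measurable_prod_ennreal borel_measurable_tail_integral) auto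
  have "(\<Prod>i\<in>insert a A. ?T i s) = ?T a s * (\<Sum>i\<in>A. \<integral>\<^sup>+t\<in>{s..}. \<phi> i t * ?R i t \<partial>lborel)"
    using insert by simp
  also have "\<dots> = (\<Sum>i\<in>A. ?T a s * (\<integral>\<^sup>+t\<in>{s..}. \<phi> i t * ?R i t \<partial>lborel))"
    by (simp add: sum_distrib_left)
  also have "\<dots> = (\<Sum>i\<in>A. (\<integral>\<^sup>+t\<in>{s..}. \<phi> a t * ?H i t \<partial>lborel)
      + (\<integral>\<^sup>+t\<in>{s..}. \<phi> i t * ?R i t * ?T a t \<partial>lborel))"
    by (intro sum.cong refl tail_integral_mult borel_measurable_times_ennreal rest insert.prems) auto
  also have "\<dots> = (\<integral>\<^sup>+t\<in>{s..}. \<phi> a t * (\<Sum>i\<in>A. ?H i t) \<partial>lborel)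
      + (\<Sum>i\<in>A. \<integral>\<^sup>+t\<in>{s..}. \<phi> i t * ?R i t * ?T a t \<partial>lborel)"
  proof -
    have "(\<lambda>t. \<phi> a t * ?H i t * indicator {s..} t)
        \<in> borel_measurable lborel" if "i \<in> A" for i
    proof -
      have [measurable]: "(\<lambda>r. \<phi> i r * ?R i r) \<in> borel_measurable borel"
        using m[OF that] rest by (intro borel_measurable_times_ennreal) auto
      show ?thesis by measurable
    qed
    then show ?thesis
      by (simp add: sum.distrib sum_distrib_left sum_distrib_right nn_integral_sum)
  qed
  also have "\<dots> = (\<integral>\<^sup>+t\<in>{s..}. \<phi> a t * (\<Prod>j\<in>A. ?T j t) \<partial>lborel)
      + (\<Sum>i\<in>A. \<integral>\<^sup>+t\<in>{s..}. \<phi> i t * (\<Prod>j\<in>insert a A - {i}. ?T j t) \<partial>lborel)"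
  proof (intro arg_cong2[where f="(+)"] nn_integral_cong sum.cong refl)
    fix t show "\<phi> a t * (\<Sum>i\<in>A. ?H i t) * indicator {s..} t
        = \<phi> a t * (\<Prod>j\<in>A. ?T j t) * indicator {s..} t"
      using insert by simp
  next
    fix t i assume "i \<in> A"
    then have "insert a A - {i} = insert a (A - {i})" using insert by auto
    then show "\<phi> i t * ?R i t * ?T a t * indicator {s..} t
        = \<phi> i t * (\<Prod>j\<in>insert a A - {i}. ?T j t) * indicator {s..} t"
      using insert by (simp add: ac_simps)
  qed
  also have "\<dots> = (\<Sum>i\<in>insert a A. \<integral>\<^sup>+t\<in>{s..}. \<phi> i t * (\<Prod>j\<in>insert a A - {i}. ?T j t) \<partial>lborel)"
    using insert by simp
  finally show ?case .
qed

text \<open>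
  The earliest index is split off repeatedly; the choices made on the way list the index set.
\<close>

lemma prod_time_integrals_eq_sum_orderings:
  fixes \<phi> :: "'i \<Rightarrow> real \<Rightarrow> ennreal"
  assumes "finite A" and "\<And>i. i \<in> A \<Longrightarrow> \<phi> i \<in> borel_measurable borel"
  shows "c * (\<Prod>i\<in>A. \<integral>\<^sup>+t\<in>{s..}. \<phi> i t \<partial>lborel) =
    (\<Sum>xs\<in>permutations_of_set A. time_ordered c (map \<phi> xs) s)"
  using assms
proof (induction A arbitrary: s rule: finite_remove_induct)
  case empty
  then show ?case by simp
next
  case (remove A)
  let ?T = "\<lambda>i s. \<integral>\<^sup>+t\<in>{s..}. \<phi> i t \<partial>lborel"
  let ?R = "\<lambda>i t. \<Prod>j\<in>A - {i}. ?T j t"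
  let ?O = "\<lambda>xs. time_ordered c (map \<phi> xs)"
  have meas: "(\<lambda>t. ?O xs t) \<in> borel_measurable borel" if "set xs \<subseteq> A" for xs
  proof (rule borel_measurable_time_ordered)
    fix i assume "i \<in> set xs"
    then have [measurable]: "\<phi> i \<in> borel_measurable borel" using remove.prems that by auto
    show "(\<lambda>(x :: real, t). \<phi> i t) \<in> borel_measurable (borel \<Otimes>\<^sub>M borel)" by measurable
  qed auto
  have [measurable]: "\<phi> i \<in> borel_measurable borel" if "i \<in> A" for i using remove.prems that by auto
  have m2: "(\<lambda>t. ?O xs t) \<in> borel_measurable borel"
    if "xs \<in> permutations_of_set (A - {i})" for xs i
    using that by (intro meas) (auto simp: permutations_of_set_def)
  have m3: "(\<lambda>t. \<Prod>j\<in>A - {i}. ?T j t) \<in> borel_measurable borel" for i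
    by (intro borel_measurable_prod_ennreal borel_measurable_tail_integral) auto
  have "c * (\<Prod>i\<in>A. ?T i s) =
      (\<Sum>i\<in>A. \<integral>\<^sup>+t\<in>{s..}. \<phi> i t * (c * ?R i t) \<partial>lborel)"
  proof -
    have "c * (\<integral>\<^sup>+t\<in>{s..}. \<phi> i t * ?R i t \<partial>lborel)
        = (\<integral>\<^sup>+t\<in>{s..}. \<phi> i t * (c * ?R i t) \<partial>lborel)"
      if "i \<in> A" for i
      using m3[of i] remove.prems[OF that]
      by (subst nn_integral_cmult[symmetric]) (auto simp: ac_simps)
    moreover have "(\<Prod>i\<in>A. ?T i s) =
        (\<Sum>i\<in>A. \<integral>\<^sup>+t\<in>{s..}. \<phi> i t * ?R i t \<partial>lborel)"
      using remove.hyps remove.prems by (intro prod_tail_integral_first) auto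
    ultimately show ?thesis
      by (simp only: sum_distrib_left cong: sum.cong)
  qed
  also have "\<dots> = (\<Sum>i\<in>A. \<integral>\<^sup>+t\<in>{s..}. \<phi> i t * (\<Sum>xs\<in>permutations_of_set (A - {i}). ?O xs t) \<partial>lborel)"
  proof (intro sum.cong nn_integral_cong refl)
    fix i t assume "i \<in> A"
    then have "c * ?R i t
        = (\<Sum>xs\<in>permutations_of_set (A - {i}). ?O xs t)"
      using remove.IH[of i t] remove.prems by auto
    then show "\<phi> i t * (c * ?R i t) * indicator {s..} t
        = \<phi> i t * (\<Sum>xs\<in>permutations_of_set (A - {i}). ?O xs t) * indicator {s..} t"
      by (simp only:)
  qed
  also have "\<dots> = (\<Sum>i\<in>A. \<Sum>xs\<in>permutations_of_set (A - {i}). time_ordered c (map \<phi> (i # xs)) s)"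
  proof (intro sum.cong refl)
    fix i assume "i \<in> A"
    then have [measurable]: "\<phi> i \<in> borel_measurable borel" using remove.prems by auto
    have "(\<integral>\<^sup>+t\<in>{s..}. \<phi> i t * (\<Sum>xs\<in>permutations_of_set (A - {i}). ?O xs t) \<partial>lborel) =
       (\<integral>\<^sup>+t. (\<Sum>xs\<in>permutations_of_set (A - {i}). \<phi> i t * ?O xs t * indicator {s..} t) \<partial>lborel)"
      by (simp only: sum_distrib_left sum_distrib_right)
    also have "\<dots> = (\<Sum>xs\<in>permutations_of_set (A - {i}). time_ordered c (map \<phi> (i # xs)) s)"
      using m2 by (subst nn_integral_sum) auto
    finally show "(\<integral>\<^sup>+t\<in>{s..}. \<phi> i t * (\<Sum>xs\<in>permutations_of_set (A - {i}). ?O xs t) \<partial>lborel) =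
       (\<Sum>xs\<in>permutations_of_set (A - {i}). time_ordered c (map \<phi> (i # xs)) s)" .
  qed
  also have "\<dots> = (\<Sum>xs\<in>permutations_of_set A. ?O xs s)"
  proof -
    have eq: "permutations_of_set A = (\<Union>i\<in>A. (#) i ` permutations_of_set (A - {i}))"
      using remove.hyps by (intro permutations_of_set_nonempty)
    have "(\<Sum>xs\<in>permutations_of_set A. ?O xs s) =
        (\<Sum>i\<in>A. \<Sum>xs\<in>(#) i ` permutations_of_set (A - {i}). ?O xs s)"
      unfolding eq using remove.hyps by (intro sum.UNION_disjoint) auto
    then show ?thesis
      by (simp add: sum.reindex)
  qed
  finally show ?case .
qed

lemma bij_betw_permutes_permutations_of_set:
  "bij_betw (\<lambda>\<pi>. map \<pi> [1..<Suc k]) {\<pi>. \<pi> permutes {1..k}} (permutations_of_set {1..k})"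
proof (rule bij_betw_imageI)
  have inj: "inj_on (\<lambda>\<pi>. map \<pi> [1..<Suc k]) {\<pi>. \<pi> permutes {1..k}}"
  proof (rule inj_onI, clarify)
    fix \<pi> \<rho> :: "nat \<Rightarrow> nat"
    assume "\<pi> permutes {1..k}" "\<rho> permutes {1..k}" "map \<pi> [1..<Suc k] = map \<rho> [1..<Suc k]"
    then have "\<pi> x = \<rho> x" for x
      by (cases "x \<in> {1..k}") (auto simp: permutes_not_in simp del: upt_Suc)
    then show "\<pi> = \<rho>" by auto
  qed
  then show "inj_on (\<lambda>\<pi>. map \<pi> [1..<Suc k]) {\<pi>. \<pi> permutes {1..k}}" .
  show "(\<lambda>\<pi>. map \<pi> [1..<Suc k]) ` {\<pi>. \<pi> permutes {1..k}} = permutations_of_set {1..k}"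
  proof (rule card_subset_eq)
    show "(\<lambda>\<pi>. map \<pi> [1..<Suc k]) ` {\<pi>. \<pi> permutes {1..k}} \<subseteq> permutations_of_set {1..k}"
      by (auto simp: permutations_of_set_def distinct_map permutes_inj_on permutes_image
          atLeastLessThanSuc_atLeastAtMost simp del: upt_Suc)
    show "card ((\<lambda>\<pi>. map \<pi> [1..<Suc k]) ` {\<pi>. \<pi> permutes {1..k}}) = card (permutations_of_set {1..k})"
      using card_image[OF inj] by (simp add: card_permutations)
  qed simp
qed

section \<open>Transition kernels and potentials\<close>

lemma ext0_mult: "ext0 f x * ext0 g x = ext0 (\<lambda>y. f y * g y :: 'b::mult_zero) x"
  by (cases x) auto

lemma ext0_one_mult [simp]: "ext0 (\<lambda>_. 1) x * ext0 f x = ext0 (f :: _ \<Rightarrow> ennreal) x"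
  by (cases x) auto

text \<open>
  An identity for Borel sets extends to functions: the left-hand side is an integral with respect to the image under
  \<open>X\<close> of the weighted measure, restricted to the event that \<open>X\<close> is alive.
\<close>

lemma nn_integral_ext0_eqI:
  fixes N :: "'s::topological_space measure" and f :: "'s \<Rightarrow> ennreal"
  assumes [measurable]: "X \<in> M \<rightarrow>\<^sub>M borel" "w \<in> borel_measurable M" "f \<in> borel_measurable borel"
    and N: "sets N = sets borel"
    and eq: "\<And>A. A \<in> sets borel \<Longrightarrow> (\<integral>\<^sup>+\<omega>. w \<omega> * ext0 (indicator A) (X \<omega>) \<partial>M) = emeasure N A"
  shows "(\<integral>\<^sup>+\<omega>. w \<omega> * ext0 f (X \<omega>) \<partial>M) = (\<integral>\<^sup>+y. f y \<partial>N)"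
proof -
  define D where "D = distr (density M (\<lambda>\<omega>. w \<omega> * ext0 (\<lambda>_. 1) (X \<omega>))) borel (\<lambda>\<omega>. the (X \<omega>))"
  have ext0_the: "ext0 f v = ext0 (\<lambda>_. 1) v * f (the v)" for f :: "'s \<Rightarrow> ennreal" and v
    by (cases v) auto
  have D: "(\<integral>\<^sup>+y. f y \<partial>D) = (\<integral>\<^sup>+\<omega>. w \<omega> * ext0 f (X \<omega>) \<partial>M)"
    if [measurable]: "f \<in> borel_measurable borel" for f
    unfolding D_def
    by (subst nn_integral_distr, simp, simp, subst nn_integral_density)
      (auto intro!: nn_integral_cong simp: ext0_the[of f] ac_simps)
  have "D = N"
  proof (rule measure_eqI)
    show "sets D = sets N" by (simp add: D_def N)
    fix A assume "A \<in> sets D"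
    then have A: "A \<in> sets borel" by (simp add: D_def)
    then have "emeasure D A = (\<integral>\<^sup>+y. indicator A y \<partial>D)" by (simp add: D_def)
    also have "\<dots> = emeasure N A" using A by (simp add: D eq)
    finally show "emeasure D A = emeasure N A" .
  qed
  then show ?thesis using D[of f] by simp
qed

text \<open>
  The hypotheses from which the moment formula for nonnegative functions is derived, for a fixed discount \<open>\<alpha>\<close>.
\<close>

locale loop_process =
  fixes P :: "real \<Rightarrow> 's::{t2_space, second_countable_topology} \<Rightarrow> 's measure"
    and Px :: "'s \<Rightarrow> 's path measure"
    and m :: "'s measure"
    and u :: "real \<Rightarrow> 's \<Rightarrow> 's \<Rightarrow> ennreal"
    and Q :: "'s \<Rightarrow> 's path measure"
    and \<alpha> :: real
  assumes locally_compact: "locally_compact_space (euclidean :: 's topology)"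
    and right_process: "borel_right_process P Px"
    and sets_m [measurable_cong]: "sets m = sets borel"
    and finite_on_compacts: "\<And>K. compact K \<Longrightarrow> emeasure m K < \<infinity>"
    and densities: "potential_densities P m u"
    and resolvent: "resolvent_equations m u"
    and finite_off_diagonal: "\<And>x y. x \<noteq> y \<Longrightarrow> u 0 x y < \<infinity>"
    and polar: "\<And>y. polar_point Px y"
    and Q: "\<And>z. is_Qzz P (u 0) z (Q z)"
    and \<alpha>_pos: "\<alpha> > 0"
begin

lemma space_m [simp]: "space m = UNIV"
  using sets_eq_imp_space_eq[OF sets_m] by simp

lemma relatively_compact_neighbourhood:
  obtains U K where "open U" "compact K" "(x :: 's) \<in> U" "U \<subseteq> K"
proof -
  have "\<exists>U K. open U \<and> compact K \<and> x \<in> U \<and> U \<subseteq> K"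
    using locally_compact unfolding locally_compact_space_def by (simp add: open_openin[symmetric])
  with that show ?thesis by blast
qed

sublocale m: sigma_finite_measure m
proof
  obtain B :: "'s set set" where B: "countable B" "\<And>V. V \<in> B \<Longrightarrow> open V"
    "\<And>U x. open U \<Longrightarrow> x \<in> U \<Longrightarrow> \<exists>V\<in>B. x \<in> V \<and> closure V \<subseteq> U"
    using countable_regular_basis[OF locally_compact] by blast
  let ?A = "{closure V | V. V \<in> B \<and> compact (closure V)}"
  have "x \<in> \<Union>?A" for x
  proof -
    obtain U K where UK: "open U" "compact K" "x \<in> U" "U \<subseteq> K"
      by (rule relatively_compact_neighbourhood)
    obtain V where V: "V \<in> B" "x \<in> V" "closure V \<subseteq> U" using B(3)[OF UK(1,3)] by auto
    have "compact (K \<inter> closure V)" using UK by (intro compact_Int_closed) auto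
    also have "K \<inter> closure V = closure V" using V UK by auto
    finally show ?thesis using V closure_subset[of V] by blast
  qed
  moreover have "countable ?A"
    using countable_image[OF B(1), of closure] by (rule countable_subset[rotated]) auto
  ultimately show "\<exists>A. countable A \<and> A \<subseteq> sets m \<and> \<Union>A = space m \<and> (\<forall>a\<in>A. emeasure m a \<noteq> \<infinity>)"
    using finite_on_compacts by (intro exI[of _ ?A]) (auto simp: sets_m less_top)
qed

lemma measurable_u [measurable]:
  "(\<lambda>(x, y). u 0 x y) \<in> borel_measurable (borel \<Otimes>\<^sub>M borel)"
  "(\<lambda>(x, y). u \<alpha> x y) \<in> borel_measurable (borel \<Otimes>\<^sub>M borel)"
  using densities \<alpha>_pos by (auto simp: potential_densities_def)

lemma u_pos: "0 < u 0 x y" "0 < u \<alpha> x y"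
  using densities \<alpha>_pos by (auto simp: potential_densities_def)

lemma resolvent_at_0: "u 0 x y = u \<alpha> x y + ennreal \<alpha> * (\<integral>\<^sup>+w. u \<alpha> x w * u 0 w y \<partial>m)"
  using resolvent[unfolded resolvent_equations_def, rule_format, of 0 \<alpha> x y, THEN conjunct2] \<alpha>_pos
  by (simp only: diff_zero less_imp_le order_refl simp_thms)

lemma prob_space_Px: "prob_space (Px x)"
  and sets_Px [measurable_cong]: "sets (Px x) = sets path_space"
  and space_Px [simp]: "space (Px x) = paths"
proof -
  have "Px \<in> borel \<rightarrow>\<^sub>M prob_algebra path_space"
    using right_process by (simp add: borel_right_process_def)
  from measurable_space[OF this, of x] show "prob_space (Px x)" "sets (Px x) = sets path_space"
    by (auto simp: space_prob_algebra)
  then show "space (Px x) = paths"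
    using sets_eq_imp_space_eq[of "Px x" path_space] by simp
qed

lemma measurable_Px [measurable]: "Px \<in> borel \<rightarrow>\<^sub>M subprob_algebra path_space"
  using right_process by (auto simp: borel_right_process_def intro: measurable_prob_algebraD)

lemma sets_P [measurable_cong]: "0 \<le> t \<Longrightarrow> sets (P t x) = sets borel"
  and subprob_P: "0 \<le> t \<Longrightarrow> subprob_space (P t x)"
proof -
  assume "0 \<le> t"
  then have "P t \<in> borel \<rightarrow>\<^sub>M subprob_algebra borel"
    using right_process by (simp add: borel_right_process_def)
  from measurable_space[OF this, of x] show "sets (P t x) = sets borel" "subprob_space (P t x)"
    by (auto simp: space_subprob_algebra)
qed

lemma space_P [simp]: "0 \<le> t \<Longrightarrow> space (P t x) = UNIV"
  using sets_eq_imp_space_eq[OF sets_P] by simp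

lemma measurable_ext0_process [measurable (raw)]:
  fixes \<phi> :: "'a \<Rightarrow> 's \<Rightarrow> 'b::{zero,topological_space}"
  assumes "(\<lambda>(y, x). \<phi> y x) \<in> borel_measurable (N \<Otimes>\<^sub>M borel)"
    and "T \<in> borel_measurable N" "W \<in> N \<rightarrow>\<^sub>M path_space"
  shows "(\<lambda>y. ext0 (\<phi> y) (W y (T y))) \<in> borel_measurable N"
  by (rule measurable_ext0[OF assms(1)])
    (use measurable_compose[OF measurable_Pair[OF assms(2,3)] measurable_process[OF locally_compact]] in simp)

text \<open>
  The Markov property at time \<open>0\<close>. It transfers the joint measurability of the process in time and path to
  the transition kernels, which become jointly measurable in time and starting point.
\<close>

lemma nn_integral_P:
  assumes "0 \<le> t" and [measurable]: "f \<in> borel_measurable borel"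
  shows "(\<integral>\<^sup>+y. f y \<partial>P t x) = (\<integral>\<^sup>+\<omega>. ext0 f (\<omega> t) \<partial>Px x)"
proof -
  have "markov_property {0..} (Px x) P" "AE \<omega> in Px x. \<omega> 0 = Some x"
    using right_process by (auto simp: borel_right_process_def)
  then have eq: "(\<integral>\<^sup>+\<omega>. 1 * ext0 f (\<omega> (0 + t)) \<partial>Px x)
      = (\<integral>\<^sup>+\<omega>. 1 * ext0 (\<lambda>x. \<integral>\<^sup>+y. f y \<partial>P t x) (\<omega> 0) \<partial>Px x)"
    unfolding markov_property_def using assms
    by (elim ballE[where x=0] allE[where x=t] impE ballE[where x="\<lambda>_. 1"] ballE[where x=f]) auto
  have "(\<integral>\<^sup>+\<omega>. 1 * ext0 (\<lambda>x. \<integral>\<^sup>+y. f y \<partial>P t x) (\<omega> 0) \<partial>Px x) = (\<integral>\<^sup>+\<omega>. (\<integral>\<^sup>+y. f y \<partial>P t x) \<partial>Px x)"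
    using \<open>AE \<omega> in Px x. \<omega> 0 = Some x\<close> by (intro nn_integral_cong_AE) auto
  also have "\<dots> = (\<integral>\<^sup>+y. f y \<partial>P t x)"
    using prob_space.emeasure_space_1[OF prob_space_Px] by simp
  finally show ?thesis using eq by simp
qed

lemma borel_measurable_P_integral:
  assumes [measurable]: "f \<in> borel_measurable borel" "T \<in> borel_measurable N" "X \<in> N \<rightarrow>\<^sub>M borel"
    and T: "\<And>y. y \<in> space N \<Longrightarrow> 0 \<le> T y"
  shows "(\<lambda>y. \<integral>\<^sup>+x. f x \<partial>P (T y) (X y)) \<in> borel_measurable N"
proof -
  have "(\<lambda>y. \<integral>\<^sup>+\<omega>. ext0 f (\<omega> (T y)) \<partial>Px (X y)) \<in> borel_measurable N"
    by (rule nn_integral_measurable_subprob_algebra2[where N=path_space]) measurable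
  then show ?thesis
    by (rule measurable_cong[THEN iffD1, rotated]) (simp add: nn_integral_P T)
qed

lemma potential_integral:
  assumes "0 \<le> \<beta>" and [measurable]: "f \<in> borel_measurable borel"
  shows "(\<integral>\<^sup>+t\<in>{0..}. ennreal (exp (- \<beta> * t)) * (\<integral>\<^sup>+y. f y \<partial>P t x) \<partial>lborel) = (\<integral>\<^sup>+y. u \<beta> x y * f y \<partial>m)"
proof -
  interpret Px: prob_space "Px x" by (rule prob_space_Px)
  have [measurable]: "u \<beta> x \<in> borel_measurable borel"
    using densities assms(1) measurable_compose[OF measurable_Pair1'[of x borel borel], of "\<lambda>(x, y). u \<beta> x y"]
    by (auto simp: potential_densities_def)
  let ?w = "\<lambda>t. ennreal (exp (- \<beta> * t)) * indicator {0..} t"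
  have [measurable]: "(\<lambda>p. snd p (fst p)) \<in> lborel \<Otimes>\<^sub>M Px x \<rightarrow>\<^sub>M borel"
    using measurable_process[OF locally_compact] by (simp add: case_prod_beta)
  let ?J = "\<lambda>f. \<integral>\<^sup>+p. ?w (fst p) * ext0 f (snd p (fst p)) \<partial>(lborel \<Otimes>\<^sub>M Px x)"
  have N: "?J f = (\<integral>\<^sup>+t\<in>{0..}. ennreal (exp (- \<beta> * t)) * (\<integral>\<^sup>+y. f y \<partial>P t x) \<partial>lborel)"
    if [measurable]: "f \<in> borel_measurable borel" for f
  proof -
    have "?J f = (\<integral>\<^sup>+t. \<integral>\<^sup>+\<omega>. ?w t * ext0 f (\<omega> t) \<partial>Px x \<partial>lborel)"
      by (subst Px.nn_integral_fst[symmetric]) auto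
    also have "\<dots> = (\<integral>\<^sup>+t. ?w t * (\<integral>\<^sup>+\<omega>. ext0 f (\<omega> t) \<partial>Px x) \<partial>lborel)"
      by (intro nn_integral_cong nn_integral_cmult) measurable
    also have "\<dots> = (\<integral>\<^sup>+t\<in>{0..}. ennreal (exp (- \<beta> * t)) * (\<integral>\<^sup>+y. f y \<partial>P t x) \<partial>lborel)"
      by (intro nn_integral_cong) (auto simp: nn_integral_P indicator_def)
    finally show ?thesis .
  qed
  have "?J f = (\<integral>\<^sup>+y. f y \<partial>density m (u \<beta> x))"
  proof (rule nn_integral_ext0_eqI)
    fix A :: "'s set" assume [measurable]: "A \<in> sets borel"
    have "?J (indicator A) = (\<integral>\<^sup>+t\<in>{0..}. ennreal (exp (- \<beta> * t)) * emeasure (P t x) A \<partial>lborel)"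
      by (subst N) (auto intro!: nn_integral_cong simp: indicator_def sets_P)
    also have "\<dots> = (\<integral>\<^sup>+y\<in>A. u \<beta> x y \<partial>m)"
      using densities assms(1) by (simp add: potential_densities_def)
    finally show "?J (indicator A) = emeasure (density m (u \<beta> x)) A"
      by (simp add: emeasure_density)
  qed (auto simp: sets_m)
  then show ?thesis
    using N[of f] by (simp add: nn_integral_density)
qed

lemma AE_P_neq:
  assumes "0 < t" shows "AE y in P t x. y \<noteq> z"
proof -
  have "emeasure (P t x) {z} = (\<integral>\<^sup>+y. indicator {z} y \<partial>P t x)"
    using assms by (simp add: sets_P)
  also have "\<dots> = (\<integral>\<^sup>+\<omega>. ext0 (indicator {z}) (\<omega> t) \<partial>Px x)"
    using assms by (intro nn_integral_P) auto
  also have "\<dots> = (\<integral>\<^sup>+\<omega>. 0 \<partial>Px x)"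
  proof (rule nn_integral_cong_AE)
    have "AE \<omega> in Px x. \<forall>t>0. \<omega> t \<noteq> Some z" using polar[of z] by (simp add: polar_point_def)
    then show "AE \<omega> in Px x. ext0 (indicator {z}) (\<omega> t) = (0 :: ennreal)"
      by eventually_elim (use assms in \<open>auto simp: ext0_def indicator_def split: option.split\<close>)
  qed
  finally show ?thesis
    using assms by (intro AE_I[of _ _ "{z}"]) (auto simp: sets_P)
qed

text \<open>
  The set \<open>{z}\<close> has potential zero, being polar, and the potential has a strictly positive density.
\<close>

lemma AE_m_neq: "AE y in m. y \<noteq> z"
proof -
  have "(\<integral>\<^sup>+y. u \<alpha> z y * indicator {z} y \<partial>m)
      = (\<integral>\<^sup>+t\<in>{0..}. ennreal (exp (- \<alpha> * t)) * (\<integral>\<^sup>+y. indicator {z} y \<partial>P t z) \<partial>lborel)"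
    using \<alpha>_pos by (intro potential_integral[symmetric]) auto
  also have "\<dots> = (\<integral>\<^sup>+t. 0 \<partial>(lborel :: real measure))"
  proof (rule nn_integral_cong_AE, use AE_lborel_singleton[of 0] in eventually_elim)
    fix t :: real assume "t \<noteq> 0"
    then have "(\<integral>\<^sup>+y. indicator {z} y \<partial>P t z) = 0" if "0 \<le> t"
      using AE_P_neq[of t z z] that by (intro nn_integral_zero'[of _ ]) auto
    then show "ennreal (exp (- \<alpha> * t)) * (\<integral>\<^sup>+y. indicator {z} y \<partial>P t z) * indicator {0..} t = 0"
      by (auto simp: indicator_def)
  qed
  finally have "AE y in m. u \<alpha> z y * indicator {z} y = 0"
    using nn_integral_0_iff_AE[of "\<lambda>y. u \<alpha> z y * indicator {z} y" m] by simp
  then show ?thesis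
    by eventually_elim (use u_pos(2)[of z z] in \<open>auto simp: indicator_def split: if_splits\<close>)
qed

end

section \<open>The measures \<open>Q\<^sup>z\<^sup>,\<^sup>z\<close> as a \<open>\<sigma>\<close>-finite kernel\<close>

context loop_process
begin

lemma sets_Q [measurable_cong]: "sets (Q z) = sets path_space"
  and space_Q [simp]: "space (Q z) = paths"
  and AE_Q_start: "AE \<omega> in Q z. \<omega> 0 = Some z"
  and AE_Q_lifetime: "AE \<omega> in Q z. 0 < lifetime \<omega>"
  using Q[of z] by (auto simp: is_Qzz_def)

lemma borel_measurable_QI: "G \<in> borel_measurable path_space \<Longrightarrow> G \<in> borel_measurable (Q z)"
  by (simp add: measurable_cong_sets[OF sets_Q refl])

lemma measurable_coord_path_space [measurable]: "0 \<le> t \<Longrightarrow> (\<lambda>\<omega>. \<omega> t) \<in> path_space \<rightarrow>\<^sub>M (borel :: 's option measure)"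
  by (rule measurable_coord) simp

lemma measurable_ext0_coord_Q:
  fixes f :: "'s \<Rightarrow> ennreal"
  shows "0 < s \<Longrightarrow> f \<in> borel_measurable borel \<Longrightarrow> (\<lambda>\<omega>. ext0 f (\<omega> s)) \<in> borel_measurable (Q z)"
  by (intro borel_measurable_QI measurable_ext0 measurable_coord_path_space) auto

lemma nn_integral_Q_one_time:
  assumes t: "0 < t" and [measurable]: "f \<in> borel_measurable borel"
  shows "(\<integral>\<^sup>+\<omega>. ext0 f (\<omega> t) \<partial>Q z) = (\<integral>\<^sup>+y. f y * u 0 y z \<partial>P t z)"
proof -
  have [measurable]: "(\<lambda>\<omega>. \<omega> t) \<in> Q z \<rightarrow>\<^sub>M (borel :: 's option measure)"
    using measurable_coord_path_space[of t] t by simp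
  have "(\<integral>\<^sup>+\<omega>. 1 * ext0 f (\<omega> t) \<partial>Q z) = (\<integral>\<^sup>+y. f y \<partial>entrance_law P (\<lambda>x. u 0 x z) z t)"
  proof (rule nn_integral_ext0_eqI)
    fix A :: "'s set" assume A [measurable]: "A \<in> sets borel"
    let ?L = "\<integral>\<^sup>+\<omega>. 1 * ext0 (indicator A) (\<omega> t) \<partial>Q z" and ?R = "emeasure (entrance_law P (\<lambda>x. u 0 x z) z t) A"
    let ?E = "{\<omega> \<in> space (Q z). \<omega> t \<in> Some ` A}"
    have Some_A: "?E = {\<omega> \<in> space (Q z). ext0 (indicator A) (\<omega> t) = (1 :: ennreal)}"
      by (auto simp: ext0_def indicator_def split: option.splits if_splits)
    have "?L = (\<integral>\<^sup>+\<omega>. indicator ?E \<omega> \<partial>Q z)"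
      by (intro nn_integral_cong) (auto simp: ext0_def indicator_def split: option.split)
    also have "\<dots> = emeasure (Q z) ?E"
      unfolding Some_A by (intro nn_integral_indicator) measurable
    also have "\<dots> = ?R"
      using Q[of z] t A by (simp add: is_Qzz_def)
    finally show "?L = ?R" .
  qed (use t in \<open>auto simp: entrance_law_def sets_P\<close>)
  then show ?thesis
    using t by (simp add: entrance_law_def nn_integral_density sets_P measurable_cong_sets[OF sets_P refl] ac_simps)
qed

lemma AE_Q_neq:
  assumes "0 < t" shows "AE \<omega> in Q z. \<omega> t \<noteq> Some z"
proof -
  have [measurable]: "(\<lambda>\<omega>. \<omega> t) \<in> Q z \<rightarrow>\<^sub>M (borel :: 's option measure)"
    using measurable_coord_path_space[of t] assms by simp
  have "(\<integral>\<^sup>+\<omega>. ext0 (indicator {z}) (\<omega> t) \<partial>Q z) = (\<integral>\<^sup>+y. indicator {z} y * u 0 y z \<partial>P t z)"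
    using assms by (intro nn_integral_Q_one_time) auto
  also have "\<dots> = 0"
    by (rule nn_integral_zero', use AE_P_neq[OF assms, of z z] in eventually_elim) auto
  finally have "AE \<omega> in Q z. ext0 (indicator {z}) (\<omega> t) = (0::ennreal)"
    using nn_integral_0_iff_AE[of "\<lambda>\<omega>. ext0 (indicator {z}) (\<omega> t)" "Q z"] by simp
  then show ?thesis
    by eventually_elim auto
qed

text \<open>
  The division by \<open>u(x,z)\<close> is moved out of the transformed kernel, so that only \<open>P\<^sub>r\<close> is left inside.
\<close>

lemma markov_Q:
  assumes "0 < s" "0 \<le> r" and G: "G \<in> borel_measurable (path_algebra {0..s})" and f: "f \<in> borel_measurable borel"
  shows "(\<integral>\<^sup>+\<omega>. G \<omega> * ext0 f (\<omega> (s + r)) \<partial>Q z) =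
    (\<integral>\<^sup>+\<omega>. G \<omega> * ext0 (\<lambda>x. (\<integral>\<^sup>+y. f y * u 0 y z \<partial>P r x) / u 0 x z) (\<omega> s) \<partial>Q z)"
proof -
  have "markov_property {0<..} (Q z) (h_semigroup P (\<lambda>x. u 0 x z))"
    using Q[of z] by (simp add: is_Qzz_def)
  then have "(\<integral>\<^sup>+\<omega>. G \<omega> * ext0 f (\<omega> (s + r)) \<partial>Q z) =
    (\<integral>\<^sup>+\<omega>. G \<omega> * ext0 (\<lambda>x. \<integral>\<^sup>+y. f y \<partial>h_semigroup P (\<lambda>x. u 0 x z) r x) (\<omega> s) \<partial>Q z)"
    unfolding markov_property_def using assms by simp
  also have "(\<lambda>x. \<integral>\<^sup>+y. f y \<partial>h_semigroup P (\<lambda>x. u 0 x z) r x) = (\<lambda>x. (\<integral>\<^sup>+y. f y * u 0 y z \<partial>P r x) / u 0 x z)"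
  proof
    fix x
    have [measurable]: "f \<in> borel_measurable (P r x)" "(\<lambda>y. u 0 y z) \<in> borel_measurable (P r x)"
      using f assms(2) by (simp_all add: measurable_cong_sets[OF sets_P refl])
    have "(\<integral>\<^sup>+y. f y \<partial>h_semigroup P (\<lambda>x. u 0 x z) r x) = (\<integral>\<^sup>+y. u 0 y z / u 0 x z * f y \<partial>P r x)"
      unfolding h_semigroup_def by (rule nn_integral_density) measurable
    also have "\<dots> = (\<integral>\<^sup>+y. (f y * u 0 y z) / u 0 x z \<partial>P r x)"
      by (intro nn_integral_cong) (simp add: ennreal_times_divide[symmetric] ac_simps)
    finally show "(\<integral>\<^sup>+y. f y \<partial>h_semigroup P (\<lambda>x. u 0 x z) r x) = (\<integral>\<^sup>+y. f y * u 0 y z \<partial>P r x) / u 0 x z"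
      by (simp add: nn_integral_divide)
  qed
  finally show ?thesis .
qed

definition pos_rat :: "nat \<Rightarrow> real"
  where "pos_rat = from_nat_into {q\<in>\<rat>. 0 < q}"

text \<open>
  A weight that makes all the measures \<open>Q\<^sup>z\<^sup>,\<^sup>z\<close> finite: at time \<open>t\<close> the law of \<open>X\<^sub>t\<close> has the density \<open>u(\<cdot>,z)\<close> with respect to
  \<open>P\<^sub>t(z,\<cdot>)\<close>, and \<open>v / (1 + v) \<le> 1\<close>. It is almost surely positive, because a path with \<open>\<zeta> > 0\<close> is alive at some
  positive rational time and \<open>u(\<cdot>,z)\<close> is finite off \<open>z\<close>, which the path does not hit.
\<close>

definition loop_weight :: "'s \<Rightarrow> 's path \<Rightarrow> ennreal"
  where "loop_weight z \<omega> = (\<Sum>i. (1/2) ^ Suc i * ext0 (\<lambda>x. 1 / (1 + u 0 x z)) (\<omega> (pos_rat i)))"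

lemma range_pos_rat: "range pos_rat = {q\<in>\<rat>. 0 < q}"
proof -
  have "(1::real) \<in> {q\<in>\<rat>. 0 < q}" by simp
  then have "{q\<in>\<rat>. 0 < (q::real)} \<noteq> {}" by blast
  moreover have "countable {q\<in>\<rat>. 0 < (q::real)}"
    by (rule countable_subset[OF _ countable_rat]) auto
  ultimately show ?thesis unfolding pos_rat_def by (rule range_from_nat_into)
qed

lemma pos_rat_pos: "0 < pos_rat i"
  using range_pos_rat by (metis (mono_tags, lifting) mem_Collect_eq rangeI)

lemma measurable_loop_weight [measurable]:
  "(\<lambda>(z, \<omega>). loop_weight z \<omega>) \<in> borel_measurable (borel \<Otimes>\<^sub>M path_space)"
  unfolding loop_weight_def by measurable

lemma half_power_sums: "(\<Sum>i. (1/2 :: ennreal) ^ Suc i) = 1"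
proof -
  have "(\<Sum>i. ennreal ((1/2) ^ Suc i)) = ennreal 1"
    using power_half_series by (intro suminf_ennreal_eq) auto
  moreover have "ennreal ((1/2) ^ Suc i) = (1/2) ^ Suc i" for i
    by (simp add: ennreal_power[symmetric] divide_ennreal[symmetric] ennreal_mult del: ennreal_half power_Suc)
  ultimately show ?thesis by simp
qed

lemma inverse_one_plus_mult_le: "1 / (1 + c) * c \<le> (1 :: ennreal)"
proof (cases "c = \<infinity>")
  case False
  have "1 / (1 + c) * c = c / (1 + c)"
    by (simp add: divide_ennreal_def mult.commute)
  also have "\<dots> \<le> 1"
    by (intro divide_le_posI_ennreal) (auto simp: add_pos_nonneg)
  finally show ?thesis .
qed simp

lemma nn_integral_loop_weight: "(\<integral>\<^sup>+\<omega>. loop_weight z \<omega> \<partial>Q z) \<le> 1"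
proof -
  have "(\<integral>\<^sup>+\<omega>. loop_weight z \<omega> \<partial>Q z)
      = (\<Sum>i. \<integral>\<^sup>+\<omega>. (1/2) ^ Suc i * ext0 (\<lambda>x. 1 / (1 + u 0 x z)) (\<omega> (pos_rat i)) \<partial>Q z)"
    unfolding loop_weight_def by (rule nn_integral_suminf) measurable
  also have "\<dots> \<le> (\<Sum>i. (1/2) ^ Suc i)"
  proof (intro suminf_le)
    fix i
    interpret subprob_space "P (pos_rat i) z"
      using pos_rat_pos[of i] by (intro subprob_P) auto
    have eq: "(\<integral>\<^sup>+\<omega>. (1/2) ^ Suc i * ext0 (\<lambda>x. 1 / (1 + u 0 x z)) (\<omega> (pos_rat i)) \<partial>Q z)
        = (1/2) ^ Suc i * (\<integral>\<^sup>+\<omega>. ext0 (\<lambda>x. 1 / (1 + u 0 x z)) (\<omega> (pos_rat i)) \<partial>Q z)"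
      by (rule nn_integral_cmult) measurable
    have "(\<integral>\<^sup>+\<omega>. ext0 (\<lambda>x. 1 / (1 + u 0 x z)) (\<omega> (pos_rat i)) \<partial>Q z)
        = (\<integral>\<^sup>+y. 1 / (1 + u 0 y z) * u 0 y z \<partial>P (pos_rat i) z)"
      by (intro nn_integral_Q_one_time pos_rat_pos) measurable
    also have "\<dots> \<le> (\<integral>\<^sup>+y. 1 \<partial>P (pos_rat i) z)"
      by (intro nn_integral_mono inverse_one_plus_mult_le)
    also have "\<dots> \<le> 1" using emeasure_space_le_1 by simp
    finally show "(\<integral>\<^sup>+\<omega>. (1/2) ^ Suc i * ext0 (\<lambda>x. 1 / (1 + u 0 x z)) (\<omega> (pos_rat i)) \<partial>Q z) \<le> (1/2) ^ Suc i"
      unfolding eq using mult_left_mono[of _ "1 :: ennreal" "(1/2) ^ Suc i"] by (simp del: power_Suc)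
  qed auto
  finally show ?thesis by (simp add: half_power_sums del: power_Suc)
qed

lemma loop_weight_finite: "loop_weight z \<omega> < \<infinity>"
proof -
  have "loop_weight z \<omega> \<le> (\<Sum>i. (1/2) ^ Suc i)"
    unfolding loop_weight_def
  proof (intro suminf_le)
    fix i
    have "ext0 (\<lambda>x. 1 / (1 + u 0 x z)) (\<omega> (pos_rat i)) \<le> 1"
      by (cases "\<omega> (pos_rat i)") (auto intro!: divide_le_posI_ennreal add_pos_nonneg)
    then show "(1/2) ^ Suc i * ext0 (\<lambda>x. 1 / (1 + u 0 x z)) (\<omega> (pos_rat i)) \<le> (1/2) ^ Suc i"
      using mult_left_mono[of _ "1 :: ennreal" "(1/2) ^ Suc i"] by (simp del: power_Suc)
  qed auto
  also have "\<dots> < \<infinity>" unfolding half_power_sums by simp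
  finally show ?thesis .
qed

lemma AE_loop_weight_pos: "AE \<omega> in Q z. 0 < loop_weight z \<omega>"
proof -
  have "AE \<omega> in Q z. \<forall>i. \<omega> (pos_rat i) \<noteq> Some z"
    unfolding AE_all_countable by (intro allI AE_Q_neq pos_rat_pos)
  moreover have "AE \<omega> in Q z. \<omega> \<in> paths" using AE_space[of "Q z"] by simp
  ultimately show ?thesis using AE_Q_lifetime
  proof eventually_elim
    fix \<omega> :: "'s path" assume w: "\<forall>i. \<omega> (pos_rat i) \<noteq> Some z" "\<omega> \<in> paths" "0 < lifetime \<omega>"
    obtain q where q: "q \<in> \<rat>" "0 < q" "ereal q < lifetime \<omega>"
    proof -
      obtain r where r: "0 < ereal r" "ereal r < lifetime \<omega>"
        using ereal_dense2[OF w(3)] by auto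
      from r(1) have "0 < r" by simp
      then obtain q where q: "q \<in> \<rat>" "0 < q" "q < r"
        using Rats_dense_in_real by blast
      have "ereal q < ereal r" using q by simp
      also note r(2)
      finally show ?thesis using q by (intro that)
    qed
    then have "q \<in> range pos_rat" unfolding range_pos_rat by simp
    then obtain i where i: "q = pos_rat i" by blast
    obtain x where x: "\<omega> q = Some x"
      using dead_iff_lifetime_le[OF w(2) q(2)] q(3) by (cases "\<omega> q") auto
    then have "x \<noteq> z" using w(1) i by auto
    then have "1 + u 0 x z < \<infinity>" using finite_off_diagonal[of x z] by simp
    then have "0 < 1 / (1 + u 0 x z)" by (simp add: ennreal_zero_less_divide)
    moreover have "0 < (1/2 :: ennreal) ^ Suc i"
      unfolding zero_less_iff_neq_zero power_eq_0_iff by (simp add: ennreal_divide_eq_0_iff)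
    ultimately have "0 < (1/2) ^ Suc i * ext0 (\<lambda>x. 1 / (1 + u 0 x z)) (\<omega> (pos_rat i))"
      using x i by (simp only: ennreal_zero_less_mult_iff ext0_simps simp_thms)
    also have "\<dots> \<le> loop_weight z \<omega>"
      unfolding loop_weight_def
      using sum_le_suminf[of "\<lambda>i. (1/2) ^ Suc i * ext0 (\<lambda>x. 1 / (1 + u 0 x z)) (\<omega> (pos_rat i))" "{i}"]
      by (simp del: power_Suc)
    finally show "0 < loop_weight z \<omega>" .
  qed
qed


lemma measurable_loop_weight_section [measurable]: "loop_weight z \<in> borel_measurable path_space"
  using measurable_compose[OF measurable_Pair1'[of z borel path_space], of "\<lambda>(z, \<omega>). loop_weight z \<omega>"]
  by simp

lemmas Q_measurable = borel_measurable_times_ennreal borel_measurable_QI[OF measurable_ext0]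
  measurable_coord_path_space less_imp_le

lemma subprob_weighted_Q: "subprob_space (density (Q z) (loop_weight z))"
proof
  have "emeasure (density (Q z) (loop_weight z)) (space (density (Q z) (loop_weight z)))
      = (\<integral>\<^sup>+\<omega>. 1 \<partial>density (Q z) (loop_weight z))"
    by (simp only: nn_integral_const mult_1)
  also have "\<dots> = (\<integral>\<^sup>+\<omega>. loop_weight z \<omega> \<partial>Q z)"
    by (subst nn_integral_density) (auto intro: borel_measurable_QI)
  finally show "emeasure (density (Q z) (loop_weight z)) (space (density (Q z) (loop_weight z))) \<le> 1"
    using nn_integral_loop_weight[of z] by simp
  \<comment> \<open>The path that is dead from the start shows that the path space is not empty.\<close>
  have "(\<lambda>t\<in>{0..}. None :: 's option) \<in> paths"
  proof -
    have "((\<lambda>t\<in>{0..}. None :: 's option) \<longlongrightarrow> (None :: 's option)) (at_right t)" if "0 \<le> t" for t :: real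
      by (rule tendsto_eventually) (use that in \<open>auto simp: eventually_at_filter intro!: always_eventually\<close>)
    then show ?thesis by (auto simp: paths_def)
  qed
  then show "space (density (Q z) (loop_weight z)) \<noteq> {}" by auto
qed

text \<open>
  The weight is finite and almost surely positive, so \<open>Q\<^sup>z\<^sup>,\<^sup>z\<close> is recovered from its finite version.
\<close>

lemma Q_eq_density_weighted: "Q z = density (density (Q z) (loop_weight z)) (\<lambda>\<omega>. 1 / loop_weight z \<omega>)"
proof -
  have "density (density (Q z) (loop_weight z)) (\<lambda>\<omega>. 1 / loop_weight z \<omega>)
      = density (Q z) (\<lambda>\<omega>. loop_weight z \<omega> * (1 / loop_weight z \<omega>))"
    by (intro density_density_eq) (auto intro: borel_measurable_QI)
  also have "\<dots> = density (Q z) (\<lambda>_. 1)"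
  proof (rule density_cong)
    show "AE \<omega> in Q z. loop_weight z \<omega> * (1 / loop_weight z \<omega>) = 1"
      using AE_loop_weight_pos
    proof eventually_elim
      fix \<omega> assume "0 < loop_weight z \<omega>"
      then show "loop_weight z \<omega> * (1 / loop_weight z \<omega>) = 1"
        using loop_weight_finite[of z \<omega>]
        by (simp add: ennreal_times_divide ennreal_divide_self less_top zero_less_iff_neq_zero)
    qed
  qed (auto intro: borel_measurable_QI)
  finally show ?thesis by (simp add: density_1)
qed

sublocale Q: sigma_finite_measure "Q z" for z
proof -
  interpret W: subprob_space "density (Q z) (loop_weight z)" by (rule subprob_weighted_Q)
  have "AE \<omega> in density (Q z) (loop_weight z). 1 / loop_weight z \<omega> \<noteq> \<infinity>"
    by (subst AE_density) (auto simp: ennreal_divide_eq_top_iff borel_measurable_QI)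
  then have "sigma_finite_measure (density (density (Q z) (loop_weight z)) (\<lambda>\<omega>. 1 / loop_weight z \<omega>))"
    by (subst W.sigma_finite_iff_density_finite) (auto simp: borel_measurable_QI)
  then show "sigma_finite_measure (Q z)"
    by (simp only: Q_eq_density_weighted[symmetric])
qed

text \<open>
  The Markov property at the second largest time removes the largest one, so that by induction the
  finite dimensional integrals depend measurably on \<open>z\<close>.
\<close>

lemma borel_measurable_Q_cylinder:
  assumes "finite J" "J \<noteq> {}" "J \<subseteq> {0<..}"
    and "\<And>j. j \<in> J \<Longrightarrow> (\<lambda>(z, x). \<phi> j z x) \<in> borel_measurable (borel \<Otimes>\<^sub>M borel)"
  shows "(\<lambda>z. \<integral>\<^sup>+\<omega>. (\<Prod>j\<in>J. ext0 (\<phi> j z) (\<omega> j)) \<partial>Q z) \<in> borel_measurable borel"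
  using assms
proof (induction J arbitrary: \<phi> rule: finite_linorder_max_induct)
  case empty
  then show ?case by simp
next
  case (insert b J)
  have b: "0 < b" using insert.prems by auto
  have \<phi>b [measurable]: "(\<lambda>(z, x). \<phi> b z x) \<in> borel_measurable (borel \<Otimes>\<^sub>M borel)"
    using insert.prems by auto
  have sec: "f z \<in> borel_measurable borel"
    if "(\<lambda>(z, x). f z x) \<in> borel_measurable (borel \<Otimes>\<^sub>M (borel :: 's measure))"
    for f :: "'s \<Rightarrow> 's \<Rightarrow> ennreal" and z
    using measurable_compose[OF measurable_Pair1'[of z borel borel] that] by simp
  have P_joint: "(\<lambda>(z, x). \<integral>\<^sup>+y. \<phi> b z y * u 0 y z \<partial>P r x) \<in> borel_measurable (borel \<Otimes>\<^sub>M borel)"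
    if r: "0 \<le> r" for r
  proof -
    have "(\<lambda>p. \<integral>\<^sup>+\<omega>. ext0 (\<lambda>y. \<phi> b (fst p) y * u 0 y (fst p)) (\<omega> r) \<partial>Px (snd p))
        \<in> borel_measurable (borel \<Otimes>\<^sub>M borel)"
      by (rule nn_integral_measurable_subprob_algebra2[where N=path_space]) measurable
    moreover have "(\<integral>\<^sup>+y. \<phi> b z y * u 0 y z \<partial>P r x) = (\<integral>\<^sup>+\<omega>. ext0 (\<lambda>y. \<phi> b z y * u 0 y z) (\<omega> r) \<partial>Px x)" for z x
      using sec[OF \<phi>b, of z] by (intro nn_integral_P r) measurable
    ultimately show ?thesis by (simp add: case_prod_beta)
  qed
  show ?case
  proof (cases "J = {}")
    case True
    have "(\<integral>\<^sup>+\<omega>. (\<Prod>j\<in>insert b J. ext0 (\<phi> j z) (\<omega> j)) \<partial>Q z) = (\<integral>\<^sup>+y. \<phi> b z y * u 0 y z \<partial>P b z)" for z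
      using True nn_integral_Q_one_time[OF b sec[OF \<phi>b]] by simp
    then show ?thesis
      using measurable_compose[OF measurable_Pair[OF measurable_ident measurable_ident] P_joint[of b]] b
      by (simp add: id_def)
  next
    case False
    define a where "a = Max J"
    have a: "a \<in> J" "0 < a" "a < b" and le_a: "\<And>j. j \<in> J \<Longrightarrow> j \<le> a"
      using insert False Max_in[of J] by (auto simp: a_def subset_eq)
  let ?K = "\<lambda>z x. (\<integral>\<^sup>+y. \<phi> b z y * u 0 y z \<partial>P (b - a) x) / u 0 x z"
  let ?p = "\<lambda>\<phi> J z \<omega>. \<Prod>j\<in>J. ext0 (\<phi> j z) (\<omega> j :: 's option) :: ennreal"
    \<comment> \<open>\<open>\<psi> a\<close> absorbs the transition from the second largest time \<open>a\<close> to the largest time \<open>b\<close>.\<close>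
    define \<psi> where "\<psi> j z x = (if j = a then \<phi> a z x * ((\<integral>\<^sup>+y. \<phi> b z y * u 0 y z \<partial>P (b - a) x) / u 0 x z)
      else \<phi> j z x)" for j z x
    have m\<phi> [measurable]: "(\<lambda>(z, x). \<phi> j z x) \<in> borel_measurable (borel \<Otimes>\<^sub>M borel)" if "j \<in> J" for j
      using insert.prems that by auto
    have "(\<integral>\<^sup>+\<omega>. (\<Prod>j\<in>insert b J. ext0 (\<phi> j z) (\<omega> j)) \<partial>Q z) = (\<integral>\<^sup>+\<omega>. ?p \<psi> J z \<omega> \<partial>Q z)" for z
    proof -
      have "b \<notin> J" using insert.hyps by auto
      then have "(\<integral>\<^sup>+\<omega>. (\<Prod>j\<in>insert b J. ext0 (\<phi> j z) (\<omega> j)) \<partial>Q z)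
          = (\<integral>\<^sup>+\<omega>. ?p \<phi> J z \<omega> * ext0 (\<phi> b z) (\<omega> (a + (b - a))) \<partial>Q z)"
        using insert.hyps by (simp add: ac_simps)
      also have "\<dots> = (\<integral>\<^sup>+\<omega>. ?p \<phi> J z \<omega> *
          ext0 (?K z) (\<omega> a) \<partial>Q z)"
      proof (rule markov_Q)
        show "(\<lambda>\<omega>. \<Prod>j\<in>J. ext0 (\<phi> j z) (\<omega> j)) \<in> borel_measurable (path_algebra {0..a})"
        proof (rule borel_measurable_prod_ennreal)
          fix j assume "j \<in> J"
          then have [measurable]: "(\<lambda>\<omega>. \<omega> j) \<in> path_algebra {0..a} \<rightarrow>\<^sub>M (borel :: 's option measure)"
              "\<phi> j z \<in> borel_measurable borel"
            using le_a insert.prems sec[OF m\<phi>] by (auto intro!: measurable_coord less_imp_le)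
          show "(\<lambda>\<omega>. ext0 (\<phi> j z) (\<omega> j)) \<in> borel_measurable (path_algebra {0..a})"
            by (rule measurable_ext0) measurable
        qed
      qed (use a sec[OF \<phi>b] in auto)
      also have "\<dots> = (\<integral>\<^sup>+\<omega>. ?p \<psi> J z \<omega> \<partial>Q z)"
      proof (rule nn_integral_cong)
        fix \<omega>
        have "?p \<psi> J z \<omega> = ext0 (\<psi> a z) (\<omega> a) * (\<Prod>j\<in>J - {a}. ext0 (\<psi> j z) (\<omega> j))"
          using insert.hyps a by (simp add: prod.remove)
        also have "(\<Prod>j\<in>J - {a}. ext0 (\<psi> j z) (\<omega> j)) = (\<Prod>j\<in>J - {a}. ext0 (\<phi> j z) (\<omega> j))"
          by (intro prod.cong) (auto simp: \<psi>_def[abs_def])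
        also have "ext0 (\<psi> a z) (\<omega> a) = ext0 (\<phi> a z) (\<omega> a) *
            ext0 (?K z) (\<omega> a)"
          by (simp add: ext0_mult \<psi>_def[abs_def])
        finally show "?p \<phi> J z \<omega> *
            ext0 (?K z) (\<omega> a)
          = ?p \<psi> J z \<omega>"
          using insert.hyps a by (simp add: prod.remove[of J a] ac_simps)
      qed
      finally show ?thesis .
    qed
    moreover have "(\<lambda>z. \<integral>\<^sup>+\<omega>. ?p \<psi> J z \<omega> \<partial>Q z) \<in> borel_measurable borel"
    proof (rule insert.IH)
      fix j assume "j \<in> J"
      note [measurable] = m\<phi>[OF this] m\<phi>[OF a(1)] P_joint[of "b - a"]
      have [measurable]: "(\<lambda>p. \<integral>\<^sup>+y. \<phi> b (fst p) y * u 0 y (fst p) \<partial>P (b - a) (snd p)) \<in> borel_measurable (borel \<Otimes>\<^sub>M borel)"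
        using P_joint[of "b - a"] a by (simp add: case_prod_beta)
      show "(\<lambda>(z, x). \<psi> j z x) \<in> borel_measurable (borel \<Otimes>\<^sub>M borel)"
        unfolding \<psi>_def case_prod_beta by (cases "j = a") simp_all
    qed (use False insert.prems in auto)
    ultimately show ?thesis by simp
  qed
qed

text \<open>
  All coordinates are required to be alive, which suits the Markov property; death at a given time is recovered
  as a complement.
\<close>

definition cylinders :: "'s path set set"
  where "cylinders = {{\<omega> \<in> paths. \<forall>j\<in>J. \<omega> j \<in> Some ` A j} | J A.
    finite J \<and> J \<subseteq> {0..} \<and> (\<forall>j. A j \<in> sets borel)}"

lemma Some_image_sets: "A \<in> sets borel \<Longrightarrow> Some ` A \<in> sets (borel :: 's option measure)"
proof -
  assume [measurable]: "A \<in> sets borel"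
  have "Some ` A = {w \<in> space borel. w \<notin> {None} \<and> the w \<in> A}"
    by (auto simp: image_iff)
  also have "\<dots> \<in> sets borel" by measurable
  finally show ?thesis .
qed

lemma sigma_sets_cylinders: "sets path_space = sigma_sets paths cylinders"
proof
  have "C \<in> sets path_space" if "C \<in> cylinders" for C
  proof -
    from that obtain J A where C: "C = {\<omega> \<in> space path_space. \<forall>j\<in>J. \<omega> j \<in> Some ` A j}" "finite J" "J \<subseteq> {0..}"
      "\<And>j. A j \<in> sets borel" by (auto simp: cylinders_def)
    have "{\<omega> \<in> space path_space. \<omega> j \<in> Some ` A j} \<in> sets path_space" if "j \<in> J" for j
      using measurable_sets_Collect[OF measurable_coord[of j "{0..}"], of "\<lambda>w. w \<in> Some ` A j"] that C(3)
        Some_image_sets[OF C(4)[of j]] by auto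
    then show ?thesis unfolding C(1) by (intro sets.sets_Collect_finite_All C(2))
  qed
  then show "sigma_sets paths cylinders \<subseteq> sets path_space"
    using sets.sigma_sets_subset[of cylinders path_space] by auto
  let ?S = "sigma paths cylinders"
  have sub: "cylinders \<subseteq> Pow paths" by (auto simp: cylinders_def)
  have space_S: "space ?S = paths" using sub by (rule space_measure_of)
  have cyl: "{\<omega> \<in> paths. \<omega> t \<in> Some ` A} \<in> sets ?S" if "0 \<le> t" "A \<in> sets borel" for t A
  proof -
    have "{\<omega> \<in> paths. \<omega> t \<in> Some ` A} \<in> cylinders"
      unfolding cylinders_def using that by (intro CollectI exI[of _ "{t}"] exI[of _ "\<lambda>_. A"]) auto
    then show ?thesis using sub by simp
  qed
  have "(\<lambda>\<omega>. restrict \<omega> {0..}) \<in> ?S \<rightarrow>\<^sub>M (\<Pi>\<^sub>M t\<in>{0..}. (borel :: 's option measure))"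
  proof (intro measurable_restrict borel_measurableI)
    fix t :: real and U :: "'s option set" assume t: "t \<in> {0..}" and "open U"
    then have "Some -` U \<in> sets borel" by (simp add: open_option_def)
    then have sets: "{\<omega> \<in> paths. \<omega> t \<in> Some ` (Some -` U)} \<in> sets ?S"
      using t by (intro cyl) auto
    have sets': "paths - {\<omega> \<in> paths. \<omega> t \<in> Some ` UNIV} \<in> sets ?S"
      using t sets.top[of ?S] unfolding space_S by (intro sets.Diff cyl) auto
    have "(\<lambda>\<omega>. \<omega> t) -` U \<inter> paths = {\<omega> \<in> paths. \<omega> t \<in> Some ` (Some -` U)} \<union>
      (if None \<in> U then paths - {\<omega> \<in> paths. \<omega> t \<in> Some ` UNIV} else {})"
      by (auto simp: image_iff) (metis option.exhaust)+
    then show "(\<lambda>\<omega>. \<omega> t) -` U \<inter> space ?S \<in> sets ?S"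
      using sets.Un[OF sets sets'] sets by (cases "None \<in> U") (simp_all only: space_S if_True if_False Un_empty_right simp_thms)
  qed
  then have "sets (path_space :: 's path measure) \<subseteq> sets ?S"
    unfolding path_algebra_def by (intro sets_image_in_sets) (simp_all add: space_S)
  then show "sets path_space \<subseteq> sigma_sets paths cylinders" using sub by simp
qed

lemma Int_stable_cylinders: "Int_stable cylinders"
proof (rule Int_stableI)
  fix C D assume "C \<in> cylinders" "D \<in> cylinders"
  then obtain I A J B where
    C: "C = {\<omega> \<in> paths. \<forall>j\<in>I. \<omega> j \<in> Some ` A j}" "finite I" "I \<subseteq> {0..}" "\<And>j. A j \<in> sets borel" and
    D: "D = {\<omega> \<in> paths. \<forall>j\<in>J. \<omega> j \<in> Some ` B j}" "finite J" "J \<subseteq> {0..}" "\<And>j. B j \<in> sets borel"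
    by (auto simp: cylinders_def)
  have "C \<inter> D = {\<omega> \<in> paths. \<forall>j\<in>I \<union> J. \<omega> j \<in> Some ` ((if j \<in> I then A j else UNIV) \<inter> (if j \<in> J then B j else UNIV))}"
    unfolding C D by (auto split: if_splits) (force split: if_splits)+
  then show "C \<inter> D \<in> cylinders"
    unfolding cylinders_def using C D
    by (intro CollectI exI[of _ "I \<union> J"] exI[of _ "\<lambda>j. (if j \<in> I then A j else UNIV) \<inter> (if j \<in> J then B j else UNIV)"]) auto
qed


text \<open>
  By the \<open>\<pi>\<close>-\<open>\<lambda>\<close> theorem it suffices to treat cylinders. A condition at time \<open>0\<close> is a condition on \<open>z\<close>,
  and each term of the weight is one more factor at a positive time, so that all reduces to finite dimensional
  integrals at positive times.
\<close>

lemma measurable_weighted_Q [measurable]: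
  "(\<lambda>z. density (Q z) (loop_weight z)) \<in> borel \<rightarrow>\<^sub>M subprob_algebra path_space"
proof (rule measurable_subprob_algebra_generated[OF sigma_sets_cylinders Int_stable_cylinders])
  show "cylinders \<subseteq> Pow paths" by (auto simp: cylinders_def)
  show "subprob_space (density (Q z) (loop_weight z))" for z by (rule subprob_weighted_Q)
  show "sets (density (Q z) (loop_weight z)) = sets path_space" for z by (simp add: sets_Q)
  have *: "(\<lambda>z. emeasure (density (Q z) (loop_weight z)) C) \<in> borel_measurable borel" if "C \<in> cylinders" for C
  proof -
    from that obtain J A where C: "C = {\<omega> \<in> paths. \<forall>j\<in>J. \<omega> j \<in> Some ` A j}" "finite J" "J \<subseteq> {0..}"
      and A [measurable]: "\<And>j. A j \<in> sets borel" by (auto simp: cylinders_def)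
    \<comment> \<open>Under \<open>Q\<^sup>z\<^sup>,\<^sup>z\<close> the coordinate at time \<open>0\<close> is \<open>z\<close>, so it is split off.\<close>
    define J' where "J' = J - {0}"
    have J': "finite J'" "J' \<subseteq> {0<..}" "0 \<notin> J'" using C by (auto simp: J'_def less_le)
    define w where "w z x = 1 / (1 + u 0 x z)" for z x
    have w [measurable]: "(\<lambda>(z, x). w z x) \<in> borel_measurable (borel \<Otimes>\<^sub>M borel)"
      unfolding w_def by measurable
    \<comment> \<open>The factor of the weight at time \<open>t\<close> is merged with the cylinder condition at \<open>t\<close>, if there is one.\<close>
    define \<phi> :: "real \<Rightarrow> real \<Rightarrow> 's \<Rightarrow> 's \<Rightarrow> ennreal"
      where "\<phi> t j z x = (if j \<in> J' then indicator (A j) x else 1) * (if j = t then w z x else 1)" for t j z x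
    let ?T = "\<lambda>i z \<omega>. \<Prod>j\<in>insert (pos_rat i) J'. ext0 (\<phi> (pos_rat i) j z) (\<omega> j)"
    let ?I = "\<lambda>\<omega>. \<Prod>j\<in>J'. ext0 (indicator (A j)) (\<omega> j) :: ennreal"
    let ?W = "\<lambda>z \<omega>. \<Sum>i. (1/2) ^ Suc i * ?T i z \<omega>"
    let ?a = "\<lambda>z. if 0 \<in> J then indicator (A 0) z else 1 :: ennreal"
    have C_sets: "C \<in> sets path_space"
      using that sigma_sets_cylinders by auto
    have ind: "indicator C \<omega> = (\<Prod>j\<in>J. ext0 (indicator (A j)) (\<omega> j) :: ennreal)" if path: "\<omega> \<in> paths" for \<omega>
    proof (cases "\<omega> \<in> C")
      case True
      then have "ext0 (indicator (A j)) (\<omega> j) = (1 :: ennreal)" if "j \<in> J" for j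
        using C(1) that by (auto simp: image_iff Ball_def)
      with True show ?thesis by simp
    next
      case False
      then obtain j where j: "j \<in> J" "\<omega> j \<notin> Some ` A j" using C(1) path by auto
      then have "ext0 (indicator (A j)) (\<omega> j) = (0 :: ennreal)"
        by (cases "\<omega> j") (auto simp: indicator_def)
      then have "\<exists>j\<in>J. ext0 (indicator (A j)) (\<omega> j) = (0 :: ennreal)" using j by auto
      then show ?thesis using False C(2) by (simp add: prod_zero_iff)
    qed
    have absorb: "(\<Prod>j\<in>insert t J'. ext0 (\<phi> t j z) (\<omega> j)) = ext0 (w z) (\<omega> t) * ?I \<omega>"
      for t z \<omega>
    proof -
      have "(\<Prod>j\<in>J' - {t}. ext0 (\<phi> t j z) (\<omega> j)) = (\<Prod>j\<in>J' - {t}. ext0 (indicator (A j)) (\<omega> j))"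
        by (intro prod.cong) (auto simp: \<phi>_def[abs_def])
      then have "(\<Prod>j\<in>insert t J'. ext0 (\<phi> t j z) (\<omega> j)) = ext0 (\<phi> t t z) (\<omega> t) * (\<Prod>j\<in>J' - {t}. ext0 (indicator (A j)) (\<omega> j))"
        using J'(1) by (simp add: prod.insert_remove)
      also have "\<dots> = ext0 (w z) (\<omega> t) * ?I \<omega>"
        using J'(1) by (cases "t \<in> J'")
          (auto simp: \<phi>_def[abs_def] prod.remove[of J' t] ext0_mult[symmetric] ac_simps)
      finally show ?thesis .
    qed
    have "emeasure (density (Q z) (loop_weight z)) C = ?a z *
        (\<Sum>i. (1/2) ^ Suc i * (\<integral>\<^sup>+\<omega>. ?T i z \<omega> \<partial>Q z))" for z
    proof -
      have meas: "(\<lambda>\<omega>. \<Prod>j\<in>J'. ext0 (indicator (A j)) (\<omega> j) :: ennreal) \<in> borel_measurable (Q z)"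
      proof (rule borel_measurable_prod_ennreal)
        fix j assume "j \<in> J'"
        then have "0 \<le> j" using J' by (auto intro: less_imp_le)
        then show "(\<lambda>\<omega>. ext0 (indicator (A j)) (\<omega> j)) \<in> borel_measurable (Q z)"
          by (intro borel_measurable_QI measurable_ext0 measurable_coord_path_space) auto
      qed
      have "emeasure (density (Q z) (loop_weight z)) C = (\<integral>\<^sup>+\<omega>. loop_weight z \<omega> * indicator C \<omega> \<partial>Q z)"
        using C_sets by (intro emeasure_density borel_measurable_QI) (auto simp: sets_Q)
      also have "\<dots> = (\<integral>\<^sup>+\<omega>. ?a z *
          ?W z \<omega> \<partial>Q z)"
      proof (rule nn_integral_cong_AE, use AE_space AE_Q_start[of z] in eventually_elim)
        fix \<omega> assume "\<omega> \<in> space (Q z)" "\<omega> 0 = Some z"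
        then have \<omega>: "\<omega> \<in> paths" "\<omega> 0 = Some z" by simp_all
        have "indicator C \<omega> = ?a z * (\<Prod>j\<in>J'. ext0 (indicator (A j)) (\<omega> j) :: ennreal)"
          unfolding ind[OF \<omega>(1)] J'_def using C(2) \<omega>(2) by (simp add: prod.remove[of J 0])
        moreover have "loop_weight z \<omega> * ?I \<omega>
            = ?W z \<omega>"
          unfolding loop_weight_def absorb w_def[symmetric] ennreal_suminf_multc[symmetric]
          by (simp add: mult.assoc)
        moreover have "a * (b * c) = b * (a * c)" for a b c :: ennreal by (simp add: ac_simps)
        ultimately show "loop_weight z \<omega> * indicator C \<omega> = ?a z *
          ?W z \<omega>"
          by metis
      qed
      also have "\<dots> = ?a z *
          (\<integral>\<^sup>+\<omega>. ?W z \<omega> \<partial>Q z)"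
        unfolding absorb using meas pos_rat_pos
        by (intro nn_integral_cmult borel_measurable_suminf Q_measurable) auto
      also have "(\<integral>\<^sup>+\<omega>. ?W z \<omega> \<partial>Q z)
          = (\<Sum>i. \<integral>\<^sup>+\<omega>. (1/2) ^ Suc i * ?T i z \<omega> \<partial>Q z)"
        unfolding absorb using meas pos_rat_pos
        by (intro nn_integral_suminf Q_measurable) auto
      also have "\<dots> = (\<Sum>i. (1/2) ^ Suc i * (\<integral>\<^sup>+\<omega>. ?T i z \<omega> \<partial>Q z))"
        unfolding absorb using meas pos_rat_pos
        by (intro suminf_cong nn_integral_cmult Q_measurable) auto
      finally show ?thesis .
    qed
    moreover have "(\<lambda>z. \<integral>\<^sup>+\<omega>. ?T i z \<omega> \<partial>Q z) \<in> borel_measurable borel" for i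
      by (rule borel_measurable_Q_cylinder) (use J' pos_rat_pos in \<open>auto simp: \<phi>_def[abs_def]\<close>)
    ultimately show ?thesis
      by (simp del: prod.insert)
  qed
  show "(\<lambda>z. emeasure (density (Q z) (loop_weight z)) C) \<in> borel_measurable borel" if "C \<in> cylinders" for C
    using that by (rule *)
  have "paths \<in> cylinders"
    unfolding cylinders_def by (intro CollectI exI[of _ "{}"] exI[of _ "\<lambda>_. UNIV"]) auto
  then show "(\<lambda>z. emeasure (density (Q z) (loop_weight z)) paths) \<in> borel_measurable borel" by (rule *)
qed

lemma borel_measurable_Q_integral:
  assumes [measurable]: "F \<in> borel_measurable path_space"
  shows "(\<lambda>z. \<integral>\<^sup>+\<omega>. F \<omega> \<partial>Q z) \<in> borel_measurable borel"
proof -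
  have "(\<integral>\<^sup>+\<omega>. F \<omega> \<partial>Q z) = (\<integral>\<^sup>+\<omega>. 1 / loop_weight z \<omega> * F \<omega> \<partial>density (Q z) (loop_weight z))" for z
    by (subst Q_eq_density_weighted, subst nn_integral_density) (auto simp: borel_measurable_QI)
  moreover have "(\<lambda>z. \<integral>\<^sup>+\<omega>. 1 / loop_weight z \<omega> * F \<omega> \<partial>density (Q z) (loop_weight z)) \<in> borel_measurable borel"
    by (rule nn_integral_measurable_subprob_algebra2[where N=path_space]) measurable
  ultimately show ?thesis by simp
qed

lemma sets_nu [measurable_cong]: "sets (nu m Q) = sets path_space"
  and space_nu [simp]: "space (nu m Q) = paths"
  by (simp_all add: nu_def sets.sigma_sets_eq[of path_space, simplified] sets.space_closed[of path_space, simplified])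

text \<open>
  Countable additivity of the defining set function requires the integrands \<open>z \<mapsto> Q\<^sup>z\<^sup>,\<^sup>z(A)\<close> to be measurable.
\<close>

lemma emeasure_nu:
  assumes A: "A \<in> sets path_space"
  shows "emeasure (nu m Q) A = (\<integral>\<^sup>+z. emeasure (Q z) A \<partial>m)"
proof (rule emeasure_measure_of[OF nu_def])
  have meas: "(\<lambda>z. emeasure (Q z) B) \<in> borel_measurable m" if "B \<in> sets path_space" for B
    using borel_measurable_Q_integral[of "indicator B"] that
    by (simp add: sets_Q measurable_cong_sets[OF sets_m refl])
  show "sets path_space \<subseteq> Pow (space path_space)" by (rule sets.space_closed)
  show "A \<in> sets (nu m Q)" using A by (simp add: sets_nu)
  show "positive (sets (nu m Q)) (\<lambda>A. \<integral>\<^sup>+z. emeasure (Q z) A \<partial>m)"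
    by (simp add: positive_def)
  show "countably_additive (sets (nu m Q)) (\<lambda>A. \<integral>\<^sup>+z. emeasure (Q z) A \<partial>m)"
  proof (rule countably_additiveI)
    fix B :: "nat \<Rightarrow> 's path set" assume B: "range B \<subseteq> sets (nu m Q)" "disjoint_family B"
    then have B': "B i \<in> sets path_space" for i by (auto simp: sets_nu)
    have "(\<Sum>i. \<integral>\<^sup>+z. emeasure (Q z) (B i) \<partial>m) = (\<integral>\<^sup>+z. (\<Sum>i. emeasure (Q z) (B i)) \<partial>m)"
      using meas[OF B'] by (intro nn_integral_suminf[symmetric]) auto
    also have "\<dots> = (\<integral>\<^sup>+z. emeasure (Q z) (\<Union> (range B)) \<partial>m)"
      using B B' by (intro nn_integral_cong suminf_emeasure) (auto simp: sets_Q)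
    finally show "(\<Sum>i. \<integral>\<^sup>+z. emeasure (Q z) (B i) \<partial>m) = (\<integral>\<^sup>+z. emeasure (Q z) (\<Union> (range B)) \<partial>m)" .
  qed
qed

lemma nn_integral_nu:
  assumes "F \<in> borel_measurable path_space"
  shows "(\<integral>\<^sup>+\<omega>. F \<omega> \<partial>nu m Q) = (\<integral>\<^sup>+z. \<integral>\<^sup>+\<omega>. F \<omega> \<partial>Q z \<partial>m)"
  using assms
proof (induction rule: borel_measurable_induct)
  case (cong f g)
  have "(\<integral>\<^sup>+\<omega>. g \<omega> \<partial>M) = (\<integral>\<^sup>+\<omega>. f \<omega> \<partial>M)" if "space M = paths" for M
    using cong(3) that by (intro nn_integral_cong) simp
  with cong show ?case by simp
next
  case (set A)
  then show ?case by (simp add: sets_nu sets_Q emeasure_nu)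
next
  case (mult f c)
  then show ?case
    using borel_measurable_Q_integral[of f]
    by (simp add: nn_integral_cmult borel_measurable_QI measurable_cong_sets[OF sets_nu refl]
        measurable_cong_sets[OF sets_m refl])
next
  case (add f g)
  then show ?case
    using borel_measurable_Q_integral[of f] borel_measurable_Q_integral[of g]
    by (simp add: nn_integral_add borel_measurable_QI measurable_cong_sets[OF sets_nu refl]
        measurable_cong_sets[OF sets_m refl])
next
  case (seq U)
  then have inc: "incseq U" by simp
  have "(\<integral>\<^sup>+\<omega>. (SUP i. U i \<omega>) \<partial>nu m Q) = (SUP i. \<integral>\<^sup>+\<omega>. U i \<omega> \<partial>nu m Q)"
    using seq by (intro nn_integral_monotone_convergence_SUP) (auto simp: measurable_cong_sets[OF sets_nu refl])
  also have "\<dots> = (SUP i. \<integral>\<^sup>+z. \<integral>\<^sup>+\<omega>. U i \<omega> \<partial>Q z \<partial>m)"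
    using seq by simp
  also have "\<dots> = (\<integral>\<^sup>+z. (SUP i. \<integral>\<^sup>+\<omega>. U i \<omega> \<partial>Q z) \<partial>m)"
  proof (rule nn_integral_monotone_convergence_SUP[symmetric])
    show "incseq (\<lambda>i z. \<integral>\<^sup>+\<omega>. U i \<omega> \<partial>Q z)"
      using inc by (auto simp: incseq_def le_fun_def intro!: nn_integral_mono)
    show "(\<lambda>z. \<integral>\<^sup>+\<omega>. U i \<omega> \<partial>Q z) \<in> borel_measurable m" for i
      using borel_measurable_Q_integral[of "U i"] seq(1) by (simp add: measurable_cong_sets[OF sets_m refl])
  qed
  also have "\<dots> = (\<integral>\<^sup>+z. \<integral>\<^sup>+\<omega>. (SUP i. U i \<omega>) \<partial>Q z \<partial>m)"
    using seq by (intro nn_integral_cong nn_integral_monotone_convergence_SUP[symmetric]) (auto intro: borel_measurable_QI)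
  finally show ?case by (simp add: SUP_apply image_comp)
qed

end

section \<open>Loop integrals as chains of potentials\<close>

lemma nn_integral_exp_tail:
  assumes \<alpha>: "0 < \<alpha>"
  shows "(\<integral>\<^sup>+r\<in>{0..}. ennreal (exp (- \<alpha> * r)) \<partial>lborel) = ennreal (1 / \<alpha>)"
proof -
  have "(\<integral>\<^sup>+r\<in>{0..}. ennreal (exp (- \<alpha> * r)) \<partial>lborel) = ennreal (0 - (- exp (- \<alpha> * 0) / \<alpha>))"
  proof (rule nn_integral_FTC_atLeast)
    have "((\<lambda>r. - exp (- \<alpha> * r) / \<alpha>) \<longlongrightarrow> - 0 / \<alpha>) at_top"
      using \<alpha> by (intro tendsto_intros filterlim_compose[OF exp_at_bot] filterlim_tendsto_neg_mult_at_bot[where c="-\<alpha>"] filterlim_ident) auto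
    then show "((\<lambda>r. - exp (- \<alpha> * r) / \<alpha>) \<longlongrightarrow> 0) at_top" by simp
  qed (use \<alpha> in \<open>auto intro!: derivative_eq_intros\<close>)
  then show ?thesis by simp
qed

text \<open>
  For a path alive at \<open>s\<close> this is \<open>exp(-\<alpha>s) - exp(-\<alpha>\<zeta>) = \<integral>\<^sub>s\<^sup>\<zeta> \<alpha> exp(-\<alpha>t) dt\<close>, written so that the integrand only
  involves whether the path is alive at time \<open>s + r\<close>.
\<close>

lemma exp_lifetime_decomposition:
  assumes \<alpha>: "0 < \<alpha>" and \<omega>: "\<omega> \<in> paths" and s: "0 < s"
  shows "ext0 (\<lambda>_. 1) (\<omega> s) * ennreal (exp_lifetime \<alpha> \<omega>) +
      ennreal (\<alpha> * exp (- \<alpha> * s)) * (\<integral>\<^sup>+r\<in>{0..}. ennreal (exp (- \<alpha> * r)) * ext0 (\<lambda>_. 1) (\<omega> (s + r)) \<partial>lborel)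
    = ennreal (exp (- \<alpha> * s)) * ext0 (\<lambda>_. 1) (\<omega> s)"
proof -
  let ?I = "\<integral>\<^sup>+r\<in>{0..}. ennreal (exp (- \<alpha> * r)) * ext0 (\<lambda>_. 1) (\<omega> (s + r)) \<partial>lborel"
  have alive: "ext0 (\<lambda>_. 1 :: ennreal) (\<omega> t) = (if ereal t < lifetime \<omega> then 1 else 0)" if "0 < t" for t
    using dead_iff_lifetime_le[OF \<omega> that] by (cases "\<omega> t") (auto simp: not_le)
  have deriv: "((\<lambda>r. - exp (- \<alpha> * r) / \<alpha>) has_real_derivative exp (- \<alpha> * r)) (at r)" for r
    using \<alpha> by (auto intro!: derivative_eq_intros)
  have I: "?I = (\<integral>\<^sup>+r. ennreal (exp (- \<alpha> * r)) * indicator {r. 0 \<le> r \<and> ereal (s + r) < lifetime \<omega>} r \<partial>lborel)"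
    using s by (intro nn_integral_cong) (auto simp: alive indicator_def)
  show ?thesis
  proof (cases "ereal s < lifetime \<omega>")
    case False
    then have "{r. 0 \<le> r \<and> ereal (s + r) < lifetime \<omega>} = {}"
      by (auto simp: not_less) (metis add_increasing2 ereal_less_eq(3) leD order.trans order_refl)
    then have "?I = 0" unfolding I by simp
    then show ?thesis using False s by (simp add: alive)
  next
    case True
    show ?thesis
    proof (cases "lifetime \<omega>")
      case PInf
      then have "?I = (\<integral>\<^sup>+r. ennreal (exp (- \<alpha> * r)) * indicator {0..} r \<partial>lborel)"
        unfolding I by (intro nn_integral_cong) (auto simp: indicator_def)
      also have "\<dots> = ennreal (1 / \<alpha>)" using \<alpha> by (rule nn_integral_exp_tail)
      finally have "?I = ennreal (1 / \<alpha>)" .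
      then show ?thesis
        using PInf \<alpha> s by (simp add: alive exp_lifetime_def ennreal_mult[symmetric])
    next
      case (real L)
      with True have L: "s < L" by simp
      have "?I = (\<integral>\<^sup>+r. ennreal (exp (- \<alpha> * r)) * indicator {0..L - s} r \<partial>lborel)"
        unfolding I
      proof (rule nn_integral_cong_AE)
        have "AE r in lborel. r \<noteq> L - s" by (rule AE_lborel_singleton)
        then show "AE r in lborel. ennreal (exp (- \<alpha> * r)) * indicator {r. 0 \<le> r \<and> ereal (s + r) < lifetime \<omega>} r
            = ennreal (exp (- \<alpha> * r)) * indicator {0..L - s} r"
          by eventually_elim (auto simp: real indicator_def)
      qed
      also have "\<dots> = ennreal (- exp (- \<alpha> * (L - s)) / \<alpha> - (- exp (- \<alpha> * 0) / \<alpha>))"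
        using L deriv by (intro nn_integral_FTC_Icc) (auto intro: has_field_derivative_at_within)
      also have "\<dots> = ennreal ((1 - exp (- \<alpha> * (L - s))) / \<alpha>)"
        by (simp add: diff_divide_distrib)
      finally have "ennreal (\<alpha> * exp (- \<alpha> * s)) * ?I = ennreal (\<alpha> * exp (- \<alpha> * s) * ((1 - exp (- \<alpha> * (L - s))) / \<alpha>))"
        using \<alpha> L by (simp add: ennreal_mult[symmetric])
      also have "\<alpha> * exp (- \<alpha> * s) * ((1 - exp (- \<alpha> * (L - s))) / \<alpha>) = exp (- \<alpha> * s) - exp (- \<alpha> * L)"
        using \<alpha> by (simp add: algebra_simps exp_add[symmetric] diff_divide_distrib)
      finally have *: "ennreal (\<alpha> * exp (- \<alpha> * s)) * ?I = ennreal (exp (- \<alpha> * s) - exp (- \<alpha> * L))" .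
      have "exp (- \<alpha> * L) \<le> exp (- \<alpha> * s)" using L \<alpha> by simp
      then show ?thesis
        unfolding * using real True s by (simp add: alive exp_lifetime_def ennreal_plus[symmetric] del: ennreal_plus)
    qed (use True in auto)
  qed
qed

text \<open>
  The truncation by which the finiteness assumption of \<open>Q_exp_lifetime_finite\<close> is removed below: \<open>g\<close> will be the value of
  an arbitrary function of the past and \<open>h = u(X\<^sub>s,z)\<close>.
\<close>

lemma SUP_truncation:
  fixes g h :: ennreal
  assumes "h < \<infinity>"
  shows "(SUP n. min g (of_nat n) * (if h \<le> of_nat n then 1 else 0)) = g"
proof (rule antisym)
  show "(SUP n. min g (of_nat n) * (if h \<le> of_nat n then 1 else 0)) \<le> g"
    by (intro SUP_least) auto
  obtain N where N: "h \<le> of_nat N"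
  proof -
    from assms obtain r where r: "h = ennreal r" "0 \<le> r" by (cases h) auto
    obtain N :: nat where "r \<le> real N" using real_arch_simple by blast
    then have "h \<le> of_nat N"
      unfolding r(1) ennreal_of_nat_eq_real_of_nat by (rule ennreal_leI)
    then show ?thesis by (rule that)
  qed
  have "g = inf g (SUP n. of_nat n)" by (simp add: ennreal_SUP_of_nat_eq_top)
  also have "\<dots> = (SUP n. inf g (of_nat n))" by (rule inf_SUP)
  also have "\<dots> \<le> (SUP n. min g (of_nat n) * (if h \<le> of_nat n then 1 else 0))"
  proof (rule SUP_mono)
    fix n
    have "h \<le> of_nat (max n N)" using N by (rule order_trans) simp
    moreover have "min g (of_nat n) \<le> min g (of_nat (max n N))"
      by (intro min.mono of_nat_mono order_refl) simp
    ultimately show "\<exists>k\<in>UNIV. inf g (of_nat n) \<le> min g (of_nat k) * (if h \<le> of_nat k then 1 else 0)"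
      by (intro bexI[of _ "max n N"]) (simp_all only: inf_min if_True mult_1_right UNIV_I)
  qed
  finally show "g \<le> (SUP n. min g (of_nat n) * (if h \<le> of_nat n then 1 else 0))" .
qed

context loop_process
begin

text \<open>
  Integrating the Markov property over the elapsed time replaces the transition kernels by \<open>u\<^sup>\<alpha>\<close>.
\<close>

lemma Q_resolvent:
  assumes s: "0 < s" and G: "G \<in> borel_measurable (path_algebra {0..s})" and [measurable]: "f \<in> borel_measurable borel"
  shows "(\<integral>\<^sup>+\<omega>. G \<omega> * (\<integral>\<^sup>+r\<in>{0..}. ennreal (exp (- \<alpha> * r)) * ext0 f (\<omega> (s + r)) \<partial>lborel) \<partial>Q z) =
    (\<integral>\<^sup>+\<omega>. G \<omega> * ext0 (\<lambda>x. (\<integral>\<^sup>+y. u \<alpha> x y * (f y * u 0 y z) \<partial>m) / u 0 x z) (\<omega> s) \<partial>Q z)"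
proof -
  let ?p = "\<lambda>r x. \<integral>\<^sup>+y. f y * u 0 y z \<partial>P (max r 0) x"
  let ?V = "\<lambda>x. (\<integral>\<^sup>+y. u \<alpha> x y * (f y * u 0 y z) \<partial>m) / u 0 x z"
  let ?I = "\<lambda>\<omega>. \<integral>\<^sup>+r\<in>{0..}. ennreal (exp (- \<alpha> * r)) * ext0 f (\<omega> (s + r)) \<partial>lborel"
  interpret QL: pair_sigma_finite "Q z" lborel ..
  have [measurable]: "G \<in> borel_measurable path_space"
    using G by (rule measurable_path_algebra_mono) auto
  let ?c = "\<lambda>r. ennreal (exp (- \<alpha> * r)) * indicator {0..} r"
  define K where "K r x = ?p r x / u 0 x z" for r x
  have "(\<lambda>p. \<integral>\<^sup>+y. f y * u 0 y z \<partial>P (max (fst p) 0) (snd p)) \<in> borel_measurable (borel \<Otimes>\<^sub>M borel)"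
    by (rule borel_measurable_P_integral) auto
  then have [measurable]: "(\<lambda>(r, x). K r x) \<in> borel_measurable (borel \<Otimes>\<^sub>M borel)"
    unfolding K_def case_prod_beta by measurable
  have "(\<integral>\<^sup>+\<omega>. G \<omega> * ?I \<omega> \<partial>Q z)
      = (\<integral>\<^sup>+\<omega>. \<integral>\<^sup>+r. G \<omega> * (?c r * ext0 f (\<omega> (s + r))) \<partial>lborel \<partial>Q z)"
  proof (rule nn_integral_cong)
    fix \<omega> assume "\<omega> \<in> space (Q z)"
    then have [measurable]: "(\<lambda>_. \<omega>) \<in> lborel \<rightarrow>\<^sub>M path_space" by simp
    have "(\<integral>\<^sup>+r. G \<omega> * (?c r * ext0 f (\<omega> (s + r))) \<partial>lborel) = G \<omega> * (\<integral>\<^sup>+r. ?c r * ext0 f (\<omega> (s + r)) \<partial>lborel)"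
      by (rule nn_integral_cmult) measurable
    then show "G \<omega> * ?I \<omega>
        = (\<integral>\<^sup>+r. G \<omega> * (?c r * ext0 f (\<omega> (s + r))) \<partial>lborel)"
      by (simp add: ac_simps)
  qed
  also have "\<dots> = (\<integral>\<^sup>+r. \<integral>\<^sup>+\<omega>. G \<omega> * (?c r * ext0 f (\<omega> (s + r))) \<partial>Q z \<partial>lborel)"
    by (rule QL.Fubini'[symmetric]) measurable
  also have "\<dots> = (\<integral>\<^sup>+r. \<integral>\<^sup>+\<omega>. G \<omega> * (?c r * ext0 (K r) (\<omega> s)) \<partial>Q z \<partial>lborel)"
  proof (rule nn_integral_cong)
    fix r :: real
    show "(\<integral>\<^sup>+\<omega>. G \<omega> * (?c r * ext0 f (\<omega> (s + r))) \<partial>Q z) = (\<integral>\<^sup>+\<omega>. G \<omega> * (?c r * ext0 (K r) (\<omega> s)) \<partial>Q z)"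
    proof (cases "0 \<le> r")
      case True
      have "(\<lambda>\<omega>. G \<omega> * ?c r) \<in> borel_measurable (path_algebra {0..s})" using G by measurable
      from markov_Q[OF s True this, of f] show ?thesis
        using True by (simp add: K_def[abs_def] max_def mult.assoc)
    qed simp
  qed
  also have "\<dots> = (\<integral>\<^sup>+\<omega>. \<integral>\<^sup>+r. G \<omega> * (?c r * ext0 (K r) (\<omega> s)) \<partial>lborel \<partial>Q z)"
    by (rule QL.Fubini') measurable
  also have "\<dots> = (\<integral>\<^sup>+\<omega>. G \<omega> * ext0 ?V (\<omega> s) \<partial>Q z)"
  proof (rule nn_integral_cong)
    fix \<omega>
    have *: "(\<integral>\<^sup>+r. ?c r * K r x \<partial>lborel) = (\<integral>\<^sup>+y. u \<alpha> x y * (f y * u 0 y z) \<partial>m) / u 0 x z" for x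
    proof -
      have "(\<lambda>r. ?p r x) \<in> borel_measurable borel"
        by (rule borel_measurable_P_integral) auto
      then have [measurable]: "(\<lambda>r. ?p r x) \<in> borel_measurable borel" .
      have "(\<integral>\<^sup>+r. ?c r * K r x \<partial>lborel) = (\<integral>\<^sup>+r. ?c r * ?p r x / u 0 x z \<partial>lborel)"
        by (simp add: K_def ennreal_times_divide)
      also have "\<dots> = (\<integral>\<^sup>+r. ?c r * ?p r x \<partial>lborel) / u 0 x z"
        by (rule nn_integral_divide) measurable
      also have "(\<integral>\<^sup>+r. ?c r * ?p r x \<partial>lborel)
          = (\<integral>\<^sup>+r\<in>{0..}. ennreal (exp (- \<alpha> * r)) * (\<integral>\<^sup>+y. f y * u 0 y z \<partial>P r x) \<partial>lborel)"
        by (intro nn_integral_cong) (auto simp: indicator_def)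
      also have "\<dots> = (\<integral>\<^sup>+y. u \<alpha> x y * (f y * u 0 y z) \<partial>m)"
        using \<alpha>_pos by (intro potential_integral) auto
      finally show ?thesis .
    qed
    have [measurable]: "(\<lambda>r. K r x) \<in> borel_measurable borel" for x
      using measurable_compose[OF measurable_Pair2'[of x borel borel], of "\<lambda>(r, x). K r x"] by simp
    show "(\<integral>\<^sup>+r. G \<omega> * (?c r * ext0 (K r) (\<omega> s)) \<partial>lborel)
        = G \<omega> * ext0 ?V (\<omega> s)"
      by (cases "\<omega> s") (auto simp: *[symmetric] nn_integral_cmult)
  qed
  finally show ?thesis .
qed

text \<open>
  Let \<open>h = u(\<cdot>,z)\<close>. Given \<open>X\<^sub>s = x\<close>, the discount \<open>exp(-\<alpha>(\<zeta> - s))\<close> has mean \<open>1 - \<alpha> U\<^sup>\<alpha>h(x) / h(x)\<close>, and this is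
  \<open>u\<^sup>\<alpha>(x,z) / h(x)\<close> by the resolvent equation. Both identities are used in additive form, and the common term
  is cancelled; this is where finiteness is needed.
\<close>

lemma Q_exp_lifetime_finite:
  assumes s: "0 < s" and G: "G \<in> borel_measurable (path_algebra {0..s})"
    and fin: "(\<integral>\<^sup>+\<omega>. G \<omega> * ext0 (\<lambda>_. 1) (\<omega> s) \<partial>Q z) < \<infinity>"
  shows "(\<integral>\<^sup>+\<omega>. G \<omega> * (ext0 (\<lambda>_. 1) (\<omega> s) * ennreal (exp_lifetime \<alpha> \<omega>)) \<partial>Q z) =
    (\<integral>\<^sup>+\<omega>. G \<omega> * (ennreal (exp (- \<alpha> * s)) * ext0 (\<lambda>x. u \<alpha> x z / u 0 x z) (\<omega> s)) \<partial>Q z)"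
    (is "?X = ?Y")
proof -
  have [measurable]: "G \<in> borel_measurable (Q z)"
    using measurable_path_algebra_mono[OF G, of "{0..}"] by (auto intro: borel_measurable_QI)
  note [measurable] = measurable_ext0_coord_Q[OF s]
  let ?c = "ennreal (\<alpha> * exp (- \<alpha> * s))" and ?e = "ennreal (exp (- \<alpha> * s))"
  define I where "I \<omega> = (\<integral>\<^sup>+r\<in>{0..}. ennreal (exp (- \<alpha> * r)) * ext0 (\<lambda>_. 1) (\<omega> (s + r)) \<partial>lborel)" for \<omega> :: "'s path"
  have "I \<in> borel_measurable path_space"
    unfolding I_def by measurable
  then have I [measurable]: "I \<in> borel_measurable (Q z)" by (rule borel_measurable_QI)
  let ?B = "\<integral>\<^sup>+\<omega>. G \<omega> * (?c * I \<omega>) \<partial>Q z"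
  define V where "V x = (\<integral>\<^sup>+y. u \<alpha> x y * u 0 y z \<partial>m)" for x
  let ?U = "\<lambda>\<omega>. ext0 (\<lambda>x. u \<alpha> x z / u 0 x z) (\<omega> s)"
  let ?V = "\<lambda>\<omega>. ext0 (\<lambda>x. V x / u 0 x z) (\<omega> s)"
  have [measurable]: "V \<in> borel_measurable borel" unfolding V_def by measurable
  have sum: "?X + ?B = (\<integral>\<^sup>+\<omega>. G \<omega> * (?e * ext0 (\<lambda>_. 1) (\<omega> s)) \<partial>Q z)"
  proof -
    have "?X + ?B = (\<integral>\<^sup>+\<omega>. G \<omega> * (ext0 (\<lambda>_. 1) (\<omega> s) * ennreal (exp_lifetime \<alpha> \<omega>)) + G \<omega> * (?c * I \<omega>) \<partial>Q z)"
      by (rule nn_integral_add[symmetric]) measurable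
    also have "\<dots> = (\<integral>\<^sup>+\<omega>. G \<omega> * (?e * ext0 (\<lambda>_. 1) (\<omega> s)) \<partial>Q z)"
    proof (rule nn_integral_cong)
      fix \<omega> assume "\<omega> \<in> space (Q z)"
      then have "\<omega> \<in> paths" by simp
      from exp_lifetime_decomposition[OF \<alpha>_pos this s]
      show "G \<omega> * (ext0 (\<lambda>_. 1) (\<omega> s) * ennreal (exp_lifetime \<alpha> \<omega>)) + G \<omega> * (?c * I \<omega>)
          = G \<omega> * (?e * ext0 (\<lambda>_. 1) (\<omega> s))"
        by (simp only: distrib_left[symmetric] I_def)
    qed
    finally show ?thesis .
  qed
  have "(\<integral>\<^sup>+\<omega>. G \<omega> * (?e * ext0 (\<lambda>_. 1) (\<omega> s)) \<partial>Q z) = ?e * (\<integral>\<^sup>+\<omega>. G \<omega> * ext0 (\<lambda>_. 1) (\<omega> s) \<partial>Q z)"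
    by (subst nn_integral_cmult[symmetric]) (auto simp: ac_simps)
  also have "\<dots> < \<infinity>" using fin by (simp add: ennreal_mult_less_top)
  finally have "?B < \<infinity>" unfolding sum[symmetric] by simp
  have "?B = ?c * (\<integral>\<^sup>+\<omega>. G \<omega> * I \<omega> \<partial>Q z)"
    by (subst nn_integral_cmult[symmetric]) (auto simp: ac_simps)
  also have "(\<integral>\<^sup>+\<omega>. G \<omega> * I \<omega> \<partial>Q z) = (\<integral>\<^sup>+\<omega>. G \<omega> * ?V \<omega> \<partial>Q z)"
    using Q_resolvent[OF s G, of "\<lambda>_. 1"] by (simp add: I_def V_def)
  also have "?c * \<dots> = (\<integral>\<^sup>+\<omega>. G \<omega> * (?c * ?V \<omega>) \<partial>Q z)"
    by (subst nn_integral_cmult[symmetric]) (auto simp: ac_simps)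
  finally have B: "?B = (\<integral>\<^sup>+\<omega>. G \<omega> * (?c * ?V \<omega>) \<partial>Q z)" .
  have "?Y + ?B = (\<integral>\<^sup>+\<omega>. G \<omega> * (?e * ?U \<omega>)
      + G \<omega> * (?c * ?V \<omega>) \<partial>Q z)"
    unfolding B by (rule nn_integral_add[symmetric]) measurable
  also have "\<dots> = (\<integral>\<^sup>+\<omega>. G \<omega> * (?e * ext0 (\<lambda>_. 1) (\<omega> s)) \<partial>Q z)"
  proof (rule nn_integral_cong_AE, use AE_Q_neq[OF s, of z] in eventually_elim)
    fix \<omega> :: "'s path" assume nz: "\<omega> s \<noteq> Some z"
    have "?e * ?U \<omega> + ?c * ?V \<omega> = ?e * ext0 (\<lambda>_. 1) (\<omega> s)"
    proof (cases "\<omega> s")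
      case (Some x)
      have "u 0 x z = u \<alpha> x z + ennreal \<alpha> * V x"
        unfolding V_def by (rule resolvent_at_0)
      then have "(u \<alpha> x z + ennreal \<alpha> * V x) / u 0 x z = 1"
        using finite_off_diagonal[of x z] nz Some u_pos(1)[of x z]
        by (auto intro!: ennreal_divide_self simp: less_top)
      moreover have "?e * (u \<alpha> x z / u 0 x z) + ?c * (V x / u 0 x z) = ?e * ((u \<alpha> x z + ennreal \<alpha> * V x) / u 0 x z)"
        using \<alpha>_pos by (simp add: divide_ennreal_def distrib_left distrib_right ennreal_mult ac_simps)
      ultimately show ?thesis using Some by simp
    qed simp
    then show "G \<omega> * (?e * ?U \<omega>)
      + G \<omega> * (?c * ?V \<omega>) = G \<omega> * (?e * ext0 (\<lambda>_. 1) (\<omega> s))"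
      by (simp only: distrib_left[symmetric])
  qed
  finally have "?X + ?B = ?Y + ?B" using sum by simp
  then show ?thesis
    using \<open>?B < \<infinity>\<close> by (auto simp: ennreal_add_left_cancel add.commute[of _ ?B])
qed

text \<open>
  The measure \<open>f \<mapsto> Q\<^sup>z\<^sup>,\<^sup>z(f(X\<^sub>s))\<close> has density \<open>u(\<cdot>,z)\<close> with respect to a sub-probability measure, so truncating
  both \<open>G\<close> and \<open>u(X\<^sub>s,z)\<close> at level \<open>n\<close> gives a finite integral; monotone convergence does the rest.
\<close>

lemma Q_exp_lifetime:
  assumes s: "0 < s" and G: "G \<in> borel_measurable (path_algebra {0..s})"
  shows "(\<integral>\<^sup>+\<omega>. G \<omega> * (ext0 (\<lambda>_. 1) (\<omega> s) * ennreal (exp_lifetime \<alpha> \<omega>)) \<partial>Q z) =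
    (\<integral>\<^sup>+\<omega>. G \<omega> * (ennreal (exp (- \<alpha> * s)) * ext0 (\<lambda>x. u \<alpha> x z / u 0 x z) (\<omega> s)) \<partial>Q z)"
proof -
  let ?L = "\<lambda>\<omega>. ext0 (\<lambda>_. 1) (\<omega> s) * ennreal (exp_lifetime \<alpha> \<omega>)"
  let ?R = "\<lambda>\<omega>. ennreal (exp (- \<alpha> * s)) * ext0 (\<lambda>x. u \<alpha> x z / u 0 x z) (\<omega> s)"
  let ?k = "\<lambda>n x. if u 0 x z \<le> of_nat n then 1 else 0 :: ennreal"
  define H where "H n \<omega> = min (G \<omega>) (of_nat n) * ext0 (?k n) (\<omega> s)" for n \<omega>
  have coord [measurable]: "(\<lambda>\<omega>. \<omega> s) \<in> path_algebra {0..s} \<rightarrow>\<^sub>M (borel :: 's option measure)"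
    using s by (intro measurable_coord) auto
  have H: "H n \<in> borel_measurable (path_algebra {0..s})" for n
    unfolding H_def using G by (intro borel_measurable_times_ennreal borel_measurable_min measurable_ext0 coord) auto
  have HQ [measurable]: "H n \<in> borel_measurable (Q z)" for n
    using measurable_path_algebra_mono[OF H, of "{0..}"] by (auto intro: borel_measurable_QI)
  have fin: "(\<integral>\<^sup>+\<omega>. H n \<omega> * ext0 (\<lambda>_. 1) (\<omega> s) \<partial>Q z) < \<infinity>" for n
  proof -
    interpret subprob_space "P s z" using s by (intro subprob_P) auto
    have "(\<integral>\<^sup>+\<omega>. H n \<omega> * ext0 (\<lambda>_. 1) (\<omega> s) \<partial>Q z) \<le> (\<integral>\<^sup>+\<omega>. ext0 (\<lambda>x. of_nat n * ?k n x) (\<omega> s) \<partial>Q z)"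
    proof (rule nn_integral_mono)
      fix \<omega> show "H n \<omega> * ext0 (\<lambda>_. 1) (\<omega> s) \<le> ext0 (\<lambda>x. of_nat n * ?k n x) (\<omega> s)"
        by (cases "\<omega> s") (auto simp: H_def)
    qed
    also have "\<dots> = (\<integral>\<^sup>+y. of_nat n * ?k n y * u 0 y z \<partial>P s z)"
      using s by (intro nn_integral_Q_one_time) auto
    also have "\<dots> \<le> (\<integral>\<^sup>+y. of_nat n * of_nat n \<partial>P s z)"
      by (intro nn_integral_mono) (auto intro: mult_left_mono)
    also have "\<dots> < \<infinity>"
    proof -
      have "emeasure (P s z) (space (P s z)) < \<top>"
        using emeasure_finite[of "space (P s z)"] less_top by blast
      then show ?thesis by (simp add: ennreal_mult_less_top of_nat_less_top)
    qed
    finally show ?thesis .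
  qed
  have inc: "incseq H"
    unfolding incseq_def le_fun_def H_def
  proof (intro allI impI mult_mono)
    fix i j :: nat and \<omega> :: "'s path" assume "i \<le> j"
    then have ij: "of_nat i \<le> (of_nat j :: ennreal)" by simp
    then show "min (G \<omega>) (of_nat i) \<le> min (G \<omega>) (of_nat j)" by (intro min.mono) auto
    show "ext0 (?k i) (\<omega> s) \<le> ext0 (?k j) (\<omega> s)"
      using ij by (cases "\<omega> s") (auto intro: order_trans)
  qed auto
  have lim: "(\<integral>\<^sup>+\<omega>. G \<omega> * W \<omega> \<partial>Q z) = (SUP n. \<integral>\<^sup>+\<omega>. H n \<omega> * W \<omega> \<partial>Q z)"
    if W [measurable]: "W \<in> borel_measurable (Q z)" and dead: "\<And>\<omega>. \<omega> s = None \<Longrightarrow> W \<omega> = 0" for W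
  proof -
    have "(\<integral>\<^sup>+\<omega>. G \<omega> * W \<omega> \<partial>Q z) = (\<integral>\<^sup>+\<omega>. (SUP n. H n \<omega> * W \<omega>) \<partial>Q z)"
    proof (rule nn_integral_cong_AE, use AE_Q_neq[OF s, of z] in eventually_elim)
      fix \<omega> :: "'s path" assume nz: "\<omega> s \<noteq> Some z"
      show "G \<omega> * W \<omega> = (SUP n. H n \<omega> * W \<omega>)"
      proof (cases "\<omega> s")
        case None
        then show ?thesis using dead by simp
      next
        case (Some x)
        then have "(SUP n. H n \<omega>) = G \<omega>"
          using SUP_truncation[OF finite_off_diagonal[of x z], of "G \<omega>"] nz by (simp add: H_def)
        then show ?thesis by (simp add: SUP_mult_right_ennreal[symmetric])
      qed
    qed
    also have "\<dots> = (SUP n. \<integral>\<^sup>+\<omega>. H n \<omega> * W \<omega> \<partial>Q z)"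
      using inc by (intro nn_integral_monotone_convergence_SUP)
        (auto simp: incseq_def le_fun_def intro!: mult_right_mono)
    finally show ?thesis .
  qed
  note [measurable] = measurable_ext0_coord_Q[OF s]
  have "(\<integral>\<^sup>+\<omega>. G \<omega> * ?L \<omega> \<partial>Q z)
      = (SUP n. \<integral>\<^sup>+\<omega>. H n \<omega> * ?L \<omega> \<partial>Q z)"
    by (rule lim) auto
  also have "\<dots> = (SUP n. \<integral>\<^sup>+\<omega>. H n \<omega> * ?R \<omega> \<partial>Q z)"
    by (simp only: Q_exp_lifetime_finite[OF s H fin])
  also have "\<dots> = (\<integral>\<^sup>+\<omega>. G \<omega> * ?R \<omega> \<partial>Q z)"
    by (rule lim[symmetric]) auto
  finally show ?thesis .
qed


text \<open>
  For \<open>gs = [g\<^sub>1, \<dots>, g\<^sub>k]\<close> this is the integral of \<open>u\<^sup>\<alpha>(x,y\<^sub>1) g\<^sub>1(y\<^sub>1) u\<^sup>\<alpha>(y\<^sub>1,y\<^sub>2) \<cdots> g\<^sub>k(y\<^sub>k) u\<^sup>\<alpha>(y\<^sub>k,z)\<close>; the start \<open>x\<close>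
  and the end \<open>z\<close> are kept apart for the sake of the recursion.
\<close>

primrec potential_chain :: "'s \<Rightarrow> ('s \<Rightarrow> ennreal) list \<Rightarrow> 's \<Rightarrow> ennreal" where
  "potential_chain z [] x = u \<alpha> x z"
| "potential_chain z (g # gs) x = (\<integral>\<^sup>+y. u \<alpha> x y * (g y * potential_chain z gs y) \<partial>m)"

lemma borel_measurable_potential_chain:
  "(\<And>g. g \<in> set gs \<Longrightarrow> g \<in> borel_measurable borel) \<Longrightarrow> potential_chain z gs \<in> borel_measurable borel"
proof (induction gs)
  case Nil
  have "(\<lambda>x. u \<alpha> x z) \<in> borel_measurable borel" by measurable
  then show ?case by (simp cong: measurable_cong)
next
  case (Cons g gs)
  then have [measurable]: "g \<in> borel_measurable borel" "potential_chain z gs \<in> borel_measurable borel"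
    by auto
  have "(\<lambda>x. \<integral>\<^sup>+y. u \<alpha> x y * (g y * potential_chain z gs y) \<partial>m) \<in> borel_measurable borel"
    by measurable
  then show ?case by (simp cong: measurable_cong)
qed

text \<open>
  The integral of \<open>g\<^sub>1(X(t\<^sub>1)) \<cdots> g\<^sub>k(X(t\<^sub>k)) exp(-\<alpha>\<zeta>)\<close> over \<open>s \<le> t\<^sub>1 \<le> \<cdots> \<le> t\<^sub>k\<close> along one path.
\<close>

definition ordered_functional :: "('s \<Rightarrow> ennreal) list \<Rightarrow> real \<Rightarrow> 's path \<Rightarrow> ennreal"
  where "ordered_functional gs s \<omega> =
    time_ordered (ennreal (exp_lifetime \<alpha> \<omega>)) (map (\<lambda>g t. ext0 g (\<omega> t)) gs) s"

lemma ordered_functional_Nil: "ordered_functional [] s \<omega> = ennreal (exp_lifetime \<alpha> \<omega>)"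
  and ordered_functional_Cons: "ordered_functional (g # gs) s \<omega> =
    (\<integral>\<^sup>+t\<in>{s..}. ext0 g (\<omega> t) * ordered_functional gs t \<omega> \<partial>lborel)"
  by (simp_all add: ordered_functional_def)

lemma borel_measurable_ordered_functional:
  assumes "\<And>g. g \<in> set gs \<Longrightarrow> g \<in> borel_measurable borel"
  shows "(\<lambda>(s, \<omega>). ordered_functional gs s \<omega>) \<in> borel_measurable (borel \<Otimes>\<^sub>M path_space)"
  unfolding ordered_functional_def case_prod_beta
proof (rule borel_measurable_time_ordered)
  fix g assume "g \<in> set gs"
  then have [measurable]: "g \<in> borel_measurable borel" by (rule assms)
  show "(\<lambda>(p, t). ext0 g (snd p t)) \<in> borel_measurable ((borel \<Otimes>\<^sub>M path_space) \<Otimes>\<^sub>M borel)"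
    by measurable
qed auto

lemma transform_cancel:
  assumes "y \<noteq> z"
  shows "g * (c / u 0 y z) * u 0 y z = g * c"
proof -
  have "c / u 0 y z * u 0 y z = c"
  proof -
    have "c / u 0 y z * u 0 y z = c * (u 0 y z / u 0 y z)"
      by (simp add: divide_ennreal_def ac_simps)
    also have "u 0 y z / u 0 y z = 1"
      using finite_off_diagonal[OF assms] u_pos(1)[of y z] by (intro ennreal_divide_self) (auto simp: less_top)
    finally show ?thesis by simp
  qed
  then show ?thesis by (simp add: mult.assoc)
qed

text \<open>
  The point \<open>z\<close>, where \<open>u(\<cdot>,z)\<close> may be infinite and cannot be cancelled, is not charged by \<open>m\<close>.
\<close>

lemma potential_chain_Cons_transform:
  "(\<integral>\<^sup>+y. u \<alpha> x y * (g y * (potential_chain z gs y / u 0 y z) * u 0 y z) \<partial>m) = potential_chain z (g # gs) x"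
  unfolding potential_chain.simps
  by (rule nn_integral_cong_AE, use AE_m_neq[of z] in eventually_elim) (subst transform_cancel, assumption, rule refl)

lemma nn_integral_tail_shift:
  fixes \<phi> :: "real \<Rightarrow> ennreal"
  assumes "\<phi> \<in> borel_measurable borel"
  shows "(\<integral>\<^sup>+t\<in>{s..}. \<phi> t \<partial>lborel) = (\<integral>\<^sup>+r\<in>{0..}. \<phi> (s + r) \<partial>lborel)"
  using nn_integral_real_affine[of "\<lambda>t. \<phi> t * indicator {s..} t" 1 s] assms
  by (simp add: indicator_def)

text \<open>
  The Markov property is applied at the successive times \<open>t\<^sub>k, \<dots>, t\<^sub>1\<close>; each application contributes one
  potential and cancels the function \<open>u(\<cdot>,z)\<close> left over by the preceding one.
\<close>

lemma Q_ordered_functional: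
  assumes "0 < s" "G \<in> borel_measurable (path_algebra {0..s})"
    and "\<And>g. g \<in> set gs \<Longrightarrow> g \<in> borel_measurable borel"
  shows "(\<integral>\<^sup>+\<omega>. G \<omega> * (ext0 (\<lambda>_. 1) (\<omega> s) * ordered_functional gs s \<omega>) \<partial>Q z) =
    (\<integral>\<^sup>+\<omega>. G \<omega> * (ennreal (exp (- \<alpha> * s)) * ext0 (\<lambda>x. potential_chain z gs x / u 0 x z) (\<omega> s)) \<partial>Q z)"
  using assms
proof (induction gs arbitrary: s G)
  case Nil
  then show ?case by (simp only: ordered_functional_Nil potential_chain.simps Q_exp_lifetime)
next
  case (Cons g gs)
  interpret QL: pair_sigma_finite "Q z" lborel ..
  note s = \<open>0 < s\<close>
  have g [measurable]: "g \<in> borel_measurable borel" using Cons.prems by auto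
  have chain [measurable]: "potential_chain z gs \<in> borel_measurable borel"
    using Cons.prems by (intro borel_measurable_potential_chain) auto
  have [measurable]: "(\<lambda>(s, \<omega>). ordered_functional gs s \<omega>) \<in> borel_measurable (borel \<Otimes>\<^sub>M path_space)"
    using Cons.prems by (intro borel_measurable_ordered_functional) auto
  define f where "f y = g y * (potential_chain z gs y / u 0 y z)" for y
  have f [measurable]: "f \<in> borel_measurable borel" unfolding f_def by measurable
  define G1 where "G1 \<omega> = G \<omega> * ext0 (\<lambda>_. 1) (\<omega> s)" for \<omega>
  let ?e = "\<lambda>t. ennreal (exp (- \<alpha> * t))"
  let ?J = "ordered_functional gs" and ?c = "potential_chain z gs"
  let ?I = "\<lambda>\<omega>. \<integral>\<^sup>+r\<in>{0..}. ?e r * ext0 f (\<omega> (s + r)) \<partial>lborel"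
  let ?A = "\<lambda>\<omega> t. G1 \<omega> * (ext0 g (\<omega> t) * ?J t \<omega> * indicator {s..} t)"
  let ?B = "\<lambda>\<omega> t. G1 \<omega> * (?e t * ext0 f (\<omega> t) * indicator {s..} t)"
  have coord: "(\<lambda>\<omega>. \<omega> t) \<in> path_algebra {0..r} \<rightarrow>\<^sub>M (borel :: 's option measure)" if "0 \<le> t" "t \<le> r" for t r
    using that by (intro measurable_coord) auto
  have G1_s: "G1 \<in> borel_measurable (path_algebra {0..s})"
    unfolding G1_def using s Cons.prems(2)
    by (intro borel_measurable_times_ennreal measurable_ext0 coord) auto
  have G1 [measurable]: "G1 \<in> borel_measurable path_space"
    using G1_s by (rule measurable_path_algebra_mono) auto
  have section_meas: "(\<lambda>t. F t \<omega>) \<in> borel_measurable lborel"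
    if "(\<lambda>(t, \<omega>). F t \<omega>) \<in> borel_measurable (borel \<Otimes>\<^sub>M path_space)" "\<omega> \<in> paths" for F :: "real \<Rightarrow> 's path \<Rightarrow> ennreal" and \<omega>
    using measurable_compose[OF measurable_Pair2'[of \<omega> path_space borel] that(1)] that(2) by simp
  have "(\<integral>\<^sup>+\<omega>. G \<omega> * (ext0 (\<lambda>_. 1) (\<omega> s) * ordered_functional (g # gs) s \<omega>) \<partial>Q z)
      = (\<integral>\<^sup>+\<omega>. \<integral>\<^sup>+t. ?A \<omega> t \<partial>lborel \<partial>Q z)"
  proof (rule nn_integral_cong)
    fix \<omega> assume "\<omega> \<in> space (Q z)"
    then have "\<omega> \<in> paths" by simp
    have "(\<lambda>(t, \<omega>). ext0 g (\<omega> t) * ?J t \<omega> * indicator {s..} t) \<in> borel_measurable (borel \<Otimes>\<^sub>M path_space)"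
      by measurable
    from nn_integral_cmult[OF section_meas[OF this \<open>\<omega> \<in> paths\<close>], of "G1 \<omega>"]
    show "G \<omega> * (ext0 (\<lambda>_. 1) (\<omega> s) * ordered_functional (g # gs) s \<omega>)
        = (\<integral>\<^sup>+t. ?A \<omega> t \<partial>lborel)"
      by (simp only: ordered_functional_Cons G1_def mult.assoc)
  qed
  also have "\<dots> = (\<integral>\<^sup>+t. \<integral>\<^sup>+\<omega>. ?A \<omega> t \<partial>Q z \<partial>lborel)"
    by (rule QL.Fubini'[symmetric]) measurable
  also have "\<dots> = (\<integral>\<^sup>+t. \<integral>\<^sup>+\<omega>. ?B \<omega> t \<partial>Q z \<partial>lborel)"
  proof (rule nn_integral_cong)
    fix t :: real
    show "(\<integral>\<^sup>+\<omega>. ?A \<omega> t \<partial>Q z)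
        = (\<integral>\<^sup>+\<omega>. ?B \<omega> t \<partial>Q z)"
    proof (cases "s \<le> t")
      case True
      have "(\<integral>\<^sup>+\<omega>. (G1 \<omega> * ext0 g (\<omega> t)) * (ext0 (\<lambda>_. 1) (\<omega> t) * ?J t \<omega>) \<partial>Q z)
        = (\<integral>\<^sup>+\<omega>. (G1 \<omega> * ext0 g (\<omega> t)) * (?e t * ext0 (\<lambda>x. ?c x / u 0 x z) (\<omega> t)) \<partial>Q z)"
      proof (rule Cons.IH)
        show "0 < t" using True s by simp
        have "G1 \<in> borel_measurable (path_algebra {0..t})"
          using G1_s by (rule measurable_path_algebra_mono) (use True in auto)
        then show "(\<lambda>\<omega>. G1 \<omega> * ext0 g (\<omega> t)) \<in> borel_measurable (path_algebra {0..t})"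
          using True s by (intro borel_measurable_times_ennreal measurable_ext0 coord) auto
      qed (use Cons.prems in auto)
      moreover have "(G1 \<omega> * ext0 g (\<omega> t)) * (ext0 (\<lambda>_. 1) (\<omega> t) * ?J t \<omega>)
          = G1 \<omega> * (ext0 g (\<omega> t) * ?J t \<omega>)" for \<omega>
        by (cases "\<omega> t") (simp_all add: mult.assoc)
      moreover have "(G1 \<omega> * ext0 g (\<omega> t)) * (?e t * ext0 (\<lambda>x. ?c x / u 0 x z) (\<omega> t))
          = G1 \<omega> * (?e t * ext0 f (\<omega> t))" for \<omega>
        by (cases "\<omega> t") (simp_all add: f_def ac_simps)
      ultimately show ?thesis using True by simp
    qed simp
  qed
  also have "\<dots> = (\<integral>\<^sup>+\<omega>. \<integral>\<^sup>+t. ?B \<omega> t \<partial>lborel \<partial>Q z)"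
    by (rule QL.Fubini') measurable
  also have "\<dots> = (\<integral>\<^sup>+\<omega>. (G1 \<omega> * ?e s) *
      ?I \<omega> \<partial>Q z)"
  proof (rule nn_integral_cong)
    fix \<omega> assume "\<omega> \<in> space (Q z)"
    then have \<omega>: "\<omega> \<in> paths" by simp
    have "(\<lambda>(t, \<omega>). ext0 f (\<omega> t)) \<in> borel_measurable (borel \<Otimes>\<^sub>M path_space)" by measurable
    from section_meas[OF this \<omega>] have m [measurable]: "(\<lambda>t. ext0 f (\<omega> t)) \<in> borel_measurable borel"
      by (simp only: measurable_lborel2)
    have e: "(\<lambda>t. ?e t) \<in> borel_measurable borel" by measurable
    have m': "(\<lambda>t. ext0 f (\<omega> (s + t))) \<in> borel_measurable borel"
      by (rule measurable_compose[OF _ m]) simp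
    have ind: "(indicator {r..} :: real \<Rightarrow> ennreal) \<in> borel_measurable borel" for r by simp
    have "(\<integral>\<^sup>+t. ?B \<omega> t \<partial>lborel)
        = G1 \<omega> * (\<integral>\<^sup>+t\<in>{s..}. ?e t * ext0 f (\<omega> t) \<partial>lborel)"
      by (rule nn_integral_cmult, unfold measurable_lborel2) (intro borel_measurable_times_ennreal e m ind)
    also have "(\<integral>\<^sup>+t\<in>{s..}. ?e t * ext0 f (\<omega> t) \<partial>lborel)
        = (\<integral>\<^sup>+r\<in>{0..}. ennreal (exp (- \<alpha> * (s + r))) * ext0 f (\<omega> (s + r)) \<partial>lborel)"
      by (rule nn_integral_tail_shift) (intro borel_measurable_times_ennreal e m)
    also have "\<dots> = (\<integral>\<^sup>+r. ?e s * (?e r * ext0 f (\<omega> (s + r)) * indicator {0..} r) \<partial>lborel)"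
    proof (rule nn_integral_cong)
      fix r
      have "ennreal (exp (- \<alpha> * (s + r))) = ?e s * ?e r"
        by (simp add: ennreal_mult[symmetric] exp_add[symmetric] algebra_simps)
      then show "ennreal (exp (- \<alpha> * (s + r))) * ext0 f (\<omega> (s + r)) * indicator {0..} r =
          ?e s * (?e r * ext0 f (\<omega> (s + r)) * indicator {0..} r)"
        by (simp only: mult.assoc)
    qed
    also have "\<dots> = ?e s * ?I \<omega>"
      by (rule nn_integral_cmult, unfold measurable_lborel2) (intro borel_measurable_times_ennreal e m' ind)
    finally show "(\<integral>\<^sup>+t. ?B \<omega> t \<partial>lborel)
      = (G1 \<omega> * ?e s) *
      ?I \<omega>"
      by (simp only: mult.assoc)
  qed
  also have "\<dots> = (\<integral>\<^sup>+\<omega>. (G1 \<omega> * ?e s) *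
      ext0 (\<lambda>x. (\<integral>\<^sup>+y. u \<alpha> x y * (f y * u 0 y z) \<partial>m) / u 0 x z) (\<omega> s) \<partial>Q z)"
    by (intro Q_resolvent s borel_measurable_times_ennreal G1_s borel_measurable_const f)
  also have "\<dots> = (\<integral>\<^sup>+\<omega>. G \<omega> * (?e s * ext0 (\<lambda>x. potential_chain z (g # gs) x / u 0 x z) (\<omega> s)) \<partial>Q z)"
  proof (rule nn_integral_cong)
    fix \<omega>
    show "G1 \<omega> * ?e s * ext0 (\<lambda>x. (\<integral>\<^sup>+y. u \<alpha> x y * (f y * u 0 y z) \<partial>m) / u 0 x z) (\<omega> s)
      = G \<omega> * (?e s * ext0 (\<lambda>x. potential_chain z (g # gs) x / u 0 x z) (\<omega> s))"
      unfolding f_def potential_chain_Cons_transform G1_def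
      by (cases "\<omega> s") (simp_all only: ext0_simps mult.assoc mult_zero_right mult_1_left mult_1_right)
  qed
  finally show ?case .
qed

text \<open>
  The first time is governed by the entrance law, whose density cancels the denominator \<open>u(\<cdot>,z)\<close> left over by the
  Markov property.
\<close>

lemma Q_ordered_functional_total:
  assumes "gs \<noteq> []" and "\<And>g. g \<in> set gs \<Longrightarrow> g \<in> borel_measurable borel"
  shows "(\<integral>\<^sup>+\<omega>. ordered_functional gs 0 \<omega> \<partial>Q z) = potential_chain z gs z"
proof -
  obtain g gs' where gs: "gs = g # gs'" using assms by (cases gs) auto
  interpret QL: pair_sigma_finite "Q z" lborel ..
  have g [measurable]: "g \<in> borel_measurable borel" using assms gs by auto
  have chain [measurable]: "potential_chain z gs' \<in> borel_measurable borel"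
    using assms gs by (intro borel_measurable_potential_chain) auto
  have [measurable]: "(\<lambda>(s, \<omega>). ordered_functional gs' s \<omega>) \<in> borel_measurable (borel \<Otimes>\<^sub>M path_space)"
    using assms gs by (intro borel_measurable_ordered_functional) auto
  define f where "f y = g y * (potential_chain z gs' y / u 0 y z)" for y
  have f [measurable]: "f \<in> borel_measurable borel" unfolding f_def by measurable
  let ?e = "\<lambda>t. ennreal (exp (- \<alpha> * t))"
  let ?J = "ordered_functional gs'"
  let ?U = "\<lambda>t. \<integral>\<^sup>+y. f y * u 0 y z \<partial>P t z"
  let ?A = "\<lambda>t \<omega>. ext0 g (\<omega> t) * ?J t \<omega> * indicator {0..} t"
  have "(\<integral>\<^sup>+\<omega>. ordered_functional gs 0 \<omega> \<partial>Q z)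
      = (\<integral>\<^sup>+t. \<integral>\<^sup>+\<omega>. ?A t \<omega> \<partial>Q z \<partial>lborel)"
    unfolding gs ordered_functional_Cons by (rule QL.Fubini'[symmetric]) measurable
  also have "\<dots> = (\<integral>\<^sup>+t\<in>{0..}. ?e t * ?U t \<partial>lborel)"
  proof (rule nn_integral_cong_AE, use AE_lborel_singleton[of 0] in eventually_elim)
    fix t :: real assume "t \<noteq> 0"
    show "(\<integral>\<^sup>+\<omega>. ?A t \<omega> \<partial>Q z)
      = ?e t * ?U t * indicator {0..} t"
    proof (cases "0 < t")
      case True
      have coord: "(\<lambda>\<omega>. \<omega> t) \<in> path_algebra {0..t} \<rightarrow>\<^sub>M (borel :: 's option measure)"
        using True by (intro measurable_coord) auto
      have "(\<integral>\<^sup>+\<omega>. ext0 g (\<omega> t) * ?J t \<omega> \<partial>Q z)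
        = (\<integral>\<^sup>+\<omega>. ext0 g (\<omega> t) * (ext0 (\<lambda>_. 1) (\<omega> t) * ?J t \<omega>) \<partial>Q z)"
        by (intro nn_integral_cong) (simp only: mult.assoc[symmetric] mult.commute[of "ext0 g _"] ext0_one_mult)
      also have "\<dots> = (\<integral>\<^sup>+\<omega>. ext0 g (\<omega> t) * (?e t * ext0 (\<lambda>x. potential_chain z gs' x / u 0 x z) (\<omega> t)) \<partial>Q z)"
        using True assms gs coord by (intro Q_ordered_functional measurable_ext0) auto
      also have "\<dots> = (\<integral>\<^sup>+\<omega>. ?e t * ext0 f (\<omega> t) \<partial>Q z)"
      proof (rule nn_integral_cong)
        fix \<omega> show "ext0 g (\<omega> t) * (?e t * ext0 (\<lambda>x. potential_chain z gs' x / u 0 x z) (\<omega> t))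
          = ?e t * ext0 f (\<omega> t)"
          by (cases "\<omega> t") (simp_all add: f_def ac_simps)
      qed
      also have "\<dots> = ?e t * (\<integral>\<^sup>+\<omega>. ext0 f (\<omega> t) \<partial>Q z)"
        by (rule nn_integral_cmult) measurable
      also have "(\<integral>\<^sup>+\<omega>. ext0 f (\<omega> t) \<partial>Q z) = ?U t"
        using True by (intro nn_integral_Q_one_time) auto
      finally show ?thesis using True by simp
    qed (use \<open>t \<noteq> 0\<close> in simp)
  qed
  also have "\<dots> = (\<integral>\<^sup>+y. u \<alpha> z y * (f y * u 0 y z) \<partial>m)"
    using \<alpha>_pos by (intro potential_integral) auto
  also have "\<dots> = potential_chain z gs z"
    unfolding f_def potential_chain_Cons_transform gs ..
  finally show ?thesis .
qed

end

section \<open>Chains of potentials as integrals over product spaces\<close>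

lemma mult_le_sum_squares: "a * b \<le> a\<^sup>2 + (b :: ennreal)\<^sup>2"
proof (cases "a \<le> b")
  case True
  then have "a * b \<le> b\<^sup>2" by (simp add: power2_eq_square mult_right_mono)
  then show ?thesis by (rule order_trans) simp
next
  case False
  then have "a * b \<le> a\<^sup>2" by (simp add: power2_eq_square mult_left_mono)
  then show ?thesis by (rule order_trans) simp
qed

context loop_process
begin

sublocale coordinates: product_sigma_finite "\<lambda>_ :: nat. m"
  by standard

lemma sigma_finite_coordinates: "finite J \<Longrightarrow> sigma_finite_measure (\<Pi>\<^sub>M j\<in>J. m)" for J :: "nat set"
  by (rule coordinates.sigma_finite)

lemma measurable_component: "j \<in> J \<Longrightarrow> (\<lambda>x. x j) \<in> (\<Pi>\<^sub>M j\<in>J. m) \<rightarrow>\<^sub>M borel" for J :: "nat set"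
  using measurable_component_singleton[of j J "\<lambda>_. m"] by (simp add: measurable_cong_sets[OF refl sets_m])

lemma measurable_u_compose:
  "a \<in> N \<rightarrow>\<^sub>M borel \<Longrightarrow> b \<in> N \<rightarrow>\<^sub>M borel \<Longrightarrow> (\<lambda>p. u \<alpha> (a p) (b p)) \<in> borel_measurable N"
  by measurable

lemmas chain_measurable = borel_measurable_times_ennreal borel_measurable_prod_ennreal
  measurable_u_compose measurable_component

text \<open>
  The last variable enters only the last link of the chain, its own factor \<open>g\<close> and the terminal function \<open>w\<close>.
\<close>

lemma nn_integral_last_coordinate:
  fixes g :: "nat \<Rightarrow> 's \<Rightarrow> ennreal" and a :: "(nat \<Rightarrow> 's) \<Rightarrow> ennreal"
  assumes a: "a \<in> borel_measurable (\<Pi>\<^sub>M j\<in>{1..Suc (Suc k)}. m)" "\<And>x y. a (x(Suc (Suc k) := y)) = a x"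
    and g [measurable]: "\<And>j. g j \<in> borel_measurable borel" and w [measurable]: "w \<in> borel_measurable borel"
  shows "(\<integral>\<^sup>+x. a x * (\<Prod>j\<in>{1..<Suc (Suc k)}. u \<alpha> (x j) (x (Suc j))) * w (x (Suc (Suc k))) *
      (\<Prod>j\<in>{1..Suc (Suc k)}. g j (x j)) \<partial>(\<Pi>\<^sub>M j\<in>{1..Suc (Suc k)}. m))
    = (\<integral>\<^sup>+x. a x * (\<Prod>j\<in>{1..<Suc k}. u \<alpha> (x j) (x (Suc j))) *
      (\<integral>\<^sup>+y. u \<alpha> (x (Suc k)) y * (g (Suc (Suc k)) y * w y) \<partial>m) *
      (\<Prod>j\<in>{1..Suc k}. g j (x j)) \<partial>(\<Pi>\<^sub>M j\<in>{1..Suc k}. m))"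
proof -
  let ?u = "\<lambda>x. \<Prod>j\<in>{1..<Suc k}. u \<alpha> (x j) (x (Suc j))" and ?g = "\<lambda>x. \<Prod>j\<in>{1..Suc k}. g j (x j)"
  let ?w = "\<lambda>x. \<integral>\<^sup>+y. u \<alpha> (x (Suc k)) y * (g (Suc (Suc k)) y * w y) \<partial>m"
  let ?I = "{1..Suc k}" and ?K = "Suc (Suc k)"
  let ?F = "\<lambda>x. a x * (\<Prod>j\<in>{1..<?K}. u \<alpha> (x j) (x (Suc j))) * w (x ?K) * (\<Prod>j\<in>{1..?K}. g j (x j))"
  have ins: "{1..?K} = insert ?K ?I" by auto
  have "(\<integral>\<^sup>+x. ?F x \<partial>(\<Pi>\<^sub>M j\<in>{1..?K}. m)) = (\<integral>\<^sup>+x. \<integral>\<^sup>+y. ?F (x(?K := y)) \<partial>m \<partial>(\<Pi>\<^sub>M j\<in>?I. m))"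
    unfolding ins
  proof (rule coordinates.product_nn_integral_insert, simp, simp, unfold ins[symmetric])
    show "?F \<in> borel_measurable (\<Pi>\<^sub>M j\<in>{1..?K}. m)"
      by (intro chain_measurable a(1) measurable_compose[OF measurable_component g]
          measurable_compose[OF measurable_component w]) auto
  qed
  also have "\<dots> = (\<integral>\<^sup>+x. a x * ?u x *
      ?w x * ?g x \<partial>(\<Pi>\<^sub>M j\<in>?I. m))"
  proof (rule nn_integral_cong)
    fix x :: "nat \<Rightarrow> 's"
    have p1: "(\<Prod>j\<in>{1..<?K}. u \<alpha> ((x(?K := y)) j) ((x(?K := y)) (Suc j)))
        = ?u x * u \<alpha> (x (Suc k)) y" for y
      by (simp add: prod.atLeastLessThan_Suc)
    have p2: "(\<Prod>j\<in>{1..?K}. g j ((x(?K := y)) j)) = ?g x * g ?K y" for y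
      by (simp add: prod.atLeast1_atMost_eq prod.cl_ivl_Suc)
    have "(\<integral>\<^sup>+y. ?F (x(?K := y)) \<partial>m) = (\<integral>\<^sup>+y. a x * ?u x *
        ?g x * (u \<alpha> (x (Suc k)) y * (g ?K y * w y)) \<partial>m)"
      unfolding p1 p2 a(2) by (intro nn_integral_cong) (simp add: ac_simps)
    also have "\<dots> = a x * ?u x * ?g x *
        ?w x"
      by (rule nn_integral_cmult) measurable
    finally show "(\<integral>\<^sup>+y. ?F (x(?K := y)) \<partial>m) = a x * ?u x *
        ?w x * ?g x"
      by (simp only: ac_simps)
  qed
  finally show ?thesis .
qed

text \<open>
  The last coordinate is integrated first and absorbed into the terminal function \<open>w\<close>, which is therefore arbitrary.
\<close>

lemma nn_integral_path_product:
  fixes g :: "nat \<Rightarrow> 's \<Rightarrow> ennreal"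
  assumes "\<And>j. g j \<in> borel_measurable borel" and "w \<in> borel_measurable borel"
  shows "(\<integral>\<^sup>+x. u \<alpha> z (x 1) * (\<Prod>j\<in>{1..<Suc k}. u \<alpha> (x j) (x (Suc j))) * w (x (Suc k)) * (\<Prod>j\<in>{1..Suc k}. g j (x j))
      \<partial>(\<Pi>\<^sub>M j\<in>{1..Suc k}. m))
    = foldr (\<lambda>g w x. \<integral>\<^sup>+y. u \<alpha> x y * (g y * w y) \<partial>m) (map g [1..<Suc (Suc k)]) w z"
  using assms(2)
proof (induction k arbitrary: w)
  case 0
  note [measurable] = 0 assms(1)
  have "(\<integral>\<^sup>+x. u \<alpha> z (x 1) * w (x 1) * g 1 (x 1) \<partial>(\<Pi>\<^sub>M j\<in>{1::nat}. m)) = (\<integral>\<^sup>+y. u \<alpha> z y * w y * g 1 y \<partial>m)"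
    by (rule coordinates.product_nn_integral_singleton[where f="\<lambda>y. u \<alpha> z y * w y * g 1 y"]) measurable
  then show ?case by (simp add: ac_simps)
next
  case (Suc k)
  note [measurable] = Suc.prems assms(1)
  define w' where "w' x = (\<integral>\<^sup>+y. u \<alpha> x y * (g (Suc (Suc k)) y * w y) \<partial>m)" for x
  have w': "w' \<in> borel_measurable borel" unfolding w'_def by measurable
  have a: "(\<lambda>x. u \<alpha> z (x 1)) \<in> borel_measurable (\<Pi>\<^sub>M j\<in>{1..Suc (Suc k)}. m)"
    by (intro measurable_u_compose measurable_component measurable_const) auto
  note nn_integral_last_coordinate[of "\<lambda>x. u \<alpha> z (x 1)" k g w, OF a _ assms(1) Suc.prems]
  also note Suc.IH[OF w', unfolded w'_def]
  also have "foldr (\<lambda>g w x. \<integral>\<^sup>+y. u \<alpha> x y * (g y * w y) \<partial>m) (map g [1..<Suc (Suc k)])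
      (\<lambda>x. \<integral>\<^sup>+y. u \<alpha> x y * (g (Suc (Suc k)) y * w y) \<partial>m) z
    = foldr (\<lambda>g w x. \<integral>\<^sup>+y. u \<alpha> x y * (g y * w y) \<partial>m) (map g [1..<Suc (Suc (Suc k))]) w z"
    by simp
  finally show ?case by simp
qed

lemma potential_chain_eq_foldr:
  "potential_chain z gs = foldr (\<lambda>g w x. \<integral>\<^sup>+y. u \<alpha> x y * (g y * w y) \<partial>m) gs (\<lambda>x. u \<alpha> x z)"
  by (induction gs) auto

lemma potential_chain_eq_cyclic_integral:
  assumes "1 \<le> k" and "\<And>j. g j \<in> borel_measurable borel"
  shows "potential_chain z (map g [1..<Suc k]) z =
    (\<integral>\<^sup>+x. cyclic_product (u \<alpha>) k z x * (\<Prod>j=1..k. g j (x j)) \<partial>(\<Pi>\<^sub>M j\<in>{1..k}. m))"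
proof -
  obtain n where k: "k = Suc n" using assms(1) by (cases k) auto
  show ?thesis
    unfolding k potential_chain_eq_foldr cyclic_product_def
    by (rule nn_integral_path_product[symmetric]) (use assms(2) in measurable)
qed

lemma borel_measurable_cyclic_product [measurable]:
  assumes "1 \<le> k"
  shows "(\<lambda>(z, x). cyclic_product (u \<alpha>) k z x) \<in> borel_measurable (m \<Otimes>\<^sub>M (\<Pi>\<^sub>M j\<in>{1..k}. m))"
proof -
  have c: "(\<lambda>p. snd p j) \<in> m \<Otimes>\<^sub>M (\<Pi>\<^sub>M j\<in>{1..k}. m) \<rightarrow>\<^sub>M borel" if "j \<in> {1..k}" for j
    by (rule measurable_compose[OF measurable_snd measurable_component[OF that]])
  have f: "(\<lambda>p. fst p) \<in> m \<Otimes>\<^sub>M (\<Pi>\<^sub>M j\<in>{1..k}. m) \<rightarrow>\<^sub>M borel"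
    using measurable_fst[of m "\<Pi>\<^sub>M j\<in>{1..k}. m"] by (simp add: measurable_cong_sets[OF refl sets_m])
  show ?thesis
    unfolding cyclic_product_def case_prod_beta
    by (intro chain_measurable c f) (use assms in auto)
qed

end

section \<open>Finiteness\<close>

context loop_process
begin

lemma compact_neighbourhood:
  assumes "compact (K :: 's set)"
  obtains K' where "compact K'" "K \<subseteq> interior K'"
proof -
  define \<U> where "\<U> = {U :: 's set. open U \<and> (\<exists>C. compact C \<and> U \<subseteq> C)}"
  have "x \<in> \<Union>\<U>" for x
    by (rule relatively_compact_neighbourhood[of x]) (auto simp: \<U>_def)
  then have cover: "K \<subseteq> \<Union>\<U>" by blast
  have "open U" if "U \<in> \<U>" for U using that by (simp add: \<U>_def)
  then obtain F where F: "F \<subseteq> \<U>" "finite F" "K \<subseteq> \<Union>F"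
    by (rule compactE[OF assms cover])
  have "\<forall>U\<in>F. \<exists>C. compact C \<and> U \<subseteq> C" using F(1) by (auto simp: \<U>_def)
  then obtain C where C: "\<forall>U\<in>F. compact (C U) \<and> U \<subseteq> C U"
    by (rule bchoice[THEN exE])
  show ?thesis
  proof
    show "compact (\<Union>U\<in>F. C U)" using F(2) C by (intro compact_UN) auto
    have "\<Union>F \<subseteq> interior (\<Union>U\<in>F. C U)"
      using C F(1) by (intro interior_maximal open_Union) (auto simp: \<U>_def)
    then show "K \<subseteq> interior (\<Union>U\<in>F. C U)" using F(3) by blast
  qed
qed

lemma u_mono: "u \<alpha> x y \<le> u 0 x y"
  using resolvent_at_0[of x y] by (simp only: le_iff_add) blast

lemma nn_integral_u_le: "(\<integral>\<^sup>+y. u \<alpha> x y \<partial>m) \<le> ennreal (1 / \<alpha>)"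
proof -
  have "(\<integral>\<^sup>+y. u \<alpha> x y \<partial>m) = (\<integral>\<^sup>+t\<in>{0..}. ennreal (exp (- \<alpha> * t)) * (\<integral>\<^sup>+y. 1 \<partial>P t x) \<partial>lborel)"
    using potential_integral[of \<alpha> "\<lambda>_. 1" x] \<alpha>_pos by (simp only: less_imp_le borel_measurable_const mult_1_right)
  also have "\<dots> \<le> (\<integral>\<^sup>+t\<in>{0..}. ennreal (exp (- \<alpha> * t)) \<partial>lborel)"
  proof (rule nn_integral_mono)
    fix t :: real
    have "emeasure (P t x) (space (P t x)) \<le> 1" if "0 \<le> t"
      using subprob_P[OF that] by (rule subprob_space.subprob_emeasure_le_1)
    then show "ennreal (exp (- \<alpha> * t)) * (\<integral>\<^sup>+y. 1 \<partial>P t x) * indicator {0..} t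
        \<le> ennreal (exp (- \<alpha> * t)) * indicator {0..} t"
      using mult_left_mono[of "emeasure (P t x) (space (P t x))" 1 "ennreal (exp (- \<alpha> * t))"]
      by (auto simp: indicator_def)
  qed
  also have "\<dots> = ennreal (1 / \<alpha>)" by (rule nn_integral_exp_tail[OF \<alpha>_pos])
  finally show ?thesis .
qed

text \<open>
  Closing the loop at \<open>z\<close>: near \<open>K\<close> both factors are square integrable, away from \<open>K\<close> the factor
  \<open>u\<^sup>\<alpha>(z,x)\<close> is bounded and \<open>u\<^sup>\<alpha>(y,\<cdot>)\<close> is integrable because \<open>\<alpha> > 0\<close>.
\<close>

lemma loop_closure_bound:
  assumes L2: "\<And>K. compact K \<Longrightarrow> (SUP x. \<integral>\<^sup>+y\<in>K. (u 0 x y + u 0 y x)\<^sup>2 \<partial>m) < \<infinity>"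
    and off_bound: "\<And>K'. compact K' \<Longrightarrow> K \<subseteq> interior K' \<Longrightarrow> (SUP (z, x) \<in> (- K') \<times> K. u \<alpha> z x) < \<infinity>"
    and K: "compact K"
  obtains D where "D < \<infinity>" "\<And>x y. x \<in> K \<Longrightarrow> (\<integral>\<^sup>+z. u \<alpha> z x * u \<alpha> y z \<partial>m) \<le> D"
proof -
  obtain K' where K': "compact K'" "K \<subseteq> interior K'" using compact_neighbourhood[OF K] by blast
  have [measurable]: "K' \<in> sets borel" using K' by (simp add: borel_closed compact_imp_closed)
  define A where "A = (SUP x. \<integral>\<^sup>+y\<in>K'. (u 0 x y + u 0 y x)\<^sup>2 \<partial>m)"
  define B where "B = (SUP (z, x) \<in> (- K') \<times> K. u \<alpha> z x)"
  have A: "A < \<infinity>" unfolding A_def by (rule L2[OF K'(1)])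
  have B: "B < \<infinity>" unfolding B_def by (rule off_bound[OF K'])
  have sq: "(\<integral>\<^sup>+y\<in>K'. (u 0 x y + u 0 y x)\<^sup>2 \<partial>m) \<le> A" for x
    unfolding A_def by (rule SUP_upper) simp
  have "(\<integral>\<^sup>+z. u \<alpha> z x * u \<alpha> y z \<partial>m) \<le> A + A + B * ennreal (1 / \<alpha>)" if x: "x \<in> K" for x y
  proof -
    have "(\<integral>\<^sup>+z. u \<alpha> z x * u \<alpha> y z \<partial>m) \<le> (\<integral>\<^sup>+z. (u 0 x z + u 0 z x)\<^sup>2 * indicator K' z
        + (u 0 y z + u 0 z y)\<^sup>2 * indicator K' z + B * u \<alpha> y z \<partial>m)"
    proof (rule nn_integral_mono)
      fix z
      show "u \<alpha> z x * u \<alpha> y z \<le> (u 0 x z + u 0 z x)\<^sup>2 * indicator K' z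
        + (u 0 y z + u 0 z y)\<^sup>2 * indicator K' z + B * u \<alpha> y z"
      proof (cases "z \<in> K'")
        case True
        have "u \<alpha> z x \<le> u 0 x z + u 0 z x" "u \<alpha> y z \<le> u 0 y z + u 0 z y"
          using u_mono[of z x] u_mono[of y z] by (auto intro: add_increasing add_increasing2)
        then have "u \<alpha> z x * u \<alpha> y z \<le> (u 0 x z + u 0 z x) * (u 0 y z + u 0 z y)"
          by (intro mult_mono) auto
        also have "\<dots> \<le> (u 0 x z + u 0 z x)\<^sup>2 + (u 0 y z + u 0 z y)\<^sup>2" by (rule mult_le_sum_squares)
        also have "\<dots> \<le> (u 0 x z + u 0 z x)\<^sup>2 + (u 0 y z + u 0 z y)\<^sup>2 + B * u \<alpha> y z" by simp
        finally show ?thesis using True by simp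
      next
        case False
        have "u \<alpha> z x \<le> B" unfolding B_def using False x by (intro SUP_upper2[of "(z, x)"]) auto
        then show ?thesis using False by (simp add: mult_right_mono)
      qed
    qed
    also have "\<dots> = (\<integral>\<^sup>+z\<in>K'. (u 0 x z + u 0 z x)\<^sup>2 \<partial>m) + (\<integral>\<^sup>+z\<in>K'. (u 0 y z + u 0 z y)\<^sup>2 \<partial>m) + B * (\<integral>\<^sup>+z. u \<alpha> y z \<partial>m)"
      by (subst nn_integral_add, measurable, subst nn_integral_add, measurable, subst nn_integral_cmult, measurable)
    also have "\<dots> \<le> A + A + B * ennreal (1 / \<alpha>)"
      by (intro add_mono mult_left_mono sq nn_integral_u_le) auto
    finally show ?thesis .
  qed
  moreover have "A + A + B * ennreal (1 / \<alpha>) < \<infinity>"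
    using A B by (simp add: ennreal_mult_less_top)
  ultimately show ?thesis using that by blast
qed

text \<open>
  The last variable is integrated first; on \<open>K\<close> the square integrable function \<open>u(x,\<cdot>)\<close> is integrable, uniformly in \<open>x\<close>,
  because \<open>v \<le> v\<^sup>2 + 1\<close>.
\<close>

lemma open_chain_integral_finite:
  fixes g :: "nat \<Rightarrow> 's \<Rightarrow> ennreal"
  assumes L2: "\<And>K. compact K \<Longrightarrow> (SUP x. \<integral>\<^sup>+y\<in>K. (u 0 x y + u 0 y x)\<^sup>2 \<partial>m) < \<infinity>"
    and K: "compact K" and C: "C < \<infinity>"
    and g [measurable]: "\<And>j. g j \<in> borel_measurable borel" and le: "\<And>j x. g j x \<le> C * indicator K x"
  shows "(\<integral>\<^sup>+x. (\<Prod>j\<in>{1..<Suc k}. u \<alpha> (x j) (x (Suc j))) * (\<Prod>j\<in>{1..Suc k}. g j (x j)) \<partial>(\<Pi>\<^sub>M j\<in>{1..Suc k}. m)) < \<infinity>"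
proof (induction k)
  case 0
  have [measurable]: "K \<in> sets borel" using K by (simp add: borel_closed compact_imp_closed)
  have "(\<integral>\<^sup>+x. g 1 (x 1) \<partial>(\<Pi>\<^sub>M j\<in>{1::nat}. m)) = (\<integral>\<^sup>+y. g 1 y \<partial>m)"
    by (rule coordinates.product_nn_integral_singleton) measurable
  also have "\<dots> \<le> (\<integral>\<^sup>+y. C * indicator K y \<partial>m)" by (intro nn_integral_mono le)
  also have "\<dots> = C * emeasure m K" by (subst nn_integral_cmult) (auto simp: sets_m)
  also have "\<dots> < \<infinity>" using C finite_on_compacts[OF K] by (simp add: ennreal_mult_less_top)
  finally show ?case by simp
next
  case (Suc k)
  let ?I = "{1..Suc k}" and ?K = "Suc (Suc k)"
  have [measurable]: "K \<in> sets borel" using K by (simp add: borel_closed compact_imp_closed)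
  define A where "A = (SUP x. \<integral>\<^sup>+y\<in>K. (u 0 x y + u 0 y x)\<^sup>2 \<partial>m)"
  have A: "A < \<infinity>" unfolding A_def by (rule L2[OF K])
  let ?u = "\<lambda>k x. \<Prod>j\<in>{1..<Suc k}. u \<alpha> (x j) (x (Suc j))" and ?g = "\<lambda>k x. \<Prod>j\<in>{1..Suc k}. g j (x j)"
  let ?D = "C * (A + emeasure m K)"
  have sq: "(\<integral>\<^sup>+y\<in>K. (u 0 x y + u 0 y x)\<^sup>2 \<partial>m) \<le> A" for x
    unfolding A_def by (rule SUP_upper) simp
  have step: "(\<integral>\<^sup>+y. u \<alpha> x y * g ?K y \<partial>m) \<le> ?D" for x
  proof -
    have "(\<integral>\<^sup>+y. u \<alpha> x y * g ?K y \<partial>m) \<le> (\<integral>\<^sup>+y. C * ((u 0 x y + u 0 y x)\<^sup>2 * indicator K y + indicator K y) \<partial>m)"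
    proof (rule nn_integral_mono)
      fix y
      have "u \<alpha> x y \<le> u 0 x y + u 0 y x" using u_mono[of x y] by (auto intro: add_increasing2)
      also have "\<dots> \<le> (u 0 x y + u 0 y x)\<^sup>2 + 1" using mult_le_sum_squares[of "u 0 x y + u 0 y x" 1] by simp
      finally have "u \<alpha> x y * g ?K y \<le> ((u 0 x y + u 0 y x)\<^sup>2 + 1) * (C * indicator K y)"
        using le[of ?K y] by (intro mult_mono) auto
      then show "u \<alpha> x y * g ?K y \<le> C * ((u 0 x y + u 0 y x)\<^sup>2 * indicator K y + indicator K y)"
        by (simp add: algebra_simps)
    qed
    also have "\<dots> = C * ((\<integral>\<^sup>+y\<in>K. (u 0 x y + u 0 y x)\<^sup>2 \<partial>m) + emeasure m K)"
      by (subst nn_integral_cmult, measurable, subst nn_integral_add, measurable)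
    also have "\<dots> \<le> ?D" by (intro mult_left_mono add_mono sq) auto
    finally show ?thesis .
  qed
  have "(\<integral>\<^sup>+x. (\<Prod>j\<in>{1..<?K}. u \<alpha> (x j) (x (Suc j))) * (\<Prod>j\<in>{1..?K}. g j (x j)) \<partial>(\<Pi>\<^sub>M j\<in>{1..?K}. m))
    = (\<integral>\<^sup>+x. ?u k x * (\<integral>\<^sup>+y. u \<alpha> (x (Suc k)) y * g ?K y \<partial>m) *
        ?g k x \<partial>(\<Pi>\<^sub>M j\<in>?I. m))"
    using nn_integral_last_coordinate[of "\<lambda>_. 1" k g "\<lambda>_. 1", OF _ _ g]
    by (simp only: mult_1_left mult_1_right borel_measurable_const)
  also have "\<dots> \<le> (\<integral>\<^sup>+x. ?D * (?u k x * ?g k x) \<partial>(\<Pi>\<^sub>M j\<in>?I. m))"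
  proof (rule nn_integral_mono)
    fix x :: "nat \<Rightarrow> 's"
    have rearrange: "a * b * c = b * (a * c)" for a b c :: ennreal by (simp only: ac_simps)
    show "?u k x * (\<integral>\<^sup>+y. u \<alpha> (x (Suc k)) y * g ?K y \<partial>m) * ?g k x
      \<le> ?D * (?u k x * ?g k x)"
      by (subst rearrange) (intro mult_right_mono step zero_le)
  qed
  also have "\<dots> = ?D * (\<integral>\<^sup>+x. ?u k x * ?g k x \<partial>(\<Pi>\<^sub>M j\<in>?I. m))"
    by (intro nn_integral_cmult chain_measurable measurable_compose[OF measurable_component g]) auto
  also have "\<dots> < \<infinity>"
    using Suc.IH C A finite_on_compacts[OF K] by (simp add: ennreal_mult_less_top del: prod.op_ivl_Suc)
  finally show ?case .
qed

lemma borel_measurable_cyclic_integrand: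
  assumes "1 \<le> k" and g: "\<And>j. g j \<in> borel_measurable borel"
  shows "(\<lambda>(z, x). cyclic_product (u \<alpha>) k z x * (\<Prod>j=1..k. g j (x j)) :: ennreal)
    \<in> borel_measurable (m \<Otimes>\<^sub>M (\<Pi>\<^sub>M j\<in>{1..k}. m))"
proof -
  have "(\<lambda>p. \<Prod>j=1..k. g j (snd p j)) \<in> borel_measurable (m \<Otimes>\<^sub>M (\<Pi>\<^sub>M j\<in>{1..k}. m))"
    by (intro borel_measurable_prod_ennreal measurable_compose[OF measurable_compose[OF measurable_snd measurable_component] g]) auto
  then show ?thesis
    using borel_measurable_cyclic_product[OF assms(1)] unfolding case_prod_beta
    by (rule borel_measurable_times_ennreal[rotated])
qed

text \<open>
  Integrating over \<open>z\<close> removes the two factors that close the loop at a bounded cost and leaves an open chain.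
\<close>

lemma cyclic_integral_finite:
  fixes g :: "nat \<Rightarrow> 's \<Rightarrow> ennreal"
  assumes L2: "\<And>K. compact K \<Longrightarrow> (SUP x. \<integral>\<^sup>+y\<in>K. (u 0 x y + u 0 y x)\<^sup>2 \<partial>m) < \<infinity>"
    and off_bound: "\<And>K'. compact K' \<Longrightarrow> K \<subseteq> interior K' \<Longrightarrow> (SUP (z, x) \<in> (- K') \<times> K. u \<alpha> z x) < \<infinity>"
    and K: "compact K" and C: "C < \<infinity>" and k: "1 \<le> k"
    and g: "\<And>j. g j \<in> borel_measurable borel" and le: "\<And>j x. g j x \<le> C * indicator K x"
  shows "(\<integral>\<^sup>+(z, x). cyclic_product (u \<alpha>) k z x * (\<Prod>j=1..k. g j (x j)) \<partial>(m \<Otimes>\<^sub>M (\<Pi>\<^sub>M j\<in>{1..k}. m))) < \<infinity>"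
proof -
  let ?F = "\<lambda>z x. cyclic_product (u \<alpha>) k z x * (\<Prod>j=1..k. g j (x j))"
  let ?M = "\<Pi>\<^sub>M j\<in>{1..k}. m"
  obtain n where n: "k = Suc n" using k by (cases k) auto
  interpret X: sigma_finite_measure "\<Pi>\<^sub>M j\<in>{1..k}. m" by (rule sigma_finite_coordinates) simp
  interpret MX: pair_sigma_finite m "\<Pi>\<^sub>M j\<in>{1..k}. m" ..
  obtain D where D: "D < \<infinity>" "\<And>x y. x \<in> K \<Longrightarrow> (\<integral>\<^sup>+z. u \<alpha> z x * u \<alpha> y z \<partial>m) \<le> D"
    using loop_closure_bound[OF L2 off_bound K] by blast
  let ?R = "\<lambda>x. (\<Prod>j\<in>{1..<k}. u \<alpha> (x j) (x (Suc j))) * (\<Prod>j\<in>{1..k}. g j (x j))"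
  have "(\<integral>\<^sup>+(z, x). ?F z x \<partial>(m \<Otimes>\<^sub>M ?M))
    = (\<integral>\<^sup>+x. \<integral>\<^sup>+z. ?F z x \<partial>m \<partial>?M)"
    using MX.nn_integral_snd[OF borel_measurable_cyclic_integrand[OF k g]] by simp
  also have "\<dots> \<le> (\<integral>\<^sup>+x. D * ?R x \<partial>?M)"
  proof (rule nn_integral_mono)
    fix x :: "nat \<Rightarrow> 's"
    have "(\<integral>\<^sup>+z. ?F z x \<partial>m)
      = (\<integral>\<^sup>+z. ?R x * (u \<alpha> z (x 1) * u \<alpha> (x k) z) \<partial>m)"
      by (intro nn_integral_cong) (simp add: cyclic_product_def ac_simps)
    also have "\<dots> = ?R x * (\<integral>\<^sup>+z. u \<alpha> z (x 1) * u \<alpha> (x k) z \<partial>m)"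
      by (rule nn_integral_cmult) measurable
    also have "\<dots> \<le> ?R x * D"
    proof (cases "x 1 \<in> K")
      case True
      then show ?thesis by (intro mult_left_mono D) auto
    next
      case False
      then have "g 1 (x 1) = 0" using le[of 1 "x 1"] by simp
      then have "(\<Prod>j\<in>{1..k}. g j (x j)) = 0" using k by (intro prod_zero) auto
      then show ?thesis by (simp only: mult_zero_left mult_zero_right order_refl)
    qed
    finally show "(\<integral>\<^sup>+z. ?F z x \<partial>m) \<le> D * ?R x"
      by (simp only: mult.commute)
  qed
  also have "\<dots> = D * (\<integral>\<^sup>+x. ?R x \<partial>?M)"
    by (intro nn_integral_cmult chain_measurable measurable_compose[OF measurable_component g]) auto
  also have "\<dots> < \<infinity>"
    using D(1) open_chain_integral_finite[OF L2 K C g le, of n] unfolding n by (simp only: ennreal_mult_less_top infinity_ennreal_def simp_thms)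
  finally show ?thesis .
qed

section \<open>The moment formula for nonnegative functions\<close>

lemma loop_moment_formula_nonneg:
  fixes g :: "nat \<Rightarrow> 's \<Rightarrow> ennreal"
  assumes k: "1 \<le> k" and g [measurable]: "\<And>j. g j \<in> borel_measurable borel"
  shows "(\<integral>\<^sup>+\<omega>. (\<Prod>j=1..k. \<integral>\<^sup>+t\<in>{0..}. ext0 (g j) (\<omega> t) \<partial>lborel) * ennreal (exp_lifetime \<alpha> \<omega>) \<partial>nu m Q) =
    (\<Sum>\<pi> | \<pi> permutes {1..k}. \<integral>\<^sup>+(z, x). cyclic_product (u \<alpha>) k z x * (\<Prod>j=1..k. g (\<pi> j) (x j))
      \<partial>(m \<Otimes>\<^sub>M (\<Pi>\<^sub>M j\<in>{1..k}. m)))"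
proof -
  let ?F = "\<lambda>\<pi> z x. cyclic_product (u \<alpha>) k z x * (\<Prod>j=1..k. g (\<pi> j) (x j))"
  let ?M = "\<Pi>\<^sub>M j\<in>{1..k}. m"
  let ?T = "\<lambda>j \<omega>. \<integral>\<^sup>+t\<in>{0..}. ext0 (g j) (\<omega> t) \<partial>lborel"
  let ?S = "{\<pi>. \<pi> permutes {1..k}}"
  let ?J = "\<lambda>\<pi>. ordered_functional (map (\<lambda>j. g (\<pi> j)) [1..<Suc k])"
  interpret X: sigma_finite_measure "\<Pi>\<^sub>M j\<in>{1..k}. m" by (rule sigma_finite_coordinates) simp
  let ?gs = "\<lambda>\<pi>. map (\<lambda>j. g (\<pi> j)) [1..<Suc k]"
  have J: "ordered_functional (?gs \<pi>) 0 \<in> borel_measurable path_space" for \<pi>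
  proof -
    have "(\<lambda>(s, \<omega>). ordered_functional (?gs \<pi>) s \<omega>) \<in> borel_measurable (borel \<Otimes>\<^sub>M path_space)"
      by (rule borel_measurable_ordered_functional) (use g in auto)
    from measurable_compose[OF measurable_Pair1'[of 0 borel path_space] this] show ?thesis
      by (simp del: upt_Suc)
  qed
  have "(\<Prod>j=1..k. ?T j \<omega>) * ennreal (exp_lifetime \<alpha> \<omega>)
      = (\<Sum>\<pi>\<in>?S. ?J \<pi> 0 \<omega>)" if \<omega>: "\<omega> \<in> paths" for \<omega>
  proof -
    have meas: "(\<lambda>t. ext0 (g j) (\<omega> t)) \<in> borel_measurable borel" for j
    proof -
      have "(\<lambda>(t, \<omega>). ext0 (g j) (\<omega> t)) \<in> borel_measurable (borel \<Otimes>\<^sub>M path_space)" by measurable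
      from measurable_compose[OF measurable_Pair2'[of \<omega> path_space borel] this] \<omega> show ?thesis by simp
    qed
    have "(\<Prod>j=1..k. ?T j \<omega>) * ennreal (exp_lifetime \<alpha> \<omega>)
      = ennreal (exp_lifetime \<alpha> \<omega>) * (\<Prod>j\<in>{1..k}. ?T j \<omega>)"
      by (rule mult.commute)
    also have "\<dots> = (\<Sum>js\<in>permutations_of_set {1..k}. time_ordered (ennreal (exp_lifetime \<alpha> \<omega>)) (map (\<lambda>j t. ext0 (g j) (\<omega> t)) js) 0)"
      by (intro prod_time_integrals_eq_sum_orderings finite_atLeastAtMost meas)
    also have "\<dots> = (\<Sum>\<pi>\<in>?S. time_ordered (ennreal (exp_lifetime \<alpha> \<omega>)) (map (\<lambda>j t. ext0 (g j) (\<omega> t)) (map \<pi> [1..<Suc k])) 0)"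
      by (rule sum.reindex_bij_betw[OF bij_betw_permutes_permutations_of_set, symmetric])
    finally show ?thesis by (simp add: ordered_functional_def o_def del: upt_Suc)
  qed
  then have "(\<integral>\<^sup>+\<omega>. (\<Prod>j=1..k. ?T j \<omega>) * ennreal (exp_lifetime \<alpha> \<omega>) \<partial>nu m Q)
      = (\<integral>\<^sup>+\<omega>. (\<Sum>\<pi>\<in>?S. ?J \<pi> 0 \<omega>) \<partial>nu m Q)"
    by (intro nn_integral_cong) (simp only: space_nu)
  also have "\<dots> = (\<Sum>\<pi>\<in>?S. \<integral>\<^sup>+\<omega>. ?J \<pi> 0 \<omega> \<partial>nu m Q)"
    by (rule nn_integral_sum) (simp only: measurable_cong_sets[OF sets_nu refl] J)
  also have "\<dots> = (\<Sum>\<pi>\<in>?S. \<integral>\<^sup>+(z, x). ?F \<pi> z x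
      \<partial>(m \<Otimes>\<^sub>M ?M))"
  proof (intro sum.cong refl)
    fix \<pi>
    have "(\<integral>\<^sup>+\<omega>. ?J \<pi> 0 \<omega> \<partial>nu m Q) = (\<integral>\<^sup>+z. \<integral>\<^sup>+\<omega>. ?J \<pi> 0 \<omega> \<partial>Q z \<partial>m)"
      by (rule nn_integral_nu[OF J])
    also have "\<dots> = (\<integral>\<^sup>+z. potential_chain z (?gs \<pi>) z \<partial>m)"
      using k g by (intro nn_integral_cong Q_ordered_functional_total) (auto simp del: upt_Suc)
    also have "\<dots> = (\<integral>\<^sup>+z. \<integral>\<^sup>+x. ?F \<pi> z x \<partial>?M \<partial>m)"
      by (intro nn_integral_cong potential_chain_eq_cyclic_integral k g)
    also have "\<dots> = (\<integral>\<^sup>+(z, x). ?F \<pi> z x \<partial>(m \<Otimes>\<^sub>M ?M))"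
      using X.nn_integral_fst[OF borel_measurable_cyclic_integrand[OF k, of "\<lambda>j. g (\<pi> j)"]] g by simp
    finally show "(\<integral>\<^sup>+\<omega>. ?J \<pi> 0 \<omega> \<partial>nu m Q)
      = (\<integral>\<^sup>+(z, x). ?F \<pi> z x \<partial>(m \<Otimes>\<^sub>M ?M))" .
  qed
  finally show ?thesis .
qed

end

section \<open>Signed functions\<close>

lemma prod_diff_eq_sum_Pow:
  fixes p n :: "'i \<Rightarrow> real"
  assumes "finite S"
  shows "(\<Prod>i\<in>S. p i - n i) = (\<Sum>X\<in>Pow S. (-1) ^ card X * (\<Prod>i\<in>S. if i \<in> X then n i else p i))"
proof -
  have "(\<Prod>i\<in>S. p i - n i) = (\<Prod>i\<in>S. - n i + p i)" by simp
  also have "\<dots> = (\<Sum>X\<in>Pow S. (\<Prod>i\<in>X. - n i) * (\<Prod>i\<in>S - X. p i))"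
    by (rule prod_add[OF assms])
  also have "\<dots> = (\<Sum>X\<in>Pow S. (-1) ^ card X * (\<Prod>i\<in>S. if i \<in> X then n i else p i))"
  proof (rule sum.cong[OF refl])
    fix X assume X: "X \<in> Pow S"
    then have "S \<inter> X = X" by auto
    then have "(\<Prod>i\<in>S. if i \<in> X then n i else p i) = (\<Prod>i\<in>X. n i) * (\<Prod>i\<in>S - X. p i)"
      using prod.If_cases[OF assms, of "\<lambda>i. i \<in> X" n p] by (simp add: Diff_eq)
    then show "(\<Prod>i\<in>X. - n i) * (\<Prod>i\<in>S - X. p i) = (-1) ^ card X * (\<Prod>i\<in>S. if i \<in> X then n i else p i)"
      by (simp add: prod_uminus)
  qed
  finally show ?thesis .
qed

text \<open>
  Both sides of the moment formula have to be expanded over sets of functions \<open>f i\<close>. In the cyclic integral the product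
  is indexed by the variables \<open>x j\<close>, and this change of index passes from variables to functions.
\<close>

lemma prod_permutes_reindex:
  assumes "\<pi> permutes S"
  shows "(\<Prod>j\<in>S. h (\<pi> j) j) = (\<Prod>i\<in>S. h i (inv \<pi> i))"
  using prod.permute[OF assms, of "\<lambda>i. h i (inv \<pi> i)"] by (simp add: o_def permutes_inverses[OF assms])

lemma integral_enn2real:
  assumes f: "f \<in> borel_measurable M" and fin: "(\<integral>\<^sup>+x. f x \<partial>M) < \<infinity>"
  shows "integrable M (\<lambda>x. enn2real (f x))" "(LINT x|M. enn2real (f x)) = enn2real (\<integral>\<^sup>+x. f x \<partial>M)"
proof -
  have "AE x in M. f x \<noteq> \<infinity>" using fin by (intro nn_integral_PInf_AE f) auto
  then have eq: "(\<integral>\<^sup>+x. ennreal (enn2real (f x)) \<partial>M) = (\<integral>\<^sup>+x. f x \<partial>M)"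
    by (intro nn_integral_cong_AE, eventually_elim) (simp add: less_top[symmetric] ennreal_enn2real_if)
  have m: "(\<lambda>x. enn2real (f x)) \<in> borel_measurable M" using f by measurable
  show "integrable M (\<lambda>x. enn2real (f x))"
    using fin by (intro integrableI_nonneg m) (auto simp: eq)
  show "(LINT x|M. enn2real (f x)) = enn2real (\<integral>\<^sup>+x. f x \<partial>M)"
    using m by (subst integral_eq_nn_integral) (auto simp: eq)
qed

lemma enn2real_prod: "enn2real (\<Prod>i\<in>S. f i) = (\<Prod>i\<in>S. enn2real (f i))"
  by (induction S rule: infinite_finite_induct) (auto simp: enn2real_mult)

lemma real_eq_enn2real_diff: "x = enn2real (ennreal x) - enn2real (ennreal (- x))"
  by (cases "0 \<le> x") (auto simp: ennreal_neg)

text \<open>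
  On a path with finite lifetime a bounded function has an absolutely convergent time integral. Paths with infinite
  lifetime do not contribute to the theorem, since \<open>exp(-\<alpha>\<zeta>) = 0\<close> for them.
\<close>

lemma time_integral_eq_diff:
  fixes f :: "'s::topological_space \<Rightarrow> real"
  assumes \<omega>: "\<omega> \<in> paths" and life: "lifetime \<omega> \<noteq> \<infinity>"
    and meas: "(\<lambda>t. ext0 f (\<omega> t)) \<in> borel_measurable borel" and bound: "\<And>x. \<bar>f x\<bar> \<le> c"
  shows "(LBINT t:{0..}. ext0 f (\<omega> t)) =
    enn2real (\<integral>\<^sup>+t\<in>{0..}. ext0 (\<lambda>x. ennreal (f x)) (\<omega> t) \<partial>lborel)
    - enn2real (\<integral>\<^sup>+t\<in>{0..}. ext0 (\<lambda>x. ennreal (- f x)) (\<omega> t) \<partial>lborel)"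
proof -
  obtain L where L: "0 < L" "lifetime \<omega> \<le> ereal L"
  proof (cases "lifetime \<omega>")
    case (real r)
    then show ?thesis by (intro that[of "max r 1"]) auto
  next
    case MInf
    then show ?thesis by (intro that[of 1]) auto
  qed (use life in auto)
  have c: "0 \<le> c" using bound[of undefined] by (meson abs_ge_zero order_trans)
  have "integrable lborel (\<lambda>t. indicator {0..} t *\<^sub>R ext0 f (\<omega> t))"
  proof (rule Bochner_Integration.integrable_bound)
    show "integrable lborel (\<lambda>t. indicator {0..L} t *\<^sub>R c)"
      by (rule integrable_indicator) (simp_all add: emeasure_lborel_Icc_eq)
    show "(\<lambda>t. indicator {0..} t *\<^sub>R ext0 f (\<omega> t)) \<in> borel_measurable lborel"
      using meas by (intro borel_measurable_scaleR) auto
    show "AE t in lborel. norm (indicator {0..} t *\<^sub>R ext0 f (\<omega> t)) \<le> norm (indicator {0..L} t *\<^sub>R c)"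
    proof (rule AE_I2)
      fix t :: real
      show "norm (indicator {0..} t *\<^sub>R ext0 f (\<omega> t)) \<le> norm (indicator {0..L} t *\<^sub>R c)"
      proof (cases "0 \<le> t \<and> L < t")
        case True
        then have "lifetime \<omega> \<le> ereal t" using L(2) by (auto intro: order_trans)
        then have "\<omega> t = None" using dead_iff_lifetime_le[OF \<omega>, of t] True L by auto
        then show ?thesis by simp
      next
        case False
        then show ?thesis using bound c by (cases "\<omega> t") (auto simp: indicator_def)
      qed
    qed
  qed
  from real_lebesgue_integral_def[OF this]
  have "(LBINT t:{0..}. ext0 f (\<omega> t)) = enn2real (\<integral>\<^sup>+t. ennreal (indicator {0..} t *\<^sub>R ext0 f (\<omega> t)) \<partial>lborel)
      - enn2real (\<integral>\<^sup>+t. ennreal (- (indicator {0..} t *\<^sub>R ext0 f (\<omega> t))) \<partial>lborel)"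
    by (simp only: set_lebesgue_integral_def)
  moreover have "ennreal (indicator {0..} t *\<^sub>R ext0 f (\<omega> t)) = ext0 (\<lambda>x. ennreal (f x)) (\<omega> t) * indicator {0..} t" for t
    by (cases "\<omega> t") (auto simp: indicator_def)
  moreover have "ennreal (- (indicator {0..} t *\<^sub>R ext0 f (\<omega> t))) = ext0 (\<lambda>x. ennreal (- f x)) (\<omega> t) * indicator {0..} t" for t
    by (cases "\<omega> t") (auto simp: indicator_def)
  ultimately show ?thesis by (simp only:)
qed

context loop_process
begin

text \<open>
  Both sides are multilinear in the functions \<open>f j\<close>. The set \<open>X\<close> below collects the indices at which the negative part is
  taken, so that \<open>g X j\<close> is the negative or the positive part of \<open>f j\<close>; on each term the nonnegative formula applies, and its
  finiteness allows the terms to be added up again.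
\<close>

lemma loop_moment_formula:
  fixes f :: "nat \<Rightarrow> 's \<Rightarrow> real"
  assumes L2: "\<And>K. compact K \<Longrightarrow> (SUP x. \<integral>\<^sup>+y\<in>K. (u 0 x y + u 0 y x)\<^sup>2 \<partial>m) < \<infinity>"
    and off_bound: "\<And>K'. compact K' \<Longrightarrow> K \<subseteq> interior K' \<Longrightarrow> (SUP (z, x) \<in> (- K') \<times> K. u \<alpha> z x) < \<infinity>"
    and K: "compact K" and k: "1 \<le> k"
    and f: "\<And>j. f j \<in> borel_measurable borel" and le: "\<And>j x. \<bar>f j x\<bar> \<le> c * indicator K x"
  shows
    "(\<integral>\<^sup>+\<omega>. (\<Prod>j=1..k. \<integral>\<^sup>+t\<in>{0..}. ennreal \<bar>ext0 (f j) (\<omega> t)\<bar> \<partial>lborel)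
        * ennreal (exp_lifetime \<alpha> \<omega>) \<partial>nu m Q) < \<infinity>" (is ?loop_finite)
    and "\<pi> permutes {1..k} \<Longrightarrow>
      (\<integral>\<^sup>+(z, x). cyclic_product (u \<alpha>) k z x * (\<Prod>j=1..k. ennreal \<bar>f (\<pi> j) (x j)\<bar>)
        \<partial>(m \<Otimes>\<^sub>M (\<Pi>\<^sub>M j\<in>{1..k}. m))) < \<infinity>" (is "_ \<Longrightarrow> ?cyclic_finite")
    and "(LINT \<omega>|nu m Q. (\<Prod>j=1..k. LBINT t:{0..}. ext0 (f j) (\<omega> t)) * exp_lifetime \<alpha> \<omega>) =
      (\<Sum>\<pi> | \<pi> permutes {1..k}.
        LINT (z, x)|(m \<Otimes>\<^sub>M (\<Pi>\<^sub>M j\<in>{1..k}. m)).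
          enn2real (cyclic_product (u \<alpha>) k z x) * (\<Prod>j=1..k. f (\<pi> j) (x j)))" (is ?formula)
proof -
  let ?MX = "m \<Otimes>\<^sub>M (\<Pi>\<^sub>M j\<in>{1..k}. m)"
  let ?S = "{1..k}"
  let ?T = "\<lambda>f \<omega>. \<integral>\<^sup>+t\<in>{0..}. ext0 f (\<omega> t) \<partial>lborel :: ennreal"
  let ?L = "\<lambda>\<omega>. (\<Prod>j=1..k. LBINT t:{0..}. ext0 (f j) (\<omega> t)) * exp_lifetime \<alpha> \<omega>"
  let ?C = "\<lambda>\<pi> z x. enn2real (cyclic_product (u \<alpha>) k z x) * (\<Prod>j=1..k. f (\<pi> j) (x j))"
  let ?sgn = "\<lambda>X. (-1) ^ card X :: real"
  let ?i = "\<lambda>X i x. if i \<in> X then enn2real (ennreal (- f i x)) else enn2real (ennreal (f i x))"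
  have fin: "(\<integral>\<^sup>+(z, x). cyclic_product (u \<alpha>) k z x * (\<Prod>j=1..k. g j (x j)) \<partial>?MX) < \<infinity>"
    if "\<And>j. g j \<in> borel_measurable borel" "\<And>j x. g j x \<le> ennreal c * indicator K x" for g :: "nat \<Rightarrow> 's \<Rightarrow> ennreal"
    by (rule cyclic_integral_finite[OF L2 off_bound K _ k that]) auto
  have le': "ennreal y \<le> ennreal c * indicator K x" if "y \<le> \<bar>f j x\<bar>" for y j x
  proof -
    have "ennreal y \<le> ennreal (c * indicator K x)"
      using that le[of j x] by (intro ennreal_leI) simp
    then show ?thesis by (auto simp: indicator_def)
  qed
  have abs_meas: "(\<lambda>x. ennreal \<bar>f j x\<bar>) \<in> borel_measurable borel" for j
    using f[of j] by measurable
  have cyc: "(\<integral>\<^sup>+(z, x). cyclic_product (u \<alpha>) k z x * (\<Prod>j=1..k. ennreal \<bar>f (\<rho> j) (x j)\<bar>) \<partial>?MX) < \<infinity>" for \<rho>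
    by (rule fin[OF abs_meas]) (rule le', rule order_refl)
  then show ?cyclic_finite .
  have "ennreal \<bar>ext0 (f j) w\<bar> = ext0 (\<lambda>x. ennreal \<bar>f j x\<bar>) w" for j w
    by (cases w) auto
  then show ?loop_finite
    using loop_moment_formula_nonneg[OF k abs_meas, of "\<lambda>j. j"] cyc
    by (simp add: finite_permutations)
  define s where "s X j = (if j \<in> X then -1 else 1 :: real)" for X and j :: nat
  define g where "g X j x = ennreal (s X j * f j x)" for X j x
  have g: "g X j \<in> borel_measurable borel" for X j
    unfolding g_def using f[of j] by measurable
  have g_le: "g X j x \<le> ennreal c * indicator K x" for X j x
    unfolding g_def by (rule le'[of _ j]) (auto simp: s_def)
  define \<Phi> where "\<Phi> X \<omega> = (\<Prod>j=1..k. ?T (g X j) \<omega>) * ennreal (exp_lifetime \<alpha> \<omega>)" for X \<omega>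
  define \<Psi> where "\<Psi> X \<pi> p = (case p of (z, x) \<Rightarrow> cyclic_product (u \<alpha>) k z x * (\<Prod>j=1..k. g X (\<pi> j) (x j)))" for X \<pi> p
  have \<Psi>_meas: "\<Psi> X \<pi> \<in> borel_measurable ?MX" for X \<pi>
    unfolding \<Psi>_def[abs_def] by (rule borel_measurable_cyclic_integrand[OF k]) (rule g)
  have \<Psi>_fin: "(\<integral>\<^sup>+p. \<Psi> X \<pi> p \<partial>?MX) < \<infinity>" for X \<pi>
    unfolding \<Psi>_def by (rule fin) (auto intro: g g_le)
  have \<Phi>_int: "(\<integral>\<^sup>+\<omega>. \<Phi> X \<omega> \<partial>nu m Q) = (\<Sum>\<pi> | \<pi> permutes ?S. \<integral>\<^sup>+p. \<Psi> X \<pi> p \<partial>?MX)" for X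
    unfolding \<Phi>_def \<Psi>_def by (rule loop_moment_formula_nonneg[OF k g])
  have \<Phi>_fin: "(\<integral>\<^sup>+\<omega>. \<Phi> X \<omega> \<partial>nu m Q) < \<infinity>" for X
    unfolding \<Phi>_int using \<Psi>_fin by (simp add: finite_permutations)
  have \<Phi>_meas: "\<Phi> X \<in> borel_measurable (nu m Q)" for X
  proof -
    have "(\<lambda>\<omega>. ?T (g X j) \<omega>) \<in> borel_measurable path_space" for j
    proof -
      note [measurable] = g[of X j]
      show ?thesis by measurable
    qed
    then have "\<Phi> X \<in> borel_measurable path_space"
      unfolding \<Phi>_def[abs_def]
      by (intro borel_measurable_times_ennreal borel_measurable_prod_ennreal) auto
    then show ?thesis by (simp only: measurable_cong_sets[OF sets_nu refl])
  qed
  have loop: "?L \<omega>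
      = (\<Sum>X\<in>Pow ?S. ?sgn X * enn2real (\<Phi> X \<omega>))" if \<omega>: "\<omega> \<in> paths" for \<omega>
  proof (cases "lifetime \<omega> = \<infinity>")
    case True
    then show ?thesis by (simp add: exp_lifetime_def \<Phi>_def)
  next
    case False
    let ?p = "\<lambda>j. enn2real (\<integral>\<^sup>+t\<in>{0..}. ext0 (\<lambda>x. ennreal (f j x)) (\<omega> t) \<partial>lborel)"
    let ?n = "\<lambda>j. enn2real (\<integral>\<^sup>+t\<in>{0..}. ext0 (\<lambda>x. ennreal (- f j x)) (\<omega> t) \<partial>lborel)"
    have "(LBINT t:{0..}. ext0 (f j) (\<omega> t)) = ?p j - ?n j" for j
    proof (rule time_integral_eq_diff[OF \<omega> False])
      note [measurable] = f[of j]
      have "(\<lambda>(t, \<omega>). ext0 (f j) (\<omega> t)) \<in> borel_measurable (borel \<Otimes>\<^sub>M path_space)" by measurable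
      from measurable_compose[OF measurable_Pair2'[of \<omega> path_space borel] this] \<omega>
      show "(\<lambda>t. ext0 (f j) (\<omega> t)) \<in> borel_measurable borel" by simp
      fix x
      have "c * indicator K x \<le> \<bar>c\<bar>" by (auto simp: indicator_def)
      then show "\<bar>f j x\<bar> \<le> \<bar>c\<bar>" using le[of j x] by linarith
    qed
    then have "(\<Prod>j=1..k. LBINT t:{0..}. ext0 (f j) (\<omega> t)) = (\<Prod>j\<in>?S. ?p j - ?n j)" by (simp only:)
    also have "\<dots> = (\<Sum>X\<in>Pow ?S. ?sgn X * (\<Prod>j\<in>?S. if j \<in> X then ?n j else ?p j))"
      by (rule prod_diff_eq_sum_Pow) simp
    also have "\<dots> = (\<Sum>X\<in>Pow ?S. ?sgn X * enn2real (\<Prod>j=1..k. ?T (g X j) \<omega>))"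
      unfolding enn2real_prod
    proof (intro sum.cong refl arg_cong2[where f="(*)"] prod.cong)
      fix X j show "(if j \<in> X then ?n j else ?p j) = enn2real (?T (g X j) \<omega>)"
        by (simp add: g_def[abs_def] s_def)
    qed
    finally show ?thesis
      by (simp add: \<Phi>_def enn2real_mult sum_distrib_right exp_lifetime_nonneg mult.assoc)
  qed
  have cyclic: "?C \<pi> z x
      = (\<Sum>X\<in>Pow ?S. ?sgn X * enn2real (\<Psi> X \<pi> (z, x)))" if \<pi>: "\<pi> permutes ?S" for \<pi> z x
  proof -
    have "(\<Prod>j=1..k. f (\<pi> j) (x j)) = (\<Prod>i\<in>?S. f i (x (inv \<pi> i)))"
      by (rule prod_permutes_reindex[OF \<pi>, of "\<lambda>i j. f i (x j)"])
    also have "\<dots> = (\<Prod>i\<in>?S. enn2real (ennreal (f i (x (inv \<pi> i)))) - enn2real (ennreal (- f i (x (inv \<pi> i)))))"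
      by (intro prod.cong refl real_eq_enn2real_diff)
    also have "\<dots> = (\<Sum>X\<in>Pow ?S. ?sgn X *
        (\<Prod>i\<in>?S. ?i X i (x (inv \<pi> i))))"
      by (rule prod_diff_eq_sum_Pow) simp
    also have "\<dots> = (\<Sum>X\<in>Pow ?S. ?sgn X * enn2real (\<Prod>j=1..k. g X (\<pi> j) (x j)))"
    proof (intro sum.cong refl arg_cong2[where f="(*)"])
      fix X
      have "(\<Prod>i\<in>?S. ?i X i (x (inv \<pi> i)))
          = (\<Prod>i\<in>?S. enn2real (g X i (x (inv \<pi> i))))"
        by (intro prod.cong refl) (simp add: g_def s_def)
      also have "\<dots> = (\<Prod>j\<in>?S. enn2real (g X (\<pi> j) (x j)))"
        by (rule prod_permutes_reindex[OF \<pi>, of "\<lambda>i j. enn2real (g X i (x j))", symmetric])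
      finally show "(\<Prod>i\<in>?S. ?i X i (x (inv \<pi> i)))
          = enn2real (\<Prod>j=1..k. g X (\<pi> j) (x j))"
        by (simp only: enn2real_prod)
    qed
    finally show ?thesis
      by (simp add: \<Psi>_def enn2real_mult sum_distrib_left mult.left_commute)
  qed
  have "(LINT \<omega>|nu m Q. ?L \<omega>)
      = (LINT \<omega>|nu m Q. (\<Sum>X\<in>Pow ?S. ?sgn X * enn2real (\<Phi> X \<omega>)))"
    by (intro Bochner_Integration.integral_cong refl loop) (simp only: space_nu)
  also have "\<dots> = (\<Sum>X\<in>Pow ?S. ?sgn X * enn2real (\<integral>\<^sup>+\<omega>. \<Phi> X \<omega> \<partial>nu m Q))"
    using integral_enn2real[OF \<Phi>_meas \<Phi>_fin] by (subst Bochner_Integration.integral_sum) auto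
  also have "\<dots> = (\<Sum>X\<in>Pow ?S. \<Sum>\<pi> | \<pi> permutes ?S. ?sgn X * enn2real (\<integral>\<^sup>+p. \<Psi> X \<pi> p \<partial>?MX))"
    unfolding \<Phi>_int using \<Psi>_fin by (simp add: enn2real_sum sum_distrib_left o_def)
  also have "\<dots> = (\<Sum>\<pi> | \<pi> permutes ?S. \<Sum>X\<in>Pow ?S. ?sgn X * enn2real (\<integral>\<^sup>+p. \<Psi> X \<pi> p \<partial>?MX))"
    by (rule sum.swap)
  also have "\<dots> = (\<Sum>\<pi> | \<pi> permutes ?S. LINT p|?MX. (\<Sum>X\<in>Pow ?S. ?sgn X * enn2real (\<Psi> X \<pi> p)))"
    using integral_enn2real[OF \<Psi>_meas \<Psi>_fin] by (subst Bochner_Integration.integral_sum) auto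
  also have "\<dots> = (\<Sum>\<pi> | \<pi> permutes ?S. LINT (z, x)|?MX. ?C \<pi> z x)"
  proof (intro sum.cong refl Bochner_Integration.integral_cong)
    fix \<pi> p assume "\<pi> \<in> {\<pi>. \<pi> permutes ?S}"
    then have "\<pi> permutes ?S" by (rule CollectD)
    from cyclic[OF this]
    show "(\<Sum>X\<in>Pow ?S. ?sgn X * enn2real (\<Psi> X \<pi> p))
        = (case p of (z, x) \<Rightarrow> ?C \<pi> z x)"
      by (cases p) (simp only: prod.case)
  qed
  finally show ?formula .
qed

end

theorem theorem1p2:
  fixes P :: "real \<Rightarrow> 's::{t2_space, second_countable_topology} \<Rightarrow> 's measure"
    and Px :: "'s \<Rightarrow> 's path measure"
    and m :: "'s measure"
    and u :: "real \<Rightarrow> 's \<Rightarrow> 's \<Rightarrow> ennreal"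
    and Q :: "'s \<Rightarrow> 's path measure"
    and k :: nat
    and \<alpha> :: real
    and f :: "nat \<Rightarrow> 's \<Rightarrow> real"
  assumes "locally_compact_space (euclidean :: 's topology)"
    and "borel_right_process P Px"
    and "transient P"
    and "sets m = sets borel"
    and "\<And>K. compact K \<Longrightarrow> emeasure m K < \<infinity>"
    and "potential_densities P m u"
    and "resolvent_equations m u"
    and "\<And>y. excessive P 0 (\<lambda>x. u 0 x y)"
    and "\<And>x. u 0 x x = \<infinity>"
    and "\<And>x y. x \<noteq> y \<Longrightarrow> u 0 x y < \<infinity>"
    and "\<And>y. polar_point Px y"
    and "\<And>K. compact K \<Longrightarrow> (SUP x. \<integral>\<^sup>+y\<in>K. (u 0 x y + u 0 y x)\<^sup>2 \<partial>m) < \<infinity>"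
    and "\<And>\<beta> K K'. \<beta> > 0 \<Longrightarrow> compact K \<Longrightarrow> compact K' \<Longrightarrow> K \<subseteq> interior K' \<Longrightarrow>
           (SUP (z, x) \<in> (- K') \<times> K. u \<beta> z x) < \<infinity>"
    and "\<And>z. is_Qzz P (u 0) z (Q z)"
    and "k \<ge> 1"
    and "\<alpha> > 0"
    and "\<And>j. j \<in> {1..k} \<Longrightarrow> f j \<in> borel_measurable borel"
    and "\<And>j. j \<in> {1..k} \<Longrightarrow> bounded (range (f j))"
    and "\<And>j. j \<in> {1..k} \<Longrightarrow> compact (closure {x. f j x \<noteq> 0})"
  shows
    "(\<integral>\<^sup>+\<omega>. (\<Prod>j=1..k. \<integral>\<^sup>+t\<in>{0..}. ennreal \<bar>ext0 (f j) (\<omega> t)\<bar> \<partial>lborel)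
        * ennreal (exp_lifetime \<alpha> \<omega>) \<partial>nu m Q) < \<infinity> \<and>
     (\<forall>\<pi>. \<pi> permutes {1..k} \<longrightarrow>
      (\<integral>\<^sup>+(z, x). cyclic_product (u \<alpha>) k z x * (\<Prod>j=1..k. ennreal \<bar>f (\<pi> j) (x j)\<bar>)
        \<partial>(m \<Otimes>\<^sub>M (\<Pi>\<^sub>M j\<in>{1..k}. m))) < \<infinity>) \<and>
     (LINT \<omega>|nu m Q. (\<Prod>j=1..k. LBINT t:{0..}. ext0 (f j) (\<omega> t)) * exp_lifetime \<alpha> \<omega>) =
      (\<Sum>\<pi> | \<pi> permutes {1..k}.
        LINT (z, x)|(m \<Otimes>\<^sub>M (\<Pi>\<^sub>M j\<in>{1..k}. m)).
          enn2real (cyclic_product (u \<alpha>) k z x) * (\<Prod>j=1..k. f (\<pi> j) (x j)))"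
proof -
  interpret loop_process P Px m u Q \<alpha>
    by standard (fact assms)+
  let ?C = "\<lambda>f \<pi>. LINT (z, x)|(m \<Otimes>\<^sub>M (\<Pi>\<^sub>M j\<in>{1..k}. m)).
    enn2real (cyclic_product (u \<alpha>) k z x) * (\<Prod>j=1..k. f (\<pi> j) (x j))"
  \<comment> \<open>Nothing is known about \<open>f j\<close> for \<open>j\<close> outside \<open>{1..k}\<close>, so it is replaced by \<open>0\<close> there.\<close>
  define F where "F j = (if j \<in> {1..k} then f j else (\<lambda>_. 0))" for j
  define K where "K = (\<Union>j\<in>{1..k}. closure {x. f j x \<noteq> 0})"
  have K: "compact K" unfolding K_def by (intro compact_UN assms(19)) auto
  have "\<forall>j\<in>{1..k}. \<exists>b. \<forall>x. \<bar>f j x\<bar> \<le> b"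
    using assms(18) by (auto simp: bounded_iff)
  then obtain b where b: "\<And>j x. j \<in> {1..k} \<Longrightarrow> \<bar>f j x\<bar> \<le> b j"
    by (metis bchoice)
  define c where "c = (\<Sum>j\<in>{1..k}. \<bar>b j\<bar>)"
  have F_le: "\<bar>F j x\<bar> \<le> c * indicator K x" for j x
  proof (cases "j \<in> {1..k} \<and> f j x \<noteq> 0")
    case True
    then have "x \<in> K" using closure_subset[of "{x. f j x \<noteq> 0}"] by (auto simp: K_def)
    moreover have "\<bar>b j\<bar> \<le> c" unfolding c_def using True by (intro member_le_sum) auto
    moreover have "\<bar>f j x\<bar> \<le> \<bar>b j\<bar>" using b[of j x] True by linarith
    ultimately show ?thesis using True by (simp add: F_def)
  next
    case False
    have "0 \<le> c" unfolding c_def by (intro sum_nonneg) auto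
    then show ?thesis using False by (auto simp: F_def)
  qed
  have F_meas: "F j \<in> borel_measurable borel" for j
    using assms(17)[of j] by (auto simp: F_def)
  note formula = loop_moment_formula[where f=F and K=K and k=k and c=c,
    OF assms(12) assms(13)[OF assms(16) K] K assms(15) F_meas F_le]
  have F_eq: "F j = f j" if "j \<in> {1..k}" for j using that by (simp add: F_def)
  have F_perm: "F (\<pi> j) = f (\<pi> j)" if "\<pi> permutes {1..k}" "j \<in> {1..k}" for \<pi> j
    using permutes_in_image[OF that(1)] that(2) by (intro F_eq) blast
  have cyclic_eq: "?C F \<pi> = ?C f \<pi>" if "\<pi> permutes {1..k}" for \<pi>
    using F_perm[OF that] by (simp only: cong: prod.cong)
  show ?thesis
  proof (intro conjI allI impI, goal_cases)
    case 1
    show ?case using formula(1) by (simp only: F_eq cong: prod.cong)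
  next
    case (2 \<pi>)
    then show ?case using formula(2)[of \<pi>] F_perm[OF 2] by (simp only: cong: prod.cong)
  next
    case 3
    have "(\<Sum>\<pi> | \<pi> permutes {1..k}. ?C F \<pi>) = (\<Sum>\<pi> | \<pi> permutes {1..k}. ?C f \<pi>)"
      by (intro sum.cong refl cyclic_eq) (simp only: mem_Collect_eq)
    then show ?case using formula(3) by (simp only: F_eq cong: prod.cong)
  qed
qed

end
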